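(* For any $d \geq 3$, any $d\times d\times d$ tensor $T$ satisfies \[ \underset{\sim}{\mathrm{R}}(T) \leq \sqrt{d^{\frac 4 3 \omega} - \left\lfloor \frac d 3 \right\rfloor\cdot (2^{\frac \omega 3} - 1)d^{\frac 2 3 \omega}} < d^{\frac 2 3 \omega}.\]
   Context: $\omega$ is the matrix multiplication exponent. For a tensor $T$, $\mathrm{R}(T)$ denotes its tensor rank and $\underset{\sim}{\mathrm{R}}(T) = \lim_{n\to\infty} \mathrm{R}(T^{\otimes n})^{1/n}$ its asymptotic rank. $\langle n,m,p\rangle$ denotes the matrix multiplication tensor $\sum_{i,j,k} x_{ij}y_{jk}z_{ki}$; Strassen's previous general bound $\underset{\sim}{\mathrm{R}}(T)\le d^{2\omega/3}$ comes from $T\le \langle d,1,d\rangle$ and its mode permutations. *)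

theory Defs
  imports Complex_Main "HOL-Library.Landau_Symbols"
begin

text \<open>A tensor of order three is given by its coordinates \<open>T a b c\<close>, with \<open>a\<close>, \<open>b\<close>, \<open>c\<close> ranging
  over finite index sets \<open>A\<close>, \<open>B\<close>, \<open>C\<close> that are passed separately; values of \<open>T\<close> outside
  \<open>A \<times> B \<times> C\<close> are irrelevant. A \<open>d \<times> d \<times> d\<close> tensor has \<open>A = B = C = {..<d}\<close>.\<close>

definition tensor_rank ::
    "'i set \<Rightarrow> 'j set \<Rightarrow> 'k set \<Rightarrow> ('i \<Rightarrow> 'j \<Rightarrow> 'k \<Rightarrow> 'a::field) \<Rightarrow> nat" where
  "tensor_rank A B C T =
     (LEAST r. \<exists>u v w. \<forall>a\<in>A. \<forall>b\<in>B. \<forall>c\<in>C. T a b c = (\<Sum>s<r. u s a * v s b * w s c))"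

text \<open>The coordinates of the Kronecker power \<open>T\<^sup>\<otimes>\<^sup>n\<close> are indexed by lists of length \<open>n\<close>.\<close>

definition index_pow :: "nat \<Rightarrow> 'i set \<Rightarrow> 'i list set" where
  "index_pow n A = {xs. set xs \<subseteq> A \<and> length xs = n}"

definition kron_pow ::
    "nat \<Rightarrow> ('i \<Rightarrow> 'j \<Rightarrow> 'k \<Rightarrow> 'a::field) \<Rightarrow> 'i list \<Rightarrow> 'j list \<Rightarrow> 'k list \<Rightarrow> 'a" where
  "kron_pow n T xs ys zs = (\<Prod>t<n. T (xs ! t) (ys ! t) (zs ! t))"

text \<open>The limit exists for finite index sets, since the rank is submultiplicative under
  Kronecker products (Fekete).\<close>

definition asymptotic_rank ::
    "'i set \<Rightarrow> 'j set \<Rightarrow> 'k set \<Rightarrow> ('i \<Rightarrow> 'j \<Rightarrow> 'k \<Rightarrow> 'a::field) \<Rightarrow> real" where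
  "asymptotic_rank A B C T =
     lim (\<lambda>n. root n (real (tensor_rank (index_pow n A) (index_pow n B) (index_pow n C)
                                        (kron_pow n T))))"

text \<open>Coordinates of \<open>\<langle>n,m,p\<rangle> = \<Sum>i<n. \<Sum>j<m. \<Sum>k<p. x\<^sub>i\<^sub>j y\<^sub>j\<^sub>k z\<^sub>k\<^sub>i\<close>; they do not mention \<open>n\<close>, \<open>m\<close>, \<open>p\<close>,
  which enter through the index sets only.\<close>

definition matmul_tensor :: "nat \<times> nat \<Rightarrow> nat \<times> nat \<Rightarrow> nat \<times> nat \<Rightarrow> 'a::field" where
  "matmul_tensor = (\<lambda>(i, j) (j', k) (k', i'). if i = i' \<and> j = j' \<and> k = k' then 1 else 0)"

definition matmul_rank :: "'a::field itself \<Rightarrow> nat \<Rightarrow> nat \<Rightarrow> nat \<Rightarrow> nat" where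
  "matmul_rank _ n m p =
     tensor_rank ({..<n} \<times> {..<m}) ({..<m} \<times> {..<p}) ({..<p} \<times> {..<n})
       (matmul_tensor :: _ \<Rightarrow> _ \<Rightarrow> _ \<Rightarrow> 'a)"

text \<open>The exponent \<open>\<omega>\<close> may depend on the ground field, hence the type argument.\<close>

definition matmul_exponent :: "'a::field itself \<Rightarrow> real" where
  "matmul_exponent F =
     Inf {\<tau>::real. (\<lambda>n. real (matmul_rank F n n n)) \<in> O(\<lambda>n. real n powr \<tau>)}"

end

(* Cutting the two factors of T^2 = T (x) T along different modes embeds T^2 into <d, d, d^2>, and
   this embedding uses only d^2 of the d^3 coordinates in two of the modes. The room left over lets
   s = floor(d/3) further tensors degenerate out of the same matrix product, in the manner of
   Schoenhage and Coppersmith-Winograd: T^2 (+) s <1, 1, 2 d^2> is a degeneration of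
   <d, d, d^2> (+) s <1, 1, d^2>, and likewise for the cyclic rotations.

   To exploit this, asymptotic rank is replaced by a monotone functional Phi on the tensors
   T^p (x) <n, m, l> that is multiplicative along T, <2,1,1>, <1,2,1>, agrees with asymptotic rank
   on T and is bounded by it everywhere. It is obtained from asymptotic rank by successive
   "directional derivatives" lim_M Phi (V^M w) / Phi (V)^M, an elementary substitute for a point of
   Strassen's asymptotic spectrum. With n^a1, n^a2, n^a3 the values of Phi on <n,1,1>, <1,n,1>,
   <1,1,n>, we have a1 + a2 + a3 <= omega, and each degeneration yields
   t^2 + s (2 d^2)^a <= d^(omega + a) + s d^(2 a) for the asymptotic rank t of T and a = a1, a2, a3.
   Some a is at most omega / 3, and for such a the resulting bound on t^2 is at most its value at
   a = omega / 3. *)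
theory Submission
  imports Defs "HOL-Computational_Algebra.Polynomial"
begin

section \<open>Rank decompositions\<close>

text \<open>The obstacle is the direct sum on the left of the degeneration. An upper bound for a sum
  follows by expanding its powers into words, but a lower bound needs lower bounds for the mixed
  products of T^(2k) with <1, 1, 2 d^2>^j, and asymptotic rank is only submultiplicative.
  Multiplicativity along T supplies these; multiplicativity along <2,1,1> and <1,2,1> is what makes
  a1 + a2 + a3 the exponent of <2,2,2>. The directional derivatives treat the three modes
  differently, and it is not known which of the exponents is small, so all three rotated
  degenerations have to hold for the same functional. The 3 in floor(d/3) is a block size. A block
  of q diagonal entries of the d x d matrix offers q d^2 coordinates, the d^2 kernel conditions
  consume d^2 of them, and a copy of <1, 1, d^2> on the right buys a copy of <1, 1, (q - 1) d^2> on
  the left. For q = 2 nothing is gained; q = 3 is the first useful size, and its factor 2 is the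
  origin of 2^(omega/3) - 1.\<close>

definition has_rank ::
    "'i set \<Rightarrow> 'j set \<Rightarrow> 'k set \<Rightarrow> ('i \<Rightarrow> 'j \<Rightarrow> 'k \<Rightarrow> 'a::field) \<Rightarrow> nat \<Rightarrow> bool" where
  "has_rank A B C T r \<longleftrightarrow>
     (\<exists>u v w. \<forall>a\<in>A. \<forall>b\<in>B. \<forall>c\<in>C. T a b c = (\<Sum>s<r. u s a * v s b * w s c))"

lemma has_rankI_sum:
  assumes "finite S" "card S = r"
    and "\<And>a b c. a \<in> A \<Longrightarrow> b \<in> B \<Longrightarrow> c \<in> C \<Longrightarrow> T a b c = (\<Sum>s\<in>S. u s a * v s b * w s c)"
  shows "has_rank A B C T r"
proof -
  obtain h where h: "bij_betw h {..<r} S"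
    using ex_bij_betw_nat_finite[OF assms(1)] assms(2) by (auto simp: atLeast0LessThan)
  have "T a b c = (\<Sum>s<r. u (h s) a * v (h s) b * w (h s) c)" if "a \<in> A" "b \<in> B" "c \<in> C" for a b c
    unfolding assms(3)[OF that] by (rule sum.reindex_bij_betw[OF h, symmetric])
  then show ?thesis
    unfolding has_rank_def
    by (intro exI[of _ "\<lambda>s. u (h s)"] exI[of _ "\<lambda>s. v (h s)"] exI[of _ "\<lambda>s. w (h s)"]) auto
qed

lemma has_rank_exists: "finite A \<Longrightarrow> finite B \<Longrightarrow> has_rank A B C T (card A * card B)"
  for T :: "'i \<Rightarrow> 'j \<Rightarrow> 'k \<Rightarrow> 'a::field"
proof -
  assume fin: "finite A" "finite B"
  have "T a b c = (\<Sum>s\<in>A \<times> B. (if fst s = a then 1 else 0) * (if snd s = b then 1 else 0) * T (fst s) (snd s) c)"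
    if "a \<in> A" "b \<in> B" for a b c
  proof -
    have "(\<Sum>s\<in>A \<times> B. (if fst s = a then 1 else 0) * (if snd s = b then 1 else 0) * T (fst s) (snd s) c)
        = (\<Sum>s\<in>A \<times> B. if s = (a, b) then T a b c else 0)"
      by (rule sum.cong) (auto split: prod.splits)
    also have "\<dots> = T a b c" using that fin by (simp add: sum.delta)
    finally show ?thesis by simp
  qed
  then show ?thesis
    by (intro has_rankI_sum[where S = "A \<times> B"]) (auto simp: fin card_cartesian_product)
qed

lemma has_rank_tensor_rank: "finite A \<Longrightarrow> finite B \<Longrightarrow> has_rank A B C T (tensor_rank A B C T)"
  unfolding tensor_rank_def has_rank_def[symmetric] by (rule LeastI) (rule has_rank_exists)

lemma tensor_rank_le: "has_rank A B C T r \<Longrightarrow> tensor_rank A B C T \<le> r"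
  unfolding tensor_rank_def has_rank_def[symmetric] by (rule Least_le)

lemma has_rank_mono:
  assumes "has_rank A B C T r" "r \<le> r'"
  shows "has_rank A B C T r'"
proof -
  obtain u v w where uvw: "\<And>a b c. a \<in> A \<Longrightarrow> b \<in> B \<Longrightarrow> c \<in> C \<Longrightarrow> T a b c = (\<Sum>s<r. u s a * v s b * w s c)"
    using assms(1) unfolding has_rank_def by blast
  have "T a b c = (\<Sum>s<r'. (if s < r then u s a else 0) * v s b * w s c)" if "a \<in> A" "b \<in> B" "c \<in> C" for a b c
  proof -
    have "(\<Sum>s<r'. (if s < r then u s a else 0) * v s b * w s c)
        = (\<Sum>s<r'. if s \<in> {..<r} then u s a * v s b * w s c else 0)"
      by (rule sum.cong) auto
    also have "\<dots> = (\<Sum>s\<in>{..<r'} \<inter> {..<r}. u s a * v s b * w s c)"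
      by (simp only: sum.inter_restrict[symmetric] finite_lessThan)
    also have "{..<r'} \<inter> {..<r} = {..<r}" using assms(2) by auto
    finally show ?thesis using uvw[OF that] by simp
  qed
  then show ?thesis
    by (intro has_rankI_sum[where S = "{..<r'}" and u = "\<lambda>s a. if s < r then u s a else 0"]) auto
qed

lemma has_rank_reindex:
  assumes "has_rank A B C T r"
    and "\<And>a. a \<in> A' \<Longrightarrow> f a \<in> A" "\<And>b. b \<in> B' \<Longrightarrow> g b \<in> B" "\<And>c. c \<in> C' \<Longrightarrow> h c \<in> C"
    and "\<And>a b c. a \<in> A' \<Longrightarrow> b \<in> B' \<Longrightarrow> c \<in> C' \<Longrightarrow> S a b c = T (f a) (g b) (h c)"
  shows "has_rank A' B' C' S r"
proof -
  obtain u v w where uvw: "\<And>a b c. a \<in> A \<Longrightarrow> b \<in> B \<Longrightarrow> c \<in> C \<Longrightarrow> T a b c = (\<Sum>s<r. u s a * v s b * w s c)"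
    using assms(1) unfolding has_rank_def by blast
  show ?thesis
    by (rule has_rankI_sum[where S = "{..<r}" and u = "\<lambda>s a. u s (f a)" and v = "\<lambda>s b. v s (g b)" and w = "\<lambda>s c. w s (h c)"])
       (auto simp: assms uvw)
qed

lemma has_rank_scale:
  assumes "has_rank A B C T r"
  shows "has_rank A B C (\<lambda>a b c. k * T a b c) r"
proof -
  obtain u v w where uvw: "\<And>a b c. a \<in> A \<Longrightarrow> b \<in> B \<Longrightarrow> c \<in> C \<Longrightarrow> T a b c = (\<Sum>s<r. u s a * v s b * w s c)"
    using assms(1) unfolding has_rank_def by blast
  show ?thesis
    by (rule has_rankI_sum[where S = "{..<r}" and u = "\<lambda>s a. k * u s a" and v = v and w = w])
       (auto simp: uvw sum_distrib_left mult.assoc)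
qed

lemma has_rank_sum:
  assumes "finite V" "\<And>v. v \<in> V \<Longrightarrow> has_rank A B C (T v) (r v)"
  shows "has_rank A B C (\<lambda>a b c. \<Sum>v\<in>V. T v a b c) (\<Sum>v\<in>V. r v)"
proof -
  have "\<forall>v. \<exists>x y z. v \<in> V \<longrightarrow> (\<forall>a\<in>A. \<forall>b\<in>B. \<forall>c\<in>C. T v a b c = (\<Sum>s<r v. x s a * y s b * z s c))"
    using assms(2) unfolding has_rank_def by blast
  then obtain x y z where xyz: "\<And>v a b c. v \<in> V \<Longrightarrow> a \<in> A \<Longrightarrow> b \<in> B \<Longrightarrow> c \<in> C \<Longrightarrow>
      T v a b c = (\<Sum>s<r v. x v s a * y v s b * z v s c)"
    by metis
  show ?thesis
  proof (rule has_rankI_sum[where S = "SIGMA v:V. {..<r v}" and u = "\<lambda>p. x (fst p) (snd p)"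
        and v = "\<lambda>p. y (fst p) (snd p)" and w = "\<lambda>p. z (fst p) (snd p)"])
    fix a b c assume "a \<in> A" "b \<in> B" "c \<in> C"
    then show "(\<Sum>v\<in>V. T v a b c) = (\<Sum>p\<in>Sigma V (\<lambda>v. {..<r v}). x (fst p) (snd p) a * y (fst p) (snd p) b * z (fst p) (snd p) c)"
      by (simp add: xyz sum.Sigma[OF assms(1)] split_def)
  qed (use assms(1) in auto)
qed

lemma has_rank_kron:
  assumes "has_rank A B C T r" "has_rank A' B' C' T' r'"
  shows "has_rank (A \<times> A') (B \<times> B') (C \<times> C')
           (\<lambda>a b c. T (fst a) (fst b) (fst c) * T' (snd a) (snd b) (snd c)) (r * r')"
proof -
  obtain u v w where uvw: "\<And>a b c. a \<in> A \<Longrightarrow> b \<in> B \<Longrightarrow> c \<in> C \<Longrightarrow> T a b c = (\<Sum>s<r. u s a * v s b * w s c)"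
    using assms(1) unfolding has_rank_def by blast
  obtain u' v' w' where uvw': "\<And>a b c. a \<in> A' \<Longrightarrow> b \<in> B' \<Longrightarrow> c \<in> C' \<Longrightarrow> T' a b c = (\<Sum>s<r'. u' s a * v' s b * w' s c)"
    using assms(2) unfolding has_rank_def by blast
  show ?thesis
  proof (rule has_rankI_sum[where S = "{..<r} \<times> {..<r'}" and u = "\<lambda>s a. u (fst s) (fst a) * u' (snd s) (snd a)"
          and v = "\<lambda>s a. v (fst s) (fst a) * v' (snd s) (snd a)" and w = "\<lambda>s a. w (fst s) (fst a) * w' (snd s) (snd a)"])
    fix a b c assume "a \<in> A \<times> A'" "b \<in> B \<times> B'" "c \<in> C \<times> C'"
    then have "T (fst a) (fst b) (fst c) * T' (snd a) (snd b) (snd c)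
        = (\<Sum>s<r. \<Sum>s'<r'. (u s (fst a) * v s (fst b) * w s (fst c)) * (u' s' (snd a) * v' s' (snd b) * w' s' (snd c)))"
      by (auto simp: uvw uvw' sum_product)
    then show "T (fst a) (fst b) (fst c) * T' (snd a) (snd b) (snd c) = (\<Sum>s\<in>{..<r} \<times> {..<r'}.
        u (fst s) (fst a) * u' (snd s) (snd a) * (v (fst s) (fst b) * v' (snd s) (snd b)) * (w (fst s) (fst c) * w' (snd s) (snd c)))"
      by (simp add: sum.cartesian_product split_def mult_ac)
  qed auto
qed

lemma tensor_rank_rotate: "tensor_rank B C A (\<lambda>b c a. T a b c) = tensor_rank A B C T"
proof -
  have "has_rank B C A (\<lambda>b c a. T a b c) r \<longleftrightarrow> has_rank A B C T r" for r
  proof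
    assume "has_rank B C A (\<lambda>b c a. T a b c) r"
    then obtain u v w where "\<And>a b c. a \<in> A \<Longrightarrow> b \<in> B \<Longrightarrow> c \<in> C \<Longrightarrow> T a b c = (\<Sum>s<r. u s b * v s c * w s a)"
      unfolding has_rank_def by blast
    then show "has_rank A B C T r"
      by (intro has_rankI_sum[where S = "{..<r}" and u = w and v = u and w = v]) (auto simp: mult_ac)
  next
    assume "has_rank A B C T r"
    then obtain u v w where "\<And>a b c. a \<in> A \<Longrightarrow> b \<in> B \<Longrightarrow> c \<in> C \<Longrightarrow> T a b c = (\<Sum>s<r. u s a * v s b * w s c)"
      unfolding has_rank_def by blast
    then show "has_rank B C A (\<lambda>b c a. T a b c) r"
      by (intro has_rankI_sum[where S = "{..<r}" and u = v and v = w and w = u]) (auto simp: mult_ac)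
  qed
  then show ?thesis
    unfolding tensor_rank_def has_rank_def[symmetric] by simp
qed

text \<open>Gaussian elimination: each equation costs one free coordinate. The solutions come out
  dual to the coordinates in \<open>J\<close>, not merely independent, so that coordinate vectors
  can serve as their dual system.\<close>

lemma homogeneous_system:
  fixes c :: "'e \<Rightarrow> 'i \<Rightarrow> 'a::field"
  assumes "finite E" "finite I" "card E + n \<le> card I"
  shows "\<exists>J a. J \<subseteq> I \<and> card J = n \<and> (\<forall>j\<in>J. (\<forall>e\<in>E. (\<Sum>i\<in>I. c e i * a j i) = 0) \<and>
           (\<forall>j'\<in>J. a j j' = (if j' = j then 1 else 0)))"
  using assms(1,3)
proof (induction E arbitrary: n rule: finite_induct)
  case empty
  then obtain J where "J \<subseteq> I" "card J = n"
    using obtain_subset_with_card_n[of n I] by auto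
  then show ?case
    by (intro exI[of _ J] exI[of _ "\<lambda>j j'. if j' = j then 1 else 0"]) auto
next
  case (insert e E)
  then have "card E + Suc n \<le> card I" by simp
  from insert.IH[OF this] obtain J a where J: "J \<subseteq> I" "card J = Suc n"
    and a0: "\<And>j e. j \<in> J \<Longrightarrow> e \<in> E \<Longrightarrow> (\<Sum>i\<in>I. c e i * a j i) = 0"
    and a1: "\<And>j j'. j \<in> J \<Longrightarrow> j' \<in> J \<Longrightarrow> a j j' = (if j' = j then 1 else 0)"
    by blast
  define f where "f j = (\<Sum>i\<in>I. c e i * a j i)" for j
  \<comment> \<open>The pivot: some \<open>j0\<close> with \<open>f j0\<close> nonzero if there is
    one. Otherwise all \<open>f j\<close> vanish and \<open>j0\<close> is arbitrary; then
    \<open>f j / f j0 = 0\<close>, so \<open>b\<close> agrees with \<open>a\<close> and only an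
    index is dropped.\<close>
  have "\<exists>j0\<in>J. \<forall>j\<in>J. f j0 = 0 \<longrightarrow> f j = 0"
    using J(2) by (metis card.empty ex_in_conv nat.distinct(1))
  then obtain j0 where j0: "j0 \<in> J" "\<And>j. j \<in> J \<Longrightarrow> f j0 = 0 \<Longrightarrow> f j = 0" by blast
  define b where "b j i = a j i - f j / f j0 * a j0 i" for j i
  have lin: "(\<Sum>i\<in>I. c e' i * b j i) = (\<Sum>i\<in>I. c e' i * a j i) - f j / f j0 * (\<Sum>i\<in>I. c e' i * a j0 i)" for e' j
    unfolding b_def by (simp add: sum_distrib_left sum_subtractf[symmetric] algebra_simps)
  have "finite J" using J(1) assms(2) finite_subset by auto
  show ?case
  proof (intro exI[of _ "J - {j0}"] exI[of _ b] conjI ballI)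
    show "card (J - {j0}) = n" using J(2) j0(1) \<open>finite J\<close> by simp
    fix j assume j: "j \<in> J - {j0}"
    show "(\<Sum>i\<in>I. c e' i * b j i) = 0" if "e' \<in> insert e E" for e'
    proof (cases "e' = e")
      case True
      then show ?thesis using j0(2)[of j] j unfolding lin by (auto simp: f_def[symmetric])
    next
      case False
      then show ?thesis using that a0 j j0(1) unfolding lin by auto
    qed
    show "b j j' = (if j' = j then 1 else 0)" if "j' \<in> J - {j0}" for j'
      using that j a1 j0(1) unfolding b_def by auto
  qed (use J in auto)
qed

section \<open>Matrix multiplication and Kronecker powers\<close>

lemma sum_div_mod: "(\<Sum>i<n * k. f (i div k) (i mod k)) = (\<Sum>a<n. \<Sum>b<k. f a b)"
  for f :: "nat \<Rightarrow> nat \<Rightarrow> 'a::comm_monoid_add"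
proof (cases "k = 0")
  case False
  have "(\<Sum>a<n. \<Sum>b<k. f a b) = (\<Sum>(a,b)\<in>{..<n} \<times> {..<k}. f a b)"
    by (simp add: sum.cartesian_product)
  also have "\<dots> = (\<Sum>i<n * k. f (i div k) (i mod k))"
  proof (rule sum.reindex_bij_witness[where i = "\<lambda>i. (i div k, i mod k)" and j = "\<lambda>(a, b). a * k + b"])
    fix p assume p: "p \<in> {..<n} \<times> {..<k}"
    obtain a b where ab: "p = (a, b)" "a < n" "b < k" using p by auto
    have "a * k + b < n * k"
      using ab mult_le_mono1[of "Suc a" n k] by simp
    then show "(case p of (a, b) \<Rightarrow> a * k + b) \<in> {..<n * k}" using ab by simp
  qed (use False in \<open>auto simp: less_mult_imp_div_less\<close>)
  finally show ?thesis by simp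
qed simp

lemma sum_div_mod3:
  fixes P :: "nat \<Rightarrow> nat \<Rightarrow> nat \<Rightarrow> nat \<Rightarrow> nat \<Rightarrow> nat \<Rightarrow> 'a::comm_monoid_add"
  shows "(\<Sum>i<n * n'. \<Sum>j<m * m'. \<Sum>k<l * l'. P (i div n') (i mod n') (j div m') (j mod m') (k div l') (k mod l'))
    = (\<Sum>i<n. \<Sum>j<m. \<Sum>k<l. \<Sum>i'<n'. \<Sum>j'<m'. \<Sum>k'<l'. P i i' j j' k k')"
proof -
  define Q where "Q i i' j j' k = (\<Sum>k'<l'. P i i' j j' k k')" for i i' j j' k
  have "(\<Sum>i<n * n'. \<Sum>j<m * m'. \<Sum>k<l * l'. P (i div n') (i mod n') (j div m') (j mod m') (k div l') (k mod l'))
    = (\<Sum>i<n * n'. \<Sum>j<m * m'. \<Sum>k<l. Q (i div n') (i mod n') (j div m') (j mod m') k)"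
    unfolding Q_def by (intro sum.cong refl sum_div_mod)
  also have "\<dots> = (\<Sum>i<n * n'. \<Sum>j<m. \<Sum>j'<m'. \<Sum>k<l. Q (i div n') (i mod n') j j' k)"
    by (intro sum.cong refl sum_div_mod)
  also have "\<dots> = (\<Sum>i<n. \<Sum>i'<n'. \<Sum>j<m. \<Sum>j'<m'. \<Sum>k<l. Q i i' j j' k)"
    by (rule sum_div_mod)
  also have "\<dots> = (\<Sum>i<n. \<Sum>j<m. \<Sum>i'<n'. \<Sum>j'<m'. \<Sum>k<l. Q i i' j j' k)"
    by (intro sum.cong refl sum.swap)
  also have "\<dots> = (\<Sum>i<n. \<Sum>j<m. \<Sum>i'<n'. \<Sum>k<l. \<Sum>j'<m'. Q i i' j j' k)"
    by (intro sum.cong refl sum.swap)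
  also have "\<dots> = (\<Sum>i<n. \<Sum>j<m. \<Sum>k<l. \<Sum>i'<n'. \<Sum>j'<m'. Q i i' j j' k)"
    by (intro sum.cong refl sum.swap)
  finally show ?thesis unfolding Q_def .
qed

text \<open>Restrictions of \<open>\<langle>n, m, l\<rangle>\<close>, with coefficients in a ring that will be a polynomial ring.\<close>

definition mmform ::
    "nat \<Rightarrow> nat \<Rightarrow> nat \<Rightarrow> ('x \<Rightarrow> 'y \<Rightarrow> 'z \<Rightarrow> 'r::comm_ring_1) \<Rightarrow> bool" where
  "mmform n m l F \<longleftrightarrow>
     (\<exists>A B C. \<forall>x y z. F x y z = (\<Sum>i<n. \<Sum>j<m. \<Sum>k<l. A x i j * B y j k * C z k i))"

lemma mmformI:
  assumes "finite K" "\<And>x y z. F x y z = (\<Sum>i<n. \<Sum>j<m. \<Sum>k\<in>K. A x i j * B y j k * C z k i)"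
  shows "mmform n m (card K) F"
proof -
  obtain h where h: "bij_betw h {..<card K} K"
    using ex_bij_betw_nat_finite[OF assms(1)] by (auto simp: atLeast0LessThan)
  have "F x y z = (\<Sum>i<n. \<Sum>j<m. \<Sum>k<card K. A x i j * B y j (h k) * C z (h k) i)" for x y z
    unfolding assms(2) by (intro sum.cong refl sum.reindex_bij_betw[OF h, symmetric])
  then show ?thesis
    unfolding mmform_def
    by (intro exI[of _ A] exI[of _ "\<lambda>y j k. B y j (h k)"] exI[of _ "\<lambda>z k. C z (h k)"]) auto
qed

lemma mmform_one: "mmform (Suc 0) (Suc 0) (Suc 0) (\<lambda>x y z. 1)"
  unfolding mmform_def by (intro exI[of _ "\<lambda>_ _ _. 1"]) simp

lemma mmform_comp: "mmform n m l F \<Longrightarrow> mmform n m l (\<lambda>x y z. F (f x) (g y) (h z))"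
  unfolding mmform_def
  apply (elim exE)
  subgoal for A B C
    by (intro exI[of _ "\<lambda>x. A (f x)"] exI[of _ "\<lambda>x. B (g x)"] exI[of _ "\<lambda>x. C (h x)"]) simp
  done

lemma mmform_mult:
  assumes "mmform n m l F" "mmform n' m' l' G"
  shows "mmform (n * n') (m * m') (l * l') (\<lambda>x y z. F x y z * G x y z)"
proof -
  obtain A B C where F: "\<And>x y z. F x y z = (\<Sum>i<n. \<Sum>j<m. \<Sum>k<l. A x i j * B y j k * C z k i)"
    using assms(1) unfolding mmform_def by blast
  obtain A' B' C' where G: "\<And>x y z. G x y z = (\<Sum>i<n'. \<Sum>j<m'. \<Sum>k<l'. A' x i j * B' y j k * C' z k i)"
    using assms(2) unfolding mmform_def by blast
  have "F x y z * G x y z = (\<Sum>i<n * n'. \<Sum>j<m * m'. \<Sum>k<l * l'.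
      (A x (i div n') (j div m') * A' x (i mod n') (j mod m')) *
      (B y (j div m') (k div l') * B' y (j mod m') (k mod l')) *
      (C z (k div l') (i div n') * C' z (k mod l') (i mod n')))" for x y z
  proof -
    have "F x y z * G x y z = (\<Sum>i<n. \<Sum>j<m. \<Sum>k<l. \<Sum>i'<n'. \<Sum>j'<m'. \<Sum>k'<l'.
        (A x i j * B y j k * C z k i) * (A' x i' j' * B' y j' k' * C' z k' i'))"
      by (simp only: F[of x y z] sum_distrib_right) (simp only: G[of x y z] sum_distrib_left)
    also have "\<dots> = (\<Sum>i<n. \<Sum>j<m. \<Sum>k<l. \<Sum>i'<n'. \<Sum>j'<m'. \<Sum>k'<l'.
        (A x i j * A' x i' j') * (B y j k * B' y j' k') * (C z k i * C' z k' i'))"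
      by (intro sum.cong refl) (simp only: mult_ac)
    finally show ?thesis
      by (simp only: sum_div_mod3[where P = "\<lambda>i i' j j' k k'. (A x i j * A' x i' j') * (B y j k * B' y j' k') * (C z k i * C' z k' i')"])
  qed
  then show ?thesis
    unfolding mmform_def
    by (intro exI[of _ "\<lambda>x i j. A x (i div n') (j div m') * A' x (i mod n') (j mod m')"]
        exI[of _ "\<lambda>y j k. B y (j div m') (k div l') * B' y (j mod m') (k mod l')"]
        exI[of _ "\<lambda>z k i. C z (k div l') (i div n') * C' z (k mod l') (i mod n')"]) auto
qed

section \<open>Kronecker powers and products over words\<close>

lemma index_pow_0: "index_pow 0 A = {[]}"
  by (auto simp: index_pow_def)

lemma index_pow_Suc: "index_pow (Suc n) A = (\<lambda>(x, xs). x # xs) ` (A \<times> index_pow n A)"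
  by (auto simp: index_pow_def image_iff length_Suc_conv)

lemma finite_index_pow: "finite A \<Longrightarrow> finite (index_pow n A)"
  using finite_lists_length_eq by (auto simp: index_pow_def)

lemma index_pow_nth: "xs \<in> index_pow n A \<Longrightarrow> t < n \<Longrightarrow> xs ! t \<in> A"
  by (auto simp: index_pow_def)

lemma index_pow_take_drop:
  assumes "xs \<in> index_pow (p + q) A"
  shows "take p xs \<in> index_pow p A" "drop p xs \<in> index_pow q A"
  using assms by (auto simp: index_pow_def dest: in_set_takeD in_set_dropD)

lemma kron_pow_0: "kron_pow 0 T xs ys zs = 1"
  by (simp add: kron_pow_def)

lemma kron_pow_Suc: "kron_pow (Suc n) T (x # xs) (y # ys) (z # zs) = T x y z * kron_pow n T xs ys zs"
  by (simp add: kron_pow_def prod.lessThan_Suc_shift del: prod.lessThan_Suc)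

lemma kron_pow_add:
  assumes "length xs = p + q" "length ys = p + q" "length zs = p + q"
  shows "kron_pow (p + q) T xs ys zs
    = kron_pow p T (take p xs) (take p ys) (take p zs) * kron_pow q T (drop p xs) (drop p ys) (drop p zs)"
proof -
  have "kron_pow (p + q) T xs ys zs = (\<Prod>t<p. T (xs ! t) (ys ! t) (zs ! t)) * (\<Prod>t<q. T (xs ! (p + t)) (ys ! (p + t)) (zs ! (p + t)))"
    unfolding kron_pow_def by (induction q) (auto simp: mult.assoc)
  then show ?thesis using assms by (simp add: kron_pow_def)
qed

lemma prod_sum_lists:
  fixes f :: "nat \<Rightarrow> 'b \<Rightarrow> 'a::comm_semiring_1"
  assumes "finite L"
  shows "(\<Prod>t<n. \<Sum>l\<in>L. f t l) = (\<Sum>v\<in>index_pow n L. \<Prod>t<n. f t (v ! t))"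
proof (induction n arbitrary: f)
  case 0
  then show ?case by (simp add: index_pow_0)
next
  case (Suc n)
  have "(\<Sum>v\<in>index_pow (Suc n) L. \<Prod>t<Suc n. f t (v ! t))
      = (\<Sum>(l, v)\<in>L \<times> index_pow n L. f 0 l * (\<Prod>t<n. f (Suc t) (v ! t)))"
    unfolding index_pow_Suc
    by (subst sum.reindex) (auto simp: inj_on_def prod.lessThan_Suc_shift intro!: sum.cong simp del: prod.lessThan_Suc)
  also have "\<dots> = (\<Sum>l\<in>L. f 0 l) * (\<Sum>v\<in>index_pow n L. \<Prod>t<n. f (Suc t) (v ! t))"
    by (simp add: sum_product sum.cartesian_product)
  also have "\<dots> = (\<Prod>t<Suc n. \<Sum>l\<in>L. f t l)"
    by (simp add: prod.lessThan_Suc_shift Suc.IH del: prod.lessThan_Suc)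
  finally show ?case by simp
qed

lemma mmform_prod:
  fixes Y :: "'l \<Rightarrow> 'x \<Rightarrow> 'y \<Rightarrow> 'z \<Rightarrow> 'r::comm_ring_1"
  assumes "\<And>l. l \<in> set v \<Longrightarrow> mmform (n l) (m l) (k l) (Y l)"
  shows "mmform (prod_list (map n v)) (prod_list (map m v)) (prod_list (map k v))
           (\<lambda>x y z. \<Prod>t<length v. Y (v ! t) (x t) (y t) (z t))"
  using assms
proof (induction v)
  case Nil
  then show ?case using mmform_one by simp
next
  case (Cons a v)
  have "mmform (prod_list (map n v)) (prod_list (map m v)) (prod_list (map k v))
      (\<lambda>x y z. \<Prod>t<length v. Y (v ! t) (x (Suc t)) (y (Suc t)) (z (Suc t)))"
    using mmform_comp[OF Cons.IH, where f = "\<lambda>x t. x (Suc t)" and g = "\<lambda>x t. x (Suc t)" and h = "\<lambda>x t. x (Suc t)"] Cons.prems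
    by simp
  moreover have "mmform (n a) (m a) (k a) (\<lambda>x y z. Y a (x 0) (y 0) (z 0))"
    by (rule mmform_comp[where F = "Y a"]) (simp add: Cons.prems)
  ultimately show ?case
    using mmform_mult[of "n a" "m a" "k a" "\<lambda>x y z. Y a (x 0) (y 0) (z 0)"]
    by (simp add: prod.lessThan_Suc_shift del: prod.lessThan_Suc)
qed

lemma coeff_sum_mult3:
  "coeff (p * q * r) e = (\<Sum>(e1, e2)\<in>(SIGMA e1:{..e}. {..e - e1}). coeff p e1 * coeff q e2 * coeff r (e - e1 - e2))"
  for p q r :: "'a::comm_semiring_0 poly"
proof -
  have "coeff (p * q * r) e = (\<Sum>e1\<le>e. coeff p e1 * (\<Sum>e2\<le>e - e1. coeff q e2 * coeff r (e - e1 - e2)))"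
    by (simp add: coeff_mult mult.assoc)
  also have "\<dots> = (\<Sum>e1\<le>e. \<Sum>e2\<le>e - e1. coeff p e1 * coeff q e2 * coeff r (e - e1 - e2))"
    by (simp add: sum_distrib_left mult.assoc)
  finally show ?thesis by (simp add: sum.Sigma)
qed

lemma matmul_collapse:
  fixes a :: "nat \<Rightarrow> nat \<Rightarrow> 'a::field"
  shows "(\<Sum>ij\<in>{..<n} \<times> {..<m}. \<Sum>jk\<in>{..<m} \<times> {..<l}. \<Sum>ki\<in>{..<l} \<times> {..<n}.
      a (fst ij) (snd ij) * b (fst jk) (snd jk) * c (fst ki) (snd ki) * matmul_tensor ij jk ki)
    = (\<Sum>i<n. \<Sum>j<m. \<Sum>k<l. a i j * b j k * c k i)"
proof -
  have pairs: "(\<Sum>p\<in>A \<times> B. g p) = (\<Sum>i\<in>A. \<Sum>j\<in>B. g (i, j))" for A B :: "nat set" and g :: "_ \<Rightarrow> 'a"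
    by (simp add: sum.cartesian_product)
  have "(\<Sum>j'<m. \<Sum>k<l. \<Sum>k'<l. \<Sum>i'<n. a i j * b j' k * c k' i' * matmul_tensor (i, j) (j', k) (k', i'))
     = (\<Sum>k<l. a i j * b j k * c k i)" if "i < n" "j < m" for i j
  proof -
    have 1: "(\<Sum>i'<n. a i j * b j' k * c k' i' * matmul_tensor (i, j) (j', k) (k', i'))
      = (if k' = k then if j' = j then a i j * b j' k * c k' i else 0 else 0)" for j' k k'
    proof -
      have "(\<Sum>i'<n. a i j * b j' k * c k' i' * matmul_tensor (i, j) (j', k) (k', i'))
        = (\<Sum>i'<n. if i' = i then (if k' = k then if j' = j then a i j * b j' k * c k' i else 0 else 0) else 0)"
        by (rule sum.cong) (auto simp: matmul_tensor_def)
      then show ?thesis using that by (simp add: sum.delta)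
    qed
    have 2: "(\<Sum>k'<l. if k' = k then if j' = j then a i j * b j' k * c k' i else 0 else 0)
      = (if j' = j then a i j * b j' k * c k i else 0)" if "k < l" for j' k
      using that by (simp add: sum.delta)
    have "(\<Sum>j'<m. \<Sum>k<l. \<Sum>k'<l. \<Sum>i'<n. a i j * b j' k * c k' i' * matmul_tensor (i, j) (j', k) (k', i'))
      = (\<Sum>j'<m. if j' = j then \<Sum>k<l. a i j * b j' k * c k i else 0)"
      unfolding 1 by (intro sum.cong refl) (auto simp: 2 intro!: sum.cong)
    then show ?thesis using that by (simp add: sum.delta)
  qed
  then show ?thesis unfolding pairs by (auto intro!: sum.cong)
qed

lemma sum_product3:
  fixes a b c :: "_ \<Rightarrow> 'a::comm_semiring_0"
  shows "(\<Sum>i\<in>I. a i) * (\<Sum>j\<in>J. b j) * (\<Sum>k\<in>K. c k) = (\<Sum>i\<in>I. \<Sum>j\<in>J. \<Sum>k\<in>K. a i * b j * c k)"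
proof -
  have "(\<Sum>i\<in>I. a i) * (\<Sum>j\<in>J. b j) * (\<Sum>k\<in>K. c k) = (\<Sum>i\<in>I. \<Sum>j\<in>J. a i * b j) * (\<Sum>k\<in>K. c k)"
    by (simp only: sum_product)
  also have "\<dots> = (\<Sum>i\<in>I. \<Sum>j\<in>J. a i * b j * (\<Sum>k\<in>K. c k))"
    by (simp only: sum_distrib_right)
  finally show ?thesis by (simp only: sum_distrib_left)
qed

text \<open>Linear maps applied to the three modes do not raise the rank. They act on the second
  index components only; the first ones belong to a tensor factor that is carried along
  unchanged.\<close>

lemma has_rank_restrict:
  assumes "has_rank (A0 \<times> I) (B0 \<times> J) (C0 \<times> K) M r"
    and "\<And>a0 a b0 b c0 c. a0 \<in> A0 \<Longrightarrow> b0 \<in> B0 \<Longrightarrow> c0 \<in> C0 \<Longrightarrow> a \<in> A \<Longrightarrow> b \<in> B \<Longrightarrow> c \<in> C \<Longrightarrow>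
      S (a0, a) (b0, b) (c0, c) =
        (\<Sum>i\<in>I. \<Sum>j\<in>J. \<Sum>k\<in>K. \<alpha> a i * \<beta> b j * \<gamma> c k * M (a0, i) (b0, j) (c0, k))"
  shows "has_rank (A0 \<times> A) (B0 \<times> B) (C0 \<times> C) S r"
proof -
  obtain u v w where uvw: "\<And>a b c. a \<in> A0 \<times> I \<Longrightarrow> b \<in> B0 \<times> J \<Longrightarrow> c \<in> C0 \<times> K \<Longrightarrow>
      M a b c = (\<Sum>s<r. u s a * v s b * w s c)"
    using assms(1) unfolding has_rank_def by blast
  show ?thesis
  proof (rule has_rankI_sum[where S = "{..<r}" and u = "\<lambda>s a. \<Sum>i\<in>I. \<alpha> (snd a) i * u s (fst a, i)"
        and v = "\<lambda>s b. \<Sum>j\<in>J. \<beta> (snd b) j * v s (fst b, j)"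
        and w = "\<lambda>s c. \<Sum>k\<in>K. \<gamma> (snd c) k * w s (fst c, k)"])
    fix a b c assume "a \<in> A0 \<times> A" "b \<in> B0 \<times> B" "c \<in> C0 \<times> C"
    then obtain a0 a1 b0 b1 c0 c1 where [simp]: "a = (a0, a1)" "b = (b0, b1)" "c = (c0, c1)"
      and mem: "a0 \<in> A0" "b0 \<in> B0" "c0 \<in> C0" "a1 \<in> A" "b1 \<in> B" "c1 \<in> C" by auto
    have "S a b c = (\<Sum>i\<in>I. \<Sum>j\<in>J. \<Sum>k\<in>K. \<Sum>s<r. (\<alpha> a1 i * u s (a0, i)) * (\<beta> b1 j * v s (b0, j)) * (\<gamma> c1 k * w s (c0, k)))"
      using assms(2)[OF mem] mem by (auto simp: uvw sum_distrib_left mult_ac intro!: sum.cong)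
    also have "\<dots> = (\<Sum>i\<in>I. \<Sum>j\<in>J. \<Sum>s<r. \<Sum>k\<in>K. (\<alpha> a1 i * u s (a0, i)) * (\<beta> b1 j * v s (b0, j)) * (\<gamma> c1 k * w s (c0, k)))"
      by (intro sum.cong refl sum.swap)
    also have "\<dots> = (\<Sum>i\<in>I. \<Sum>s<r. \<Sum>j\<in>J. \<Sum>k\<in>K. (\<alpha> a1 i * u s (a0, i)) * (\<beta> b1 j * v s (b0, j)) * (\<gamma> c1 k * w s (c0, k)))"
      by (intro sum.cong refl sum.swap)
    also have "\<dots> = (\<Sum>s<r. \<Sum>i\<in>I. \<Sum>j\<in>J. \<Sum>k\<in>K. (\<alpha> a1 i * u s (a0, i)) * (\<beta> b1 j * v s (b0, j)) * (\<gamma> c1 k * w s (c0, k)))"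
      by (rule sum.swap)
    also have "\<dots> = (\<Sum>s<r. (\<Sum>i\<in>I. \<alpha> a1 i * u s (a0, i)) * (\<Sum>j\<in>J. \<beta> b1 j * v s (b0, j)) * (\<Sum>k\<in>K. \<gamma> c1 k * w s (c0, k)))"
      by (simp only: sum_product3)
    finally show "S a b c = (\<Sum>s<r. (\<Sum>i\<in>I. \<alpha> (snd a) i * u s (fst a, i)) *
        (\<Sum>j\<in>J. \<beta> (snd b) j * v s (fst b, j)) * (\<Sum>k\<in>K. \<gamma> (snd c) k * w s (fst c, k)))"
      by simp
  qed auto
qed

section \<open>Direct sums of equal copies\<close>

definition dsum :: "('i \<Rightarrow> 'j \<Rightarrow> 'k \<Rightarrow> 'a::field) \<Rightarrow> 'i \<times> 'v \<Rightarrow> 'j \<times> 'v \<Rightarrow> 'k \<times> 'v \<Rightarrow> 'a" where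
  "dsum T = (\<lambda>(a, v) (b, v') (c, v''). if v = v' \<and> v = v'' then T a b c else 0)"

lemma sum_dsum:
  assumes "finite V"
  shows "(\<Sum>i\<in>V. \<Sum>j\<in>V. \<Sum>k\<in>V. u i * v j * w k * dsum U (a, i) (b, j) (c, k)) = (\<Sum>i\<in>V. u i * v i * w i * U a b c)"
proof -
  have 1: "(\<Sum>k\<in>V. u i * v j * w k * dsum U (a, i) (b, j) (c, k)) = (if j = i then u i * v i * w i * U a b c else 0)"
    if "i \<in> V" for i j
  proof -
    have "(\<Sum>k\<in>V. u i * v j * w k * dsum U (a, i) (b, j) (c, k))
      = (\<Sum>k\<in>V. if k = i then if j = i then u i * v j * w k * U a b c else 0 else 0)"
      by (rule sum.cong) (auto simp: dsum_def)
    then show ?thesis using that assms by simp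
  qed
  have 2: "(\<Sum>j\<in>V. \<Sum>k\<in>V. u i * v j * w k * dsum U (a, i) (b, j) (c, k)) = u i * v i * w i * U a b c" if "i \<in> V" for i
    using that assms by (simp add: 1)
  show ?thesis by (rule sum.cong[OF refl 2])
qed

text \<open>Splitting a rank decomposition of \<open>card V\<close> copies of \<open>W\<close> into \<open>e\<close> groups of size \<open>card V\<close> shows
  that \<open>card V\<close> copies of \<open>W \<otimes> U\<close> cost at most \<open>e\<close> times as much as \<open>card V\<close> copies of \<open>U\<close>.\<close>

lemma has_rank_dsum_kron:
  fixes W :: "'i \<Rightarrow> 'j \<Rightarrow> 'k \<Rightarrow> 'a::field" and U :: "'i' \<Rightarrow> 'j' \<Rightarrow> 'k' \<Rightarrow> 'a"
  assumes V: "finite V" and W: "has_rank (A \<times> V) (B \<times> V) (C \<times> V) (dsum W) R" "R \<le> e * card V"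
    and U: "has_rank (A' \<times> V) (B' \<times> V) (C' \<times> V) (dsum U) r"
  shows "has_rank (A' \<times> (A \<times> V)) (B' \<times> (B \<times> V)) (C' \<times> (C \<times> V))
           (\<lambda>a b c. dsum W (snd a) (snd b) (snd c) * U (fst a) (fst b) (fst c)) (e * r)"
proof -
  obtain u v w where uvw: "\<And>a b c. a \<in> A \<times> V \<Longrightarrow> b \<in> B \<times> V \<Longrightarrow> c \<in> C \<times> V \<Longrightarrow>
      dsum W a b c = (\<Sum>s<e * card V. u s a * v s b * w s c)"
    using has_rank_mono[OF W] unfolding has_rank_def by blast
  have "card ({..<e} \<times> V) = e * card V" by (simp add: card_cartesian_product)
  then obtain h where h: "bij_betw h ({..<e} \<times> V) {..<e * card V}"
    using V by (metis card_lessThan finite_SigmaI finite_lessThan finite_same_card_bij)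
  have sum_h: "(\<Sum>s<e * card V. f s) = (\<Sum>q<e. \<Sum>i\<in>V. f (h (q, i)))" for f :: "nat \<Rightarrow> 'a"
    using sum.reindex_bij_betw[OF h, of f] by (simp add: sum.cartesian_product)
  define S where "S q = (\<lambda>a b c. (\<Sum>i\<in>V. u (h (q, i)) (snd a) * v (h (q, i)) (snd b) * w (h (q, i)) (snd c) * U (fst a) (fst b) (fst c)))" for q
  have "has_rank (A' \<times> (A \<times> V)) (B' \<times> (B \<times> V)) (C' \<times> (C \<times> V)) (S q) r" for q
    by (rule has_rank_restrict[OF U, where \<alpha> = "\<lambda>a i. u (h (q, i)) a" and \<beta> = "\<lambda>a i. v (h (q, i)) a" and \<gamma> = "\<lambda>a i. w (h (q, i)) a"])
       (simp add: S_def sum_dsum[OF V])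
  then have "has_rank (A' \<times> (A \<times> V)) (B' \<times> (B \<times> V)) (C' \<times> (C \<times> V)) (\<lambda>a b c. \<Sum>q<e. S q a b c) (\<Sum>q<e. r)"
    by (intro has_rank_sum) auto
  then have "has_rank (A' \<times> (A \<times> V)) (B' \<times> (B \<times> V)) (C' \<times> (C \<times> V)) (\<lambda>a b c. \<Sum>q<e. S q a b c) (e * r)"
    by simp
  then show ?thesis
    by (rule has_rank_reindex[where f = "\<lambda>x. x" and g = "\<lambda>x. x" and h = "\<lambda>x. x"])
       (auto simp: uvw sum_h S_def sum_distrib_right)
qed

section \<open>The tensors \<open>T\<^sup>p \<otimes> \<langle>n, m, l\<rangle>\<close>\<close>

definition fam_index :: "nat \<Rightarrow> nat \<Rightarrow> nat \<Rightarrow> nat \<Rightarrow> (nat list \<times> nat \<times> nat) set" where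
  "fam_index d p n m = index_pow p {..<d} \<times> {..<n} \<times> {..<m}"

definition fam_tensor ::
    "(nat \<Rightarrow> nat \<Rightarrow> nat \<Rightarrow> 'a::field) \<Rightarrow> nat \<Rightarrow> nat list \<times> nat \<times> nat \<Rightarrow> nat list \<times> nat \<times> nat \<Rightarrow> nat list \<times> nat \<times> nat \<Rightarrow> 'a" where
  "fam_tensor T p a b c = kron_pow p T (fst a) (fst b) (fst c) * matmul_tensor (snd a) (snd b) (snd c)"

definition fam_rank :: "nat \<Rightarrow> (nat \<Rightarrow> nat \<Rightarrow> nat \<Rightarrow> 'a::field) \<Rightarrow> nat \<Rightarrow> nat \<Rightarrow> nat \<Rightarrow> nat \<Rightarrow> nat" where
  "fam_rank d T p n m l =
     tensor_rank (fam_index d p n m) (fam_index d p m l) (fam_index d p l n) (fam_tensor T p)"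

lemma finite_fam_index: "finite (fam_index d p n m)"
  by (auto simp: fam_index_def finite_index_pow)

lemma has_rank_fam:
  "has_rank (fam_index d p n m) (fam_index d p m l) (fam_index d p l n) (fam_tensor T p) (fam_rank d T p n m l)"
  unfolding fam_rank_def by (intro has_rank_tensor_rank finite_fam_index)

lemma fam_rank_le:
  "has_rank (fam_index d p n m) (fam_index d p m l) (fam_index d p l n) (fam_tensor T p) r \<Longrightarrow> fam_rank d T p n m l \<le> r"
  unfolding fam_rank_def by (rule tensor_rank_le)

lemma eq_iff_div_mod: "i = i' \<longleftrightarrow> i div n = i' div n \<and> i mod n = i' mod n" for i :: nat
  by (metis div_mult_mod_eq)

lemma matmul_tensor_div_mod:
  "matmul_tensor (i, j) (j', k) (k', i') =
     matmul_tensor (i div n, j div m) (j' div m, k div l) (k' div l, i' div n) *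
     (matmul_tensor (i mod n, j mod m) (j' mod m, k mod l) (k' mod l, i' mod n) :: 'a::field)"
  unfolding matmul_tensor_def using eq_iff_div_mod[of i i' n] eq_iff_div_mod[of j j' m] eq_iff_div_mod[of k k' l] by auto

lemma div_mod_less: "i < n * n' \<Longrightarrow> i div n' < n \<and> i mod n' < n'" for i :: nat
  by (metis less_mult_imp_div_less mod_less_divisor mult_0_right not_less0 not_gr_zero)

definition split_index :: "nat \<Rightarrow> nat \<Rightarrow> nat \<Rightarrow> nat list \<times> nat \<times> nat \<Rightarrow> (nat list \<times> nat \<times> nat) \<times> (nat list \<times> nat \<times> nat)" where
  "split_index p n m = (\<lambda>(xs, i, j). ((take p xs, i div n, j div m), (drop p xs, i mod n, j mod m)))"

lemma split_index_mem:
  "a \<in> fam_index d (p + p') (n * n') (m * m') \<Longrightarrow>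
     fst (split_index p n' m' a) \<in> fam_index d p n m \<and> snd (split_index p n' m' a) \<in> fam_index d p' n' m'"
  by (auto simp: split_index_def fam_index_def index_pow_take_drop dest!: div_mod_less)

lemma fam_tensor_split:
  assumes "a \<in> fam_index d (p + p') (n * n') (m * m')" "b \<in> fam_index d (p + p') (m * m') (l * l')" "c \<in> fam_index d (p + p') (l * l') (n * n')"
  shows "fam_tensor T (p + p') a b c =
    fam_tensor T p (fst (split_index p n' m' a)) (fst (split_index p m' l' b)) (fst (split_index p l' n' c)) *
    fam_tensor T p' (snd (split_index p n' m' a)) (snd (split_index p m' l' b)) (snd (split_index p l' n' c))"
proof -
  obtain xs i j ys j' k zs k' i' where [simp]: "a = (xs, i, j)" "b = (ys, j', k)" "c = (zs, k', i')"
    by (metis prod.collapse)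
  have "length xs = p + p'" "length ys = p + p'" "length zs = p + p'"
    using assms by (auto simp: fam_index_def index_pow_def)
  then show ?thesis
    unfolding fam_tensor_def split_index_def
    by (simp add: kron_pow_add matmul_tensor_div_mod[of i j j' k k' i' n' m' l'])
qed

lemma fam_rank_mult_le:
  "fam_rank d T (p + p') (n * n') (m * m') (l * l') \<le> fam_rank d T p n m l * fam_rank d T p' n' m' l'"
  by (intro fam_rank_le has_rank_reindex[OF has_rank_kron[OF has_rank_fam has_rank_fam],
        where f = "split_index p n' m'" and g = "split_index p m' l'" and h = "split_index p l' n'"])
     (auto simp: fam_tensor_split mem_Times_iff dest: split_index_mem)

lemma fam_rank_mono:
  assumes "n \<le> n'" "m \<le> m'" "l \<le> l'"
  shows "fam_rank d T p n m l \<le> fam_rank d T p n' m' l'"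
  by (intro fam_rank_le has_rank_reindex[OF has_rank_fam[of d p n' m' l' T], where f = "\<lambda>x. x" and g = "\<lambda>x. x" and h = "\<lambda>x. x"])
     (use assms in \<open>auto simp: fam_index_def\<close>)

text \<open>The matrix product of the product dimensions is split into two factors. The outer one
  stays separate in the index, so that it can be restricted while the inner one remains part of the
  family.\<close>

lemma has_rank_fam_matmul:
  fixes T :: "nat \<Rightarrow> nat \<Rightarrow> nat \<Rightarrow> 'a::field"
  shows "has_rank (fam_index d p n' m' \<times> {..<n} \<times> {..<m}) (fam_index d p m' l' \<times> {..<m} \<times> {..<l}) (fam_index d p l' n' \<times> {..<l} \<times> {..<n})
     (\<lambda>a b c. fam_tensor T p (fst a) (fst b) (fst c) * matmul_tensor (snd a) (snd b) (snd c))
     (fam_rank d T p (n * n') (m * m') (l * l'))"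
proof -
  have lt: "i * n' + i' < n * n'" if "i < n" "i' < n'" for i i' n n' :: nat
    using that mult_le_mono1[of "Suc i" n n'] by simp
  show ?thesis
  proof (rule has_rank_reindex[OF has_rank_fam[of d p "n * n'" "m * m'" "l * l'" T],
          where f = "\<lambda>((xs, i', j'), (i, j)). (xs, i * n' + i', j * m' + j')"
            and g = "\<lambda>((xs, i', j'), (i, j)). (xs, i * m' + i', j * l' + j')"
            and h = "\<lambda>((xs, i', j'), (i, j)). (xs, i * l' + i', j * n' + j')"], goal_cases)
    case (4 a b c)
    obtain xs i' j' i j where a: "a = ((xs, i', j'), (i, j))" by (metis prod.collapse)
    obtain ys i2' j2' i2 j2 where b: "b = ((ys, i2', j2'), (i2, j2))" by (metis prod.collapse)
    obtain zs i3' j3' i3 j3 where c: "c = ((zs, i3', j3'), (i3, j3))" by (metis prod.collapse)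
    have dm: "(q * n + q') div n = q" "(q * n + q') mod n = q'" if "q' < n" for q q' n :: nat
      using that by simp_all
    have lts: "i' < n'" "j' < m'" "i2' < m'" "j2' < l'" "i3' < l'" "j3' < n'"
      using 4 by (auto simp: a b c fam_index_def)
    have "matmul_tensor (i * n' + i', j * m' + j') (i2 * m' + i2', j2 * l' + j2') (i3 * l' + i3', j3 * n' + j3')
      = matmul_tensor (i, j) (i2, j2) (i3, j3) * (matmul_tensor (i', j') (i2', j2') (i3', j3') :: 'a)"
      by (simp only: matmul_tensor_div_mod[of "i * n' + i'" "j * m' + j'" _ _ _ _ n' m' l'] dm lts)
    then show ?case
      by (simp add: a b c fam_tensor_def)
  qed (auto simp: fam_index_def lt)
qed

text \<open>The price of replacing a degeneration by an exact identity. A coefficient of degree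
  \<open>e\<close> is a sum over the degrees contributed by the first two modes, the third being
  determined; each of the at most (e + 1)^2 choices is a restriction of
  \<open>\<langle>n, m, l\<rangle>\<close>. For \<open>e\<close> linear in the power this is a
  polynomial factor, invisible to asymptotic rank.\<close>

lemma has_rank_mmform_coeff:
  fixes T :: "nat \<Rightarrow> nat \<Rightarrow> nat \<Rightarrow> 'a::field" and F :: "'x \<Rightarrow> 'y \<Rightarrow> 'z \<Rightarrow> 'a poly"
  assumes "mmform n m l F"
  shows "has_rank (fam_index d p n' m' \<times> UNIV) (fam_index d p m' l' \<times> UNIV) (fam_index d p l' n' \<times> UNIV)
           (\<lambda>a b c. fam_tensor T p (fst a) (fst b) (fst c) * coeff (F (snd a) (snd b) (snd c)) e)
           ((e + 1)\<^sup>2 * fam_rank d T p (n * n') (m * m') (l * l'))"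
proof -
  obtain A B C where F: "\<And>x y z. F x y z = (\<Sum>i<n. \<Sum>j<m. \<Sum>k<l. A x i j * B y j k * C z k i)"
    using assms unfolding mmform_def by blast
  define E where "E = (SIGMA e1:{..e}. {..e - e1})"
  define r where "r = fam_rank d T p (n * n') (m * m') (l * l')"
  define S where "S ee = (\<lambda>a b c. fam_tensor T p (fst a) (fst b) (fst c) *
      (\<Sum>i<n. \<Sum>j<m. \<Sum>k<l. coeff (A (snd a) i j) (fst ee) * coeff (B (snd b) j k) (snd ee) * coeff (C (snd c) k i) (e - fst ee - snd ee)))" for ee
  have "card E \<le> card ({..e} \<times> {..e})" unfolding E_def by (rule card_mono) auto
  then have cE: "card E \<le> (e + 1)\<^sup>2" by (simp add: power2_eq_square)
  have "has_rank (fam_index d p n' m' \<times> UNIV) (fam_index d p m' l' \<times> UNIV) (fam_index d p l' n' \<times> UNIV) (S ee) r" for ee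
    unfolding r_def
  proof (rule has_rank_restrict[OF has_rank_fam_matmul, where \<alpha> = "\<lambda>x ij. coeff (A x (fst ij) (snd ij)) (fst ee)"
        and \<beta> = "\<lambda>x ij. coeff (B x (fst ij) (snd ij)) (snd ee)" and \<gamma> = "\<lambda>x ij. coeff (C x (fst ij) (snd ij)) (e - fst ee - snd ee)"])
    fix a0 b0 c0 a b c
    show "S ee (a0, a) (b0, b) (c0, c) = (\<Sum>ij\<in>{..<n} \<times> {..<m}. \<Sum>jk\<in>{..<m} \<times> {..<l}. \<Sum>ki\<in>{..<l} \<times> {..<n}.
        coeff (A a (fst ij) (snd ij)) (fst ee) * coeff (B b (fst jk) (snd jk)) (snd ee) * coeff (C c (fst ki) (snd ki)) (e - fst ee - snd ee) *
        (fam_tensor T p (fst (a0, ij)) (fst (b0, jk)) (fst (c0, ki)) * matmul_tensor (snd (a0, ij)) (snd (b0, jk)) (snd (c0, ki))))"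
      unfolding S_def fst_conv snd_conv matmul_collapse[symmetric] sum_distrib_left
      by (intro sum.cong refl) (simp only: mult_ac)
  qed
  then have "has_rank (fam_index d p n' m' \<times> UNIV) (fam_index d p m' l' \<times> UNIV) (fam_index d p l' n' \<times> UNIV)
      (\<lambda>a b c. \<Sum>ee\<in>E. S ee a b c) (\<Sum>ee\<in>E. r)"
    by (intro has_rank_sum) (auto simp: E_def)
  then have *: "has_rank (fam_index d p n' m' \<times> UNIV) (fam_index d p m' l' \<times> UNIV) (fam_index d p l' n' \<times> UNIV)
      (\<lambda>a b c. \<Sum>ee\<in>E. S ee a b c) ((e + 1)\<^sup>2 * r)"
    by (rule has_rank_mono) (use cE in simp)
  have "coeff (F x y z) e = (\<Sum>ee\<in>E. \<Sum>i<n. \<Sum>j<m. \<Sum>k<l. coeff (A x i j) (fst ee) * coeff (B y j k) (snd ee) * coeff (C z k i) (e - fst ee - snd ee))" for x y z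
  proof -
    have "coeff (F x y z) e = (\<Sum>i<n. \<Sum>j<m. \<Sum>k<l. \<Sum>ee\<in>E. coeff (A x i j) (fst ee) * coeff (B y j k) (snd ee) * coeff (C z k i) (e - fst ee - snd ee))"
      unfolding F coeff_sum coeff_sum_mult3 E_def split_def ..
    also have "\<dots> = (\<Sum>i<n. \<Sum>j<m. \<Sum>ee\<in>E. \<Sum>k<l. coeff (A x i j) (fst ee) * coeff (B y j k) (snd ee) * coeff (C z k i) (e - fst ee - snd ee))"
      by (intro sum.cong refl sum.swap)
    also have "\<dots> = (\<Sum>i<n. \<Sum>ee\<in>E. \<Sum>j<m. \<Sum>k<l. coeff (A x i j) (fst ee) * coeff (B y j k) (snd ee) * coeff (C z k i) (e - fst ee - snd ee))"
      by (intro sum.cong refl sum.swap)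
    also have "\<dots> = (\<Sum>ee\<in>E. \<Sum>i<n. \<Sum>j<m. \<Sum>k<l. coeff (A x i j) (fst ee) * coeff (B y j k) (snd ee) * coeff (C z k i) (e - fst ee - snd ee))"
      by (rule sum.swap)
    finally show ?thesis .
  qed
  then show ?thesis
    using * unfolding r_def S_def by (simp add: sum_distrib_left)
qed

lemma if_zero_mult: "(if P then x else 0) = (if P then 1 else 0) * (x :: 'a::semiring_1)"
  by simp

lemma dsum_conv: "dsum T (a, v) (b, v') (c, v'') = (if v = v' \<and> v = v'' then 1 else 0) * T a b c"
  unfolding dsum_def prod.case by (rule if_zero_mult)

text \<open>Schoenhage's argument: if \<open>card V\<close> copies together have rank at most
  \<open>e * card V\<close>, then tensoring the copies once more costs a factor \<open>e\<close>
  each time, so the asymptotic rank of a single copy is at most \<open>e\<close>. The factor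
  \<open>card V\<close> is constant in \<open>L\<close>.\<close>

lemma schonhage:
  fixes T :: "nat \<Rightarrow> nat \<Rightarrow> nat \<Rightarrow> 'a::field"
  assumes V: "finite V" "V \<noteq> {}" and R: "has_rank (fam_index d p n m \<times> V) (fam_index d p m l \<times> V) (fam_index d p l n \<times> V) (dsum (fam_tensor T p)) R"
    and "R \<le> e * card V"
  shows "fam_rank d T (p * L) (n ^ L) (m ^ L) (l ^ L) \<le> e ^ L * card V"
proof -
  have "has_rank (fam_index d (p * L) (n ^ L) (m ^ L) \<times> V) (fam_index d (p * L) (m ^ L) (l ^ L) \<times> V)
      (fam_index d (p * L) (l ^ L) (n ^ L) \<times> V) (dsum (fam_tensor T (p * L))) (e ^ L * card V)"
  proof (induction L)
    case 0
    show ?case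
    proof (rule has_rankI_sum[where S = V and u = "\<lambda>s a. if snd a = s then 1 else 0"
          and v = "\<lambda>s a. if snd a = s then 1 else 0" and w = "\<lambda>s a. if snd a = s then 1 else 0"])
      fix a b c
      assume a: "a \<in> fam_index d (p * 0) (n ^ 0) (m ^ 0) \<times> V" and b: "b \<in> fam_index d (p * 0) (m ^ 0) (l ^ 0) \<times> V"
        and c: "c \<in> fam_index d (p * 0) (l ^ 0) (n ^ 0) \<times> V"
      obtain a1 x b1 y c1 z where abc: "a = (a1, x)" "b = (b1, y)" "c = (c1, z)" by (metis prod.collapse)
      have one: "fam_tensor T (p * 0) a1 b1 c1 = 1"
        using a b c by (auto simp: abc fam_tensor_def fam_index_def kron_pow_0 matmul_tensor_def)
      have delta: "(if x = s then 1 else 0) * F s = (if s = x then F x else 0)" for s and F :: "_ \<Rightarrow> 'a"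
        by simp
      have "(\<Sum>s\<in>V. (if x = s then 1 else 0) * (if y = s then 1 else 0) * (if z = s then 1 else (0::'a)))
         = (\<Sum>s\<in>V. if s = x then (if y = x then 1 else 0) * (if z = x then 1 else 0) else 0)"
        by (simp only: mult.assoc delta[where F = "\<lambda>s. (if y = s then 1 else 0) * (if z = s then 1 else 0)"])
      also have "\<dots> = (if y = x then 1 else 0) * (if z = x then 1 else 0)"
        using a V(1) by (simp add: sum.delta abc)
      also have "\<dots> = dsum (fam_tensor T (p * 0)) a b c"
        unfolding abc dsum_conv one by (cases "y = x"; cases "z = x") simp_all
      finally show "dsum (fam_tensor T (p * 0)) a b c = (\<Sum>s\<in>V. (if snd a = s then 1 else 0) * (if snd b = s then 1 else 0) * (if snd c = s then 1 else 0))"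
        unfolding abc snd_conv by (rule sym)
    qed (use V in auto)
  next
    case (Suc L)
    let ?f = "\<lambda>n m (a, v). (snd (split_index p n m a), (fst (split_index p n m a), v))"
    have "has_rank (fam_index d (p + p * L) (n * n ^ L) (m * m ^ L) \<times> V) (fam_index d (p + p * L) (m * m ^ L) (l * l ^ L) \<times> V)
      (fam_index d (p + p * L) (l * l ^ L) (n * n ^ L) \<times> V) (dsum (fam_tensor T (p + p * L))) (e * (e ^ L * card V))"
    proof (rule has_rank_reindex[OF has_rank_dsum_kron[OF V(1) R \<open>R \<le> e * card V\<close> Suc.IH], where f = "?f (n ^ L) (m ^ L)"
          and g = "?f (m ^ L) (l ^ L)" and h = "?f (l ^ L) (n ^ L)"], goal_cases)
      case (1 a)
      then obtain a1 v where a: "a = (a1, v)" "a1 \<in> fam_index d (p + p * L) (n * n ^ L) (m * m ^ L)" "v \<in> V" by blast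
      show ?case
        using split_index_mem[OF a(2)] a(3) unfolding a(1) by simp
    next
      case (2 a)
      then obtain a1 v where a: "a = (a1, v)" "a1 \<in> fam_index d (p + p * L) (m * m ^ L) (l * l ^ L)" "v \<in> V" by blast
      show ?case
        using split_index_mem[OF a(2)] a(3) unfolding a(1) by simp
    next
      case (3 a)
      then obtain a1 v where a: "a = (a1, v)" "a1 \<in> fam_index d (p + p * L) (l * l ^ L) (n * n ^ L)" "v \<in> V" by blast
      show ?case
        using split_index_mem[OF a(2)] a(3) unfolding a(1) by simp
    next
      case (4 a b c)
      obtain a1 v b1 v' c1 v'' where abc: "a = (a1, v)" "b = (b1, v')" "c = (c1, v'')"
        by (metis prod.collapse)
      have split: "fam_tensor T (p + p * L) a1 b1 c1 =
          fam_tensor T p (fst (split_index p (n ^ L) (m ^ L) a1)) (fst (split_index p (m ^ L) (l ^ L) b1)) (fst (split_index p (l ^ L) (n ^ L) c1)) *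
          fam_tensor T (p * L) (snd (split_index p (n ^ L) (m ^ L) a1)) (snd (split_index p (m ^ L) (l ^ L) b1)) (snd (split_index p (l ^ L) (n ^ L) c1))"
        by (rule fam_tensor_split) (use 4 abc in auto)
      show ?case
        unfolding abc prod.case fst_conv snd_conv dsum_conv split by (rule mult.assoc[symmetric])
    qed
    then show ?case by (simp add: mult.assoc)
  qed
  note rank = this
  obtain v where "v \<in> V" using V(2) by blast
  then show ?thesis
    by (intro fam_rank_le has_rank_reindex[OF rank, where f = "\<lambda>a. (a, v)" and g = "\<lambda>a. (a, v)" and h = "\<lambda>a. (a, v)"])
       (simp_all add: dsum_conv)
qed

section \<open>The core tensor and its Kronecker powers\<close>

text \<open>The direct sum of \<open>T \<otimes> T\<close> and of copies of \<open>\<langle>1, 1, g\<rangle>\<close>, the latter numbered by \<open>i\<close>.\<close>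

fun core_tensor :: "(nat \<Rightarrow> nat \<Rightarrow> nat \<Rightarrow> 'a::field) \<Rightarrow> nat \<times> nat + nat \<Rightarrow> nat \<times> nat + nat \<times> nat \<Rightarrow> nat \<times> nat + nat \<times> nat \<Rightarrow> 'a" where
  "core_tensor T (Inl (a, a')) (Inl (b, b')) (Inl (c, c')) = T a b c * T a' b' c'"
| "core_tensor T (Inr i) (Inr (i', m)) (Inr (i'', m')) = (if i = i' \<and> i = i'' \<and> m = m' then 1 else 0)"
| "core_tensor T _ _ _ = 0"

text \<open>The blocks of a Kronecker power of \<open>core_tensor T\<close> are labelled by words, with letter \<open>0\<close> for
  \<open>T \<otimes> T\<close> and letter \<open>Suc i\<close> for copy \<open>i\<close>. Two entries of \<open>xs\<close> are consumed by each letter \<open>0\<close>, one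
  base \<open>g\<close> digit of \<open>e\<close> by each other letter.\<close>

fun word_x :: "nat list \<Rightarrow> nat list \<Rightarrow> (nat \<times> nat + nat) list" where
  "word_x [] xs = []"
| "word_x (0 # w) xs = Inl (xs ! 0, xs ! 1) # word_x w (drop 2 xs)"
| "word_x (Suc i # w) xs = Inr i # word_x w xs"

fun word_y :: "nat \<Rightarrow> nat list \<Rightarrow> nat list \<Rightarrow> nat \<Rightarrow> (nat \<times> nat + nat \<times> nat) list" where
  "word_y g [] ys e = []"
| "word_y g (0 # w) ys e = Inl (ys ! 0, ys ! 1) # word_y g w (drop 2 ys) e"
| "word_y g (Suc i # w) ys e = Inr (i, e mod g) # word_y g w ys (e div g)"

abbreviation zeros :: "nat list \<Rightarrow> nat" where
  "zeros w \<equiv> count_list w 0"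

text \<open>\<open>core_tensor\<close> couples only equal letters, so blocks of different words do
  not interact, and the block of \<open>w\<close> is a power of T times <1, 1, g^(number of nonzero
  letters)>. The bounds on \<open>e\<close> and \<open>e'\<close> ensure that equal digits mean
  equal numbers; in the base case they force both to be 0.\<close>

lemma kron_pow_core_tensor:
  assumes "length w = N" "length w' = N" "length w'' = N"
    and "length xs = 2 * zeros w" "length ys = 2 * zeros w'" "length zs = 2 * zeros w''"
    and "e < g ^ (N - zeros w')" "e' < g ^ (N - zeros w'')"
  shows "kron_pow N (core_tensor T) (word_x w xs) (word_y g w' ys e) (word_y g w'' zs e')
    = (if w = w' \<and> w = w'' then kron_pow (2 * zeros w) T xs ys zs * (if e = e' then 1 else 0) else 0)"
  using assms
proof (induction N arbitrary: w w' w'' xs ys zs e e')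
  case 0
  then show ?case by (simp add: kron_pow_0)
next
  case (Suc N)
  obtain c v c' v' c'' v'' where w: "w = c # v" "w' = c' # v'" "w'' = c'' # v''"
    using Suc.prems(1-3) by (metis length_Suc_conv)
  have len: "length v = N" "length v' = N" "length v'' = N" using Suc.prems w by auto
  have le: "zeros v \<le> N" "zeros v' \<le> N" "zeros v'' \<le> N" using len count_le_length by metis+
  have two: "kron_pow (2 + 2 * q) T xs ys zs = T (xs ! 0) (ys ! 0) (zs ! 0) * T (xs ! 1) (ys ! 1) (zs ! 1) *
      kron_pow (2 * q) T (drop 2 xs) (drop 2 ys) (drop 2 zs)"
    if "length xs = 2 + 2 * q" "length ys = 2 + 2 * q" "length zs = 2 + 2 * q" for q
    unfolding kron_pow_add[OF that] by (simp add: kron_pow_def numeral_2_eq_2 that)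
  have digit: "e div g < g ^ (N - zeros v)" if "e < g ^ (Suc N - zeros v)" "zeros v \<le> N" for e v
    using that by (simp add: Suc_diff_le less_mult_imp_div_less mult.commute)
  show ?case
  proof (cases "c = c' \<and> c = c''")
    case False
    then show ?thesis unfolding w by (cases c; cases c'; cases c'') (auto simp: kron_pow_Suc)
  next
    case True
    then have [simp]: "c' = c" "c'' = c" by auto
    show ?thesis
    proof (cases c)
      case 0
      have "kron_pow (Suc N) (core_tensor T) (word_x w xs) (word_y g w' ys e) (word_y g w'' zs e')
        = T (xs ! 0) (ys ! 0) (zs ! 0) * T (xs ! 1) (ys ! 1) (zs ! 1) *
          kron_pow N (core_tensor T) (word_x v (drop 2 xs)) (word_y g v' (drop 2 ys) e) (word_y g v'' (drop 2 zs) e')"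
        unfolding w by (simp add: 0 kron_pow_Suc)
      also have "kron_pow N (core_tensor T) (word_x v (drop 2 xs)) (word_y g v' (drop 2 ys) e) (word_y g v'' (drop 2 zs) e')
        = (if v = v' \<and> v = v'' then kron_pow (2 * zeros v) T (drop 2 xs) (drop 2 ys) (drop 2 zs) * (if e = e' then 1 else 0) else 0)"
        by (rule Suc.IH[OF len]) (use Suc.prems w 0 in auto)
      finally show ?thesis
        using two[of "zeros v"] Suc.prems w 0 by auto
    next
      case (Suc i)
      have "kron_pow (Suc N) (core_tensor T) (word_x w xs) (word_y g w' ys e) (word_y g w'' zs e')
        = (if e mod g = e' mod g then 1 else 0) *
          kron_pow N (core_tensor T) (word_x v xs) (word_y g v' ys (e div g)) (word_y g v'' zs (e' div g))"
        unfolding w by (simp add: Suc kron_pow_Suc)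
      also have "kron_pow N (core_tensor T) (word_x v xs) (word_y g v' ys (e div g)) (word_y g v'' zs (e' div g))
        = (if v = v' \<and> v = v'' then kron_pow (2 * zeros v) T xs ys zs * (if e div g = e' div g then 1 else 0) else 0)"
        by (rule Suc.IH[OF len]) (use Suc.prems w Suc le digit in auto)
      finally show ?thesis
        using eq_iff_div_mod[of e e' g] w Suc by auto
    qed
  qed
qed

definition core_x :: "nat \<Rightarrow> nat \<Rightarrow> (nat \<times> nat + nat) set" where
  "core_x d s = ({..<d} \<times> {..<d}) <+> {..<s}"

definition core_y :: "nat \<Rightarrow> nat \<Rightarrow> nat \<Rightarrow> (nat \<times> nat + nat \<times> nat) set" where
  "core_y d s g = ({..<d} \<times> {..<d}) <+> ({..<s} \<times> {..<g})"

lemma word_x_mem: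
  "set w \<subseteq> {..s} \<Longrightarrow> length xs = 2 * zeros w \<Longrightarrow> set xs \<subseteq> {..<d} \<Longrightarrow> word_x w xs \<in> index_pow (length w) (core_x d s)"
proof (induction w xs rule: word_x.induct)
  case (2 w xs)
  then have "word_x w (drop 2 xs) \<in> index_pow (length w) (core_x d s)"
    by (auto dest: in_set_dropD)
  moreover have "t < length xs \<Longrightarrow> xs ! t < d" for t using 2 nth_mem[of t xs] by (auto simp del: nth_mem)
  ultimately show ?case using 2 by (auto simp: index_pow_def core_x_def)
qed (auto simp: index_pow_def core_x_def)

lemma word_y_mem:
  "0 < g \<Longrightarrow> set w \<subseteq> {..s} \<Longrightarrow> length ys = 2 * zeros w \<Longrightarrow> set ys \<subseteq> {..<d} \<Longrightarrow> word_y g w ys e \<in> index_pow (length w) (core_y d s g)"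
proof (induction g w ys e rule: word_y.induct)
  case (2 g w ys e)
  then have "word_y g w (drop 2 ys) e \<in> index_pow (length w) (core_y d s g)"
    by (auto dest: in_set_dropD)
  moreover have "t < length ys \<Longrightarrow> ys ! t < d" for t using 2 nth_mem[of t ys] by (auto simp del: nth_mem)
  ultimately show ?case using 2 by (auto simp: index_pow_def core_y_def)
qed (auto simp: index_pow_def core_y_def)

text \<open>Every factor is divisible by the \<open>h\<close>-th power of the parameter, so the
  lowest possible degree of the product is \<open>h * N\<close>, and the higher-order errors in the
  \<open>q t\<close> do not reach it.\<close>

lemma coeff_prod_monom:
  fixes q :: "nat \<Rightarrow> 'a::comm_ring_1 poly"
  shows "coeff (\<Prod>t<N. monom 1 h * q t) (h * N) = (\<Prod>t<N. coeff (q t) 0)"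
proof -
  have "(\<Prod>t<N. monom 1 h * q t) = monom 1 (h * N) * (\<Prod>t<N. q t)"
    by (simp add: prod.distrib monom_power)
  then have "coeff (\<Prod>t<N. monom 1 h * q t) (h * N) = coeff (\<Prod>t<N. q t) 0"
    by (simp add: coeff_monom_mult)
  also have "\<dots> = (\<Prod>t<N. coeff (q t) 0)"
    by (simp add: poly_0_coeff_0[symmetric] poly_prod)
  finally show ?thesis .
qed

text \<open>Letter \<open>0\<close> stands for \<open>\<langle>d, d, D\<rangle>\<close>, every other letter for \<open>\<langle>1, 1, D\<rangle>\<close>.\<close>

definition core_dim :: "nat \<Rightarrow> nat \<Rightarrow> nat" where
  "core_dim d v = (if v = 0 then d else 1)"

lemma prod_core_dim: "prod_list (map (core_dim d) v) = d ^ zeros v"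
  by (induction v) (auto simp: core_dim_def)

text \<open>The \<open>N\<close>-th power of the degeneration. Expanding the product of the sums of
  the \<open>Y v\<close> gives one term per word, a matrix product of size <d^z, d^z, D^N> for a
  word with z zeros. The coefficient of degree \<open>2 * N\<close> is the Kronecker power of
  \<open>core_tensor\<close>, and its blocks with exactly \<open>k\<close> zeros are
  \<open>card W\<close> copies of one and the same member of the family.\<close>

lemma has_rank_words:
  fixes T :: "nat \<Rightarrow> nat \<Rightarrow> nat \<Rightarrow> 'a::field" and Y :: "nat \<Rightarrow> _ \<Rightarrow> _ \<Rightarrow> _ \<Rightarrow> 'a poly"
  assumes "0 < g" "k \<le> N"
    and Y: "\<And>v. v \<le> s \<Longrightarrow> mmform (core_dim d v) (core_dim d v) D (Y v)"
    and core: "\<And>x y z. x \<in> core_x d s \<Longrightarrow> y \<in> core_y d s g \<Longrightarrow> z \<in> core_y d s g \<Longrightarrow>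
      \<exists>q. (\<Sum>v\<le>s. Y v x y z) = monom 1 2 * q \<and> coeff q 0 = core_tensor T x y z"
  defines "W \<equiv> {w \<in> index_pow N {..s}. zeros w = k}"
  shows "has_rank (fam_index d (p + 2 * k) n m \<times> W) (fam_index d (p + 2 * k) m (l * g ^ (N - k)) \<times> W)
           (fam_index d (p + 2 * k) (l * g ^ (N - k)) n \<times> W) (dsum (fam_tensor T (p + 2 * k)))
           ((2 * N + 1)\<^sup>2 * (\<Sum>v\<in>index_pow N {..s}. fam_rank d T p (d ^ zeros v * n) (d ^ zeros v * m) (D ^ N * l)))"
proof -
  define P where "P v = (\<lambda>x y z. \<Prod>t<N. Y (v ! t) (x t) (y t) (z t))" for v
  define R where "R v = fam_rank d T p (d ^ zeros v * n) (d ^ zeros v * m) (D ^ N * l)" for v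
  have form: "mmform (d ^ zeros v) (d ^ zeros v) (D ^ N) (P v)" if "v \<in> index_pow N {..s}" for v
  proof -
    have "mmform (prod_list (map (core_dim d) v)) (prod_list (map (core_dim d) v)) (prod_list (map (\<lambda>_. D) v))
        (\<lambda>x y z. \<Prod>t<length v. Y (v ! t) (x t) (y t) (z t))"
      by (rule mmform_prod) (use that Y in \<open>auto simp: index_pow_def\<close>)
    moreover have "length v = N" using that by (simp add: index_pow_def)
    ultimately show ?thesis by (simp add: prod_core_dim P_def map_replicate_const)
  qed
  have "has_rank (fam_index d p n m \<times> UNIV) (fam_index d p m l \<times> UNIV) (fam_index d p l n \<times> UNIV)
      (\<lambda>a b c. \<Sum>v\<in>index_pow N {..s}. fam_tensor T p (fst a) (fst b) (fst c) * coeff (P v (snd a) (snd b) (snd c)) (2 * N))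
      (\<Sum>v\<in>index_pow N {..s}. (2 * N + 1)\<^sup>2 * R v)"
    unfolding R_def by (intro has_rank_sum has_rank_mmform_coeff form finite_index_pow) auto
  then have sum_rank: "has_rank (fam_index d p n m \<times> UNIV) (fam_index d p m l \<times> UNIV) (fam_index d p l n \<times> UNIV)
      (\<lambda>a b c. \<Sum>v\<in>index_pow N {..s}. fam_tensor T p (fst a) (fst b) (fst c) * coeff (P v (snd a) (snd b) (snd c)) (2 * N))
      ((2 * N + 1)\<^sup>2 * (\<Sum>v\<in>index_pow N {..s}. R v))"
    by (simp only: sum_distrib_left)
  have coeff: "(\<Sum>v\<in>index_pow N {..s}. coeff (P v (nth x) (nth y) (nth z)) (2 * N)) = kron_pow N (core_tensor T) x y z"
    if "x \<in> index_pow N (core_x d s)" "y \<in> index_pow N (core_y d s g)" "z \<in> index_pow N (core_y d s g)" for x y z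
  proof -
    define Q where "Q t q \<longleftrightarrow> (\<Sum>v\<le>s. Y v (x ! t) (y ! t) (z ! t)) = monom 1 2 * q \<and>
        coeff q 0 = core_tensor T (x ! t) (y ! t) (z ! t)" for t q
    have "\<exists>q. Q t q" if "t < N" for t
      unfolding Q_def by (intro core index_pow_nth[OF \<open>x \<in> _\<close>] index_pow_nth[OF \<open>y \<in> _\<close>] index_pow_nth[OF \<open>z \<in> _\<close>] that)
    then obtain q where "\<And>t. t < N \<Longrightarrow> Q t (q t)" by metis
    then have q: "\<And>t. t < N \<Longrightarrow> (\<Sum>v\<le>s. Y v (x ! t) (y ! t) (z ! t)) = monom 1 2 * q t"
      "\<And>t. t < N \<Longrightarrow> coeff (q t) 0 = core_tensor T (x ! t) (y ! t) (z ! t)"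
      unfolding Q_def by blast+
    have "(\<Sum>v\<in>index_pow N {..s}. coeff (P v (nth x) (nth y) (nth z)) (2 * N))
        = coeff (\<Prod>t<N. \<Sum>v\<le>s. Y v (x ! t) (y ! t) (z ! t)) (2 * N)"
      by (simp only: P_def coeff_sum prod_sum_lists finite_atMost)
    also have "(\<Prod>t<N. \<Sum>v\<le>s. Y v (x ! t) (y ! t) (z ! t)) = (\<Prod>t<N. monom 1 2 * q t)"
      by (rule prod.cong) (auto simp: q)
    also have "coeff \<dots> (2 * N) = (\<Prod>t<N. coeff (q t) 0)" by (rule coeff_prod_monom)
    also have "\<dots> = kron_pow N (core_tensor T) x y z"
      unfolding kron_pow_def by (rule prod.cong) (auto simp: q)
    finally show ?thesis .
  qed
  let ?G = "g ^ (N - k)"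
  \<comment> \<open>The first \<open>p\<close> list entries stay with the factor T^p that was there
    before; the remaining \<open>2 * k\<close> feed the letters 0. The third dimension
    \<open>l * ?G\<close> is split by quotient and remainder: the quotient belongs to the old matrix
    product, the remainder supplies the digits for the nonzero letters.\<close>
  let ?fx = "\<lambda>((xs, i, j), w). ((take p xs, i, j), nth (word_x w (drop p xs)))"
  let ?fy = "\<lambda>((xs, j, e), w). ((take p xs, j, e div ?G), nth (word_y g w (drop p xs) (e mod ?G)))"
  let ?fz = "\<lambda>((xs, e, i), w). ((take p xs, e div ?G, i), nth (word_y g w (drop p xs) (e mod ?G)))"
  show ?thesis
    unfolding R_def[symmetric]
  proof (rule has_rank_reindex[OF sum_rank, where f = ?fx and g = ?fy and h = ?fz], goal_cases)
    case (4 a b c)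
    obtain xs i j w where a: "a = ((xs, i, j), w)" by (metis prod.collapse)
    obtain ys j' e w' where b: "b = ((ys, j', e), w')" by (metis prod.collapse)
    obtain zs e' i' w'' where c: "c = ((zs, e', i'), w'')" by (metis prod.collapse)
    have xs: "xs \<in> index_pow (p + 2 * k) {..<d}" "ys \<in> index_pow (p + 2 * k) {..<d}" "zs \<in> index_pow (p + 2 * k) {..<d}"
      and w: "w \<in> W" "w' \<in> W" "w'' \<in> W"
      using 4 by (auto simp: a b c fam_index_def)
    have len: "length xs = p + 2 * k" "length ys = p + 2 * k" "length zs = p + 2 * k"
      using xs by (auto simp: index_pow_def)
    have W: "length v = N" "set v \<subseteq> {..s}" "zeros v = k" if "v \<in> W" for v
      using that by (auto simp: W_def index_pow_def)
    have drops: "set (drop p v) \<subseteq> {..<d}" "length (drop p v) = 2 * k" if "v \<in> index_pow (p + 2 * k) {..<d}" for v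
      using index_pow_take_drop(2)[OF that] by (auto simp: index_pow_def)
    have mem: "word_x w (drop p xs) \<in> index_pow N (core_x d s)"
      "word_y g w' (drop p ys) q \<in> index_pow N (core_y d s g)" "word_y g w'' (drop p zs) q \<in> index_pow N (core_y d s g)" for q
      using word_x_mem[of w s "drop p xs" d] word_y_mem[OF \<open>0 < g\<close>, of w' s "drop p ys" d]
        word_y_mem[OF \<open>0 < g\<close>, of w'' s "drop p zs" d] W w drops xs by auto
    have G: "e mod ?G < ?G" "e' mod ?G < ?G" using \<open>0 < g\<close> by auto
    have K: "kron_pow N (core_tensor T) (word_x w (drop p xs)) (word_y g w' (drop p ys) (e mod ?G)) (word_y g w'' (drop p zs) (e' mod ?G))
      = (if w = w' \<and> w = w'' then kron_pow (2 * k) T (drop p xs) (drop p ys) (drop p zs) * (if e mod ?G = e' mod ?G then 1 else 0) else 0)"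
      using kron_pow_core_tensor[of w N w' w'' "drop p xs" "drop p ys" "drop p zs" "e mod ?G" g "e' mod ?G" T] W w drops xs G by auto
    have "(\<Sum>v\<in>index_pow N {..s}. fam_tensor T p (fst (?fx a)) (fst (?fy b)) (fst (?fz c)) * coeff (P v (snd (?fx a)) (snd (?fy b)) (snd (?fz c))) (2 * N))
      = fam_tensor T p (take p xs, i, j) (take p ys, j', e div ?G) (take p zs, e' div ?G, i') *
        kron_pow N (core_tensor T) (word_x w (drop p xs)) (word_y g w' (drop p ys) (e mod ?G)) (word_y g w'' (drop p zs) (e' mod ?G))"
      unfolding a b c by (simp add: sum_distrib_left[symmetric] coeff[OF mem])
    also have "\<dots> = dsum (fam_tensor T (p + 2 * k)) a b c"
    proof -
      have "matmul_tensor (i, j) (j', e div ?G) (e' div ?G, i') * (if e mod ?G = e' mod ?G then 1 else 0)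
        = (matmul_tensor (i, j) (j', e) (e', i') :: 'a)"
        using eq_iff_div_mod[of e e' ?G] by (cases "e = e'") (auto simp: matmul_tensor_def)
      then have A: "X * matmul_tensor (i, j) (j', e div ?G) (e' div ?G, i') *
          (\<delta> * (Z * (if e mod ?G = e' mod ?G then 1 else 0))) = \<delta> * (X * Z * matmul_tensor (i, j) (j', e) (e', i'))" for X Z \<delta> :: 'a
        by (subst (asm) eq_commute) (simp only: mult_ac)
      define \<delta> :: 'a where "\<delta> = (if w = w' \<and> w = w'' then 1 else 0)"
      have \<delta>: "(if w = w' \<and> w = w'' then x else 0) = \<delta> * x" for x
        unfolding \<delta>_def by (rule if_zero_mult)
      show ?thesis
        unfolding K a b c dsum_conv fam_tensor_def fst_conv snd_conv kron_pow_add[OF len] \<delta> mult_1_right by (rule A)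
    qed
    finally show ?case by simp
  next
    case (1 a)
    then show ?case by (cases a) (auto simp: fam_index_def index_pow_take_drop(1))
  next
    case (2 a)
    then show ?case by (cases a) (auto simp: fam_index_def index_pow_take_drop(1) less_mult_imp_div_less)
  next
    case (3 a)
    then show ?case by (cases a) (auto simp: fam_index_def index_pow_take_drop(1) less_mult_imp_div_less)
  qed
qed

section \<open>The degeneration\<close>

text \<open>For fixed \<open>b\<close> the kernel condition is \<open>d\<close> equations, one per
  \<open>l\<close>, in the \<open>3 * d\<close> unknowns indexed by \<open>e\<close> and
  \<open>k\<close>, so \<open>2 * d\<close> solutions remain; the \<open>d\<close> values of
  \<open>b\<close> give \<open>2 * d * d\<close> vectors \<zeta> with disjoint supports for
  different \<open>b\<close>. The \<eta> are coordinate vectors, on which no condition is imposed: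
  only one of the two families has to be orthogonal to the old variables.\<close>

lemma kernel_duals:
  fixes t :: "nat \<Rightarrow> nat \<Rightarrow> nat \<Rightarrow> 'a::field"
  shows "\<exists>\<eta> \<zeta>. (\<forall>m<2 * d * d. \<forall>b<d. \<forall>l<d. (\<Sum>e<3. \<Sum>k<d. t e l k * \<zeta> m b k e) = 0) \<and>
    (\<forall>m<2 * d * d. \<forall>m'<2 * d * d. (\<Sum>b<d. \<Sum>k<d. \<Sum>e<3. \<eta> m b k e * \<zeta> m' b k e) = (if m = m' then 1 else 0))"
proof -
  have "card {..<d} + 2 * d \<le> card ({..<3::nat} \<times> {..<d})" by (simp add: card_cartesian_product)
  from homogeneous_system[OF finite_lessThan finite_cartesian_product[OF finite_lessThan finite_lessThan] this,
      of "\<lambda>l i. t (fst i) l (snd i)"]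
  obtain J a where J: "J \<subseteq> {..<3} \<times> {..<d}" "card J = 2 * d"
    and sys: "\<forall>j\<in>J. (\<forall>l\<in>{..<d}. (\<Sum>i\<in>{..<3} \<times> {..<d}. t (fst i) l (snd i) * a j i) = 0) \<and>
      (\<forall>j'\<in>J. a j j' = (if j' = j then 1 else 0))"
    by (elim exE conjE)
  have ker: "(\<Sum>i\<in>{..<3} \<times> {..<d}. t (fst i) l (snd i) * a j i) = 0" if "j \<in> J" "l < d" for j l
    using bspec[OF sys that(1)] that(2) by simp
  have dual: "a j j' = (if j' = j then 1 else 0)" if "j \<in> J" "j' \<in> J" for j j'
    using bspec[OF sys that(1)] that(2) by blast
  have "finite J" using J(1) finite_subset by blast
  then have "card ({..<d} \<times> J) = 2 * d * d" "finite ({..<d} \<times> J)"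
    using J(2) by (auto simp: card_cartesian_product)
  then obtain h where h: "bij_betw h {..<2 * d * d} ({..<d} \<times> J)"
    by (metis ex_bij_betw_nat_finite atLeast0LessThan)
  have hm: "fst (h m) < d" "snd (h m) \<in> J" "fst (snd (h m)) < 3" "snd (snd (h m)) < d" if "m < 2 * d * d" for m
    using bij_betwE[OF h] that J(1) by (auto simp: mem_Times_iff)
  have inj: "h m = h m' \<longleftrightarrow> m = m'" if "m < 2 * d * d" "m' < 2 * d * d" for m m'
    using bij_betw_imp_inj_on[OF h] that by (auto simp: inj_on_def)
  define \<zeta> where "\<zeta> m b k e = (if b = fst (h m) then a (snd (h m)) (e, k) else 0)" for m b k e
  define \<eta> where "\<eta> m b k e = (if b = fst (h m) then if k = snd (snd (h m)) then if e = fst (snd (h m)) then 1 else 0 else 0 else 0 :: 'a)" for m b k e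
  show ?thesis
  proof (rule exI[of _ \<eta>], rule exI[of _ \<zeta>], intro conjI allI impI)
    fix m b l assume m: "m < 2 * d * d" and "b < d" "l < d"
    have "(\<Sum>e<3. \<Sum>k<d. t e l k * \<zeta> m b k e) = (if b = fst (h m) then (\<Sum>i\<in>{..<3} \<times> {..<d}. t (fst i) l (snd i) * a (snd (h m)) i) else 0)"
      unfolding \<zeta>_def by (simp add: sum.cartesian_product split_def)
    then show "(\<Sum>e<3. \<Sum>k<d. t e l k * \<zeta> m b k e) = 0"
      using ker[OF hm(2)[OF m] \<open>l < d\<close>] by simp
  next
    fix m m' assume m: "m < 2 * d * d" "m' < 2 * d * d"
    have 1: "(\<Sum>e<3. \<eta> m b k e * \<zeta> m' b k e) = (if k = snd (snd (h m)) then if b = fst (h m) then \<zeta> m' b k (fst (snd (h m))) else 0 else 0)" for b k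
    proof -
      have "(\<Sum>e<3. \<eta> m b k e * \<zeta> m' b k e) = (\<Sum>e<3. if e = fst (snd (h m)) then if k = snd (snd (h m)) then if b = fst (h m) then \<zeta> m' b k e else 0 else 0 else 0)"
        by (rule sum.cong) (auto simp: \<eta>_def)
      then show ?thesis using hm(3)[OF m(1)] by (simp add: sum.delta)
    qed
    have 2: "(\<Sum>k<d. \<Sum>e<3. \<eta> m b k e * \<zeta> m' b k e) = (if b = fst (h m) then \<zeta> m' b (snd (snd (h m))) (fst (snd (h m))) else 0)" for b
      unfolding 1 using hm(4)[OF m(1)] by (simp add: sum.delta)
    have "(\<Sum>b<d. \<Sum>k<d. \<Sum>e<3. \<eta> m b k e * \<zeta> m' b k e) = \<zeta> m' (fst (h m)) (snd (snd (h m))) (fst (snd (h m)))"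
      unfolding 2 using hm(1)[OF m(1)] by (simp add: sum.delta)
    also have "\<dots> = (if fst (h m) = fst (h m') \<and> snd (h m) = snd (h m') then 1 else 0)"
      using dual[OF hm(2)[OF m(2)] hm(2)[OF m(2)]]
      by (simp add: \<zeta>_def dual[OF hm(2)[OF m(2)] hm(2)[OF m(1)]])
    also have "\<dots> = (if m = m' then 1 else 0)"
      using inj[OF m] by (simp add: prod_eq_iff)
    finally show "(\<Sum>b<d. \<Sum>k<d. \<Sum>e<3. \<eta> m b k e * \<zeta> m' b k e) = (if m = m' then 1 else 0)" .
  qed
qed

lemma sum_pair_delta:
  fixes f :: "nat \<Rightarrow> nat \<Rightarrow> 'a::comm_monoid_add"
  shows "b < d \<Longrightarrow> (\<Sum>\<kappa>\<in>{..<d} \<times> {..<d}. if fst \<kappa> = b then f (fst \<kappa>) (snd \<kappa>) else 0) = (\<Sum>k<d. f b k)"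
    and "k < d \<Longrightarrow> (\<Sum>\<kappa>\<in>{..<d} \<times> {..<d}. if snd \<kappa> = k then f (fst \<kappa>) (snd \<kappa>) else 0) = (\<Sum>b<d. f b k)"
proof -
  have pairs: "(\<Sum>p\<in>{..<d} \<times> {..<d}. g (fst p) (snd p)) = (\<Sum>i<d. \<Sum>j<d. g i j)" for g :: "nat \<Rightarrow> nat \<Rightarrow> 'a"
    by (simp add: sum.cartesian_product split_def)
  show "(\<Sum>\<kappa>\<in>{..<d} \<times> {..<d}. if fst \<kappa> = b then f (fst \<kappa>) (snd \<kappa>) else 0) = (\<Sum>k<d. f b k)" if "b < d"
  proof -
    have "(\<Sum>j<d. if i = b then f i j else 0) = (if i = b then \<Sum>j<d. f i j else 0)" for i by simp
    then show ?thesis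
      using that pairs[of "\<lambda>i j. if i = b then f i j else 0"] by (simp add: sum.delta)
  qed
  show "(\<Sum>\<kappa>\<in>{..<d} \<times> {..<d}. if snd \<kappa> = k then f (fst \<kappa>) (snd \<kappa>) else 0) = (\<Sum>b<d. f b k)" if "k < d"
    using that pairs[of "\<lambda>i j. if j = k then f i j else 0"] by (simp add: sum.delta)
qed

lemma sum_diag_block:
  fixes f :: "nat \<Rightarrow> nat \<Rightarrow> 'a::comm_monoid_add"
  assumes "i0 < d div 3"
  shows "(\<Sum>i<d. \<Sum>j<d. if i = j \<and> i div 3 = i0 then f i j else 0) = (\<Sum>e<3. f (3 * i0 + e) (3 * i0 + e))"
proof -
  have "(\<Sum>j<d. if i = j \<and> i div 3 = i0 then f i j else 0) = (if i div 3 = i0 then f i i else 0)" if "i < d" for i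
  proof -
    have "(\<Sum>j<d. if i = j \<and> i div 3 = i0 then f i j else 0) = (\<Sum>j<d. if i = j then if i div 3 = i0 then f i j else 0 else 0)"
      by (rule sum.cong) auto
    then show ?thesis using that by (simp add: sum.delta')
  qed
  then have "(\<Sum>i<d. \<Sum>j<d. if i = j \<and> i div 3 = i0 then f i j else 0) = (\<Sum>i<d. if i div 3 = i0 then f i i else 0)"
    by (intro sum.cong) auto
  also have "\<dots> = (\<Sum>i\<in>{i \<in> {..<d}. i div 3 = i0}. f i i)" by (rule sum.inter_filter[symmetric]) simp
  also have "\<dots> = (\<Sum>e<3. f (3 * i0 + e) (3 * i0 + e))"
    by (rule sum.reindex_bij_witness[where i = "\<lambda>e. 3 * i0 + e" and j = "\<lambda>i. i - 3 * i0"]) (use assms in auto)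
  finally show ?thesis .
qed

text \<open>Write \<open>T \<otimes> T\<close> as a restriction of \<open>\<langle>d, d, d\<^sup>2\<rangle>\<close> in which the first mode is a full matrix, scale that
  mode by the square of the degeneration parameter, and add to it the new variable number \<open>i\<close> on the
  three diagonal entries \<open>3 i\<close>, \<open>3 i + 1\<close>, \<open>3 i + 2\<close>. The old variables of the other two modes then meet
  the new one in a form of rank at most \<open>d\<^sup>2\<close>, which \<open>Y1 i\<close> cancels. The new variables of these modes,
  scaled by the parameter, are placed by \<open>\<eta>\<close> and \<open>\<zeta>\<close> on the \<open>3 d\<^sup>2\<close> coordinates of the block; choosing
  \<open>\<zeta>\<close> in the kernel of the \<open>d\<^sup>2\<close> old forms leaves room for \<open>2 d\<^sup>2\<close> of them, and the cross terms of
  \<open>\<eta>\<close> are again cancelled by \<open>Y1 i\<close>.\<close>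

lemma core_degeneration:
  fixes T :: "nat \<Rightarrow> nat \<Rightarrow> nat \<Rightarrow> 'a::field"
  shows "\<exists>Y. (\<forall>v\<le>d div 3. mmform (core_dim d v) (core_dim d v) (d * d) (Y v)) \<and>
    (\<forall>x\<in>core_x d (d div 3). \<forall>y\<in>core_y d (d div 3) (2 * d * d). \<forall>z\<in>core_y d (d div 3) (2 * d * d).
      \<exists>q. (\<Sum>v\<le>d div 3. Y v x y z) = monom 1 2 * q \<and> coeff q 0 = core_tensor T x y z)"
proof -
  define s where "s = d div 3"
  define g where "g = 2 * d * d"
  define P where "P i p \<longleftrightarrow>
      (\<forall>m<g. \<forall>b<d. \<forall>l<d. (\<Sum>e<3. \<Sum>k<d. T (3 * i + e) l k * snd p m b k e) = 0) \<and>
      (\<forall>m<g. \<forall>m'<g. (\<Sum>b<d. \<Sum>k<d. \<Sum>e<3. fst p m b k e * snd p m' b k e) = (if m = m' then 1 else 0))"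
    for i and p :: "(nat \<Rightarrow> nat \<Rightarrow> nat \<Rightarrow> nat \<Rightarrow> 'a) \<times> (nat \<Rightarrow> nat \<Rightarrow> nat \<Rightarrow> nat \<Rightarrow> 'a)"
  have "\<exists>p. P i p" for i
  proof -
    obtain \<eta> \<zeta> where "P i (\<eta>, \<zeta>)"
      using kernel_duals[of d "\<lambda>e. T (3 * i + e)"] unfolding P_def g_def fst_conv snd_conv by (elim exE)
    then show ?thesis ..
  qed
  then obtain p where p: "\<And>i. P i (p i)" by metis
  define \<eta> where "\<eta> i = fst (p i)" for i
  define \<zeta> where "\<zeta> i = snd (p i)" for i
  have ker: "(\<Sum>e<3. \<Sum>k<d. T (3 * i + e) l k * \<zeta> i m b k e) = 0" if "m < g" "b < d" "l < d" for i m b l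
    using p[of i] that unfolding P_def \<zeta>_def by blast
  have dual: "(\<Sum>b<d. \<Sum>k<d. \<Sum>e<3. \<eta> i m b k e * \<zeta> i m' b k e) = (if m = m' then 1 else 0)" if "m < g" "m' < g" for i m m'
    using p[of i] that unfolding P_def \<zeta>_def \<eta>_def by blast
  \<comment> \<open>In the term \<open>Y0\<close> the contracted index \<kappa> is a pair consisting
    of the second coordinate in the first factor T and the third coordinate in the second factor T.
    Thus \<open>y\<close> keeps the former and is expanded along its other entry by T, and
    \<open>z\<close> does so the other way round.\<close>
  define K where "K = {..<d} \<times> {..<d}"
  \<comment> \<open>Bookkeeping of degrees: old \<open>x\<close> carries 2, new \<open>x\<close>
    carries 0, new \<open>y\<close> and \<open>z\<close> carry 1 each. The wanted terms old-old-old
    and new-new-new have degree 2. Old \<open>x\<close> with a new \<open>y\<close> or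
    \<open>z\<close> has larger degree and disappears; new \<open>x\<close> with an old
    \<open>y\<close> or \<open>z\<close> has degree 0 or 1 and must cancel exactly.\<close>
  define deg :: "nat \<times> nat + nat \<times> nat \<Rightarrow> nat" where "deg = case_sum (\<lambda>_. 0) (\<lambda>_. 1)"
  define A0 :: "nat \<times> nat + nat \<Rightarrow> nat \<Rightarrow> nat \<Rightarrow> 'a poly" where
    "A0 x i j = (case x of Inl (a, a') \<Rightarrow> if i = a then if j = a' then monom 1 2 else 0 else 0
      | Inr i0 \<Rightarrow> if i = j \<and> i div 3 = i0 then 1 else 0)" for x i j
  define b0 :: "nat \<times> nat + nat \<times> nat \<Rightarrow> nat \<Rightarrow> nat \<times> nat \<Rightarrow> 'a" where
    "b0 y j \<kappa> = (case y of Inl (b, l) \<Rightarrow> if fst \<kappa> = b then T j l (snd \<kappa>) else 0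
      | Inr (i, m) \<Rightarrow> if j div 3 = i then \<eta> i m (fst \<kappa>) (snd \<kappa>) (j mod 3) else 0)" for y j \<kappa>
  define c0 :: "nat \<times> nat + nat \<times> nat \<Rightarrow> nat \<times> nat \<Rightarrow> nat \<Rightarrow> 'a" where
    "c0 z \<kappa> i = (case z of Inl (c, k) \<Rightarrow> if snd \<kappa> = k then T i (fst \<kappa>) c else 0
      | Inr (i0, m) \<Rightarrow> if i div 3 = i0 then \<zeta> i0 m (fst \<kappa>) (snd \<kappa>) (i mod 3) else 0)" for z \<kappa> i
  \<comment> \<open>Here \<kappa> is reread as the index of an old variable of the third mode, which
    \<open>c1\<close> merely selects. Hence \<open>Y1 i\<close> can cancel any bilinear form between
    \<open>y\<close> and the old \<open>z\<close>, but nothing that involves a new \<open>z\<close>;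
    the products of old \<open>y\<close> with new \<open>z\<close> are left to the kernel condition
    on \<zeta>.\<close>
  define b1 :: "nat \<Rightarrow> nat \<times> nat + nat \<times> nat \<Rightarrow> nat \<times> nat \<Rightarrow> 'a" where
    "b1 i y \<kappa> = - (case y of Inl (b, l) \<Rightarrow> \<Sum>e<3. T (3 * i + e) l (snd \<kappa>) * T (3 * i + e) b (fst \<kappa>)
      | Inr (i', m) \<Rightarrow> if i' = i then \<Sum>e<3. \<Sum>b<d. \<eta> i m b (snd \<kappa>) e * T (3 * i + e) b (fst \<kappa>) else 0)" for i y \<kappa>
  define c1 :: "nat \<times> nat + nat \<times> nat \<Rightarrow> nat \<times> nat \<Rightarrow> 'a" where
    "c1 z \<kappa> = (case z of Inl ck \<Rightarrow> if \<kappa> = ck then 1 else 0 | Inr _ \<Rightarrow> 0)" for z \<kappa>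
  define Y0 where "Y0 x y z = (\<Sum>i<d. \<Sum>j<d. \<Sum>\<kappa>\<in>K. A0 x i j * monom (b0 y j \<kappa>) (deg y) * monom (c0 z \<kappa> i) (deg z))" for x y z
  define Y1 :: "nat \<Rightarrow> nat \<times> nat + nat \<Rightarrow> _ \<Rightarrow> _ \<Rightarrow> 'a poly" where
    "Y1 i x y z = (\<Sum>i'<Suc 0. \<Sum>j'<Suc 0. \<Sum>\<kappa>\<in>K. (if x = Inr i then 1 else 0) * monom (b1 i y \<kappa>) (deg y) * monom (c1 z \<kappa>) (deg z))" for i x y z
  define Y where "Y v = (case v of 0 \<Rightarrow> Y0 | Suc i \<Rightarrow> Y1 i)" for v
  have K: "finite K" "card K = d * d" by (auto simp: K_def card_cartesian_product)
  have form: "mmform (core_dim d v) (core_dim d v) (d * d) (Y v)" for v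
  proof (cases v)
    case 0
    have "mmform d d (card K) Y0" by (rule mmformI[OF K(1)]) (rule Y0_def)
    then show ?thesis by (simp add: 0 Y_def core_dim_def K)
  next
    case (Suc i)
    have "mmform (Suc 0) (Suc 0) (card K) (Y1 i)" by (rule mmformI[OF K(1)]) (rule Y1_def)
    then show ?thesis by (simp add: Suc Y_def core_dim_def K)
  qed
  have total: "(\<Sum>v\<le>s. Y v x y z) = Y0 x y z + (\<Sum>i<s. Y1 i x y z)" for x y z
    by (simp add: sum.atMost_shift Y_def)
  \<comment> \<open>The coefficient of new variable \<open>i\<close>, by cases on \<open>y\<close>
    and \<open>z\<close>: an old \<open>z\<close> is cancelled by \<open>b1\<close>, old
    \<open>y\<close> with new \<open>z\<close> vanishes by \<open>ker\<close>, and new with new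
    gives the identity by \<open>dual\<close>.\<close>
  have scalar: "(\<Sum>e<3. \<Sum>\<kappa>\<in>K. b0 y (3 * i + e) \<kappa> * c0 z \<kappa> (3 * i + e)) + (\<Sum>\<kappa>\<in>K. b1 i y \<kappa> * c1 z \<kappa>) = core_tensor T (Inr i) y z"
    if yy: "y \<in> core_y d s g" and zz: "z \<in> core_y d s g" for y z i
  proof (cases y)
    case y: (Inl bl)
    obtain b l where bl: "bl = (b, l)" "b < d" "l < d" using yy y by (auto simp: core_y_def)
    show ?thesis
    proof (cases z)
      case z: (Inl ck)
      obtain c k where ck: "ck = (c, k)" "c < d" "k < d" using zz z by (auto simp: core_y_def)
      have "(\<Sum>\<kappa>\<in>K. b0 y (3 * i + e) \<kappa> * c0 z \<kappa> (3 * i + e)) = T (3 * i + e) l k * T (3 * i + e) b c" for e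
      proof -
        have "(\<Sum>\<kappa>\<in>K. b0 y (3 * i + e) \<kappa> * c0 z \<kappa> (3 * i + e)) =
            (\<Sum>\<kappa>\<in>K. if \<kappa> = (b, k) then T (3 * i + e) l k * T (3 * i + e) b c else 0)"
          by (rule sum.cong) (auto simp: b0_def c0_def y z bl ck)
        then show ?thesis using bl ck K(1) by (simp add: sum.delta K_def)
      qed
      moreover have "(\<Sum>\<kappa>\<in>K. b1 i y \<kappa> * c1 z \<kappa>) = - (\<Sum>e<3. T (3 * i + e) l k * T (3 * i + e) b c)"
      proof -
        have "(\<Sum>\<kappa>\<in>K. b1 i y \<kappa> * c1 z \<kappa>) = (\<Sum>\<kappa>\<in>K. if \<kappa> = (c, k) then b1 i y (c, k) else 0)"
          by (rule sum.cong) (auto simp: c1_def z ck)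
        then show ?thesis using ck K(1) by (simp add: sum.delta K_def b1_def y bl)
      qed
      ultimately show ?thesis by (simp add: y z bl ck)
    next
      case z: (Inr im)
      obtain i' m where im: "im = (i', m)" "i' < s" "m < g" using zz z by (auto simp: core_y_def)
      have "(\<Sum>\<kappa>\<in>K. b0 y (3 * i + e) \<kappa> * c0 z \<kappa> (3 * i + e)) =
          (if i = i' then \<Sum>k<d. T (3 * i + e) l k * \<zeta> i m b k e else 0)" if "e < 3" for e
      proof -
        have "(\<Sum>\<kappa>\<in>K. b0 y (3 * i + e) \<kappa> * c0 z \<kappa> (3 * i + e)) =
            (\<Sum>\<kappa>\<in>K. if fst \<kappa> = b then if i = i' then T (3 * i + e) l (snd \<kappa>) * \<zeta> i m (fst \<kappa>) (snd \<kappa>) e else 0 else 0)"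
          by (rule sum.cong) (use that in \<open>auto simp: b0_def c0_def y z bl im\<close>)
        also have "\<dots> = (\<Sum>k<d. if i = i' then T (3 * i + e) l k * \<zeta> i m b k e else 0)"
          unfolding K_def by (rule sum_pair_delta(1)[OF bl(2)])
        finally show ?thesis by simp
      qed
      then have "(\<Sum>e<3. \<Sum>\<kappa>\<in>K. b0 y (3 * i + e) \<kappa> * c0 z \<kappa> (3 * i + e)) = 0"
        using ker[OF im(3) bl(2,3), of i] by (cases "i = i'") simp_all
      moreover have "(\<Sum>\<kappa>\<in>K. b1 i y \<kappa> * c1 z \<kappa>) = 0" by (simp add: c1_def z)
      ultimately show ?thesis by (simp add: y z bl im)
    qed
  next
    case y: (Inr im)
    obtain i' m where im: "im = (i', m)" "i' < s" "m < g" using yy y by (auto simp: core_y_def)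
    show ?thesis
    proof (cases z)
      case z: (Inl ck)
      obtain c k where ck: "ck = (c, k)" "c < d" "k < d" using zz z by (auto simp: core_y_def)
      have "(\<Sum>\<kappa>\<in>K. b0 y (3 * i + e) \<kappa> * c0 z \<kappa> (3 * i + e)) =
          (if i' = i then \<Sum>b<d. \<eta> i m b k e * T (3 * i + e) b c else 0)" if "e < 3" for e
      proof -
        have "(\<Sum>\<kappa>\<in>K. b0 y (3 * i + e) \<kappa> * c0 z \<kappa> (3 * i + e)) =
            (\<Sum>\<kappa>\<in>K. if snd \<kappa> = k then if i' = i then \<eta> i m (fst \<kappa>) (snd \<kappa>) e * T (3 * i + e) (fst \<kappa>) c else 0 else 0)"
          by (rule sum.cong) (use that in \<open>auto simp: b0_def c0_def y z ck im\<close>)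
        also have "\<dots> = (\<Sum>b<d. if i' = i then \<eta> i m b k e * T (3 * i + e) b c else 0)"
          unfolding K_def by (rule sum_pair_delta(2)[OF ck(3)])
        finally show ?thesis by simp
      qed
      then have "(\<Sum>e<3. \<Sum>\<kappa>\<in>K. b0 y (3 * i + e) \<kappa> * c0 z \<kappa> (3 * i + e)) =
          (if i' = i then \<Sum>e<3. \<Sum>b<d. \<eta> i m b k e * T (3 * i + e) b c else 0)" by simp
      moreover have "(\<Sum>\<kappa>\<in>K. b1 i y \<kappa> * c1 z \<kappa>) = b1 i y (c, k)"
      proof -
        have "(\<Sum>\<kappa>\<in>K. b1 i y \<kappa> * c1 z \<kappa>) = (\<Sum>\<kappa>\<in>K. if \<kappa> = (c, k) then b1 i y (c, k) else 0)"
          by (rule sum.cong) (auto simp: c1_def z ck)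
        then show ?thesis using ck K(1) by (simp add: sum.delta K_def)
      qed
      ultimately show ?thesis by (simp add: y z im ck b1_def)
    next
      case z: (Inr im')
      obtain i'' m' where im': "im' = (i'', m')" "i'' < s" "m' < g" using zz z by (auto simp: core_y_def)
      define R where "R \<longleftrightarrow> i = i' \<and> i = i''"
      have "(\<Sum>\<kappa>\<in>K. b0 y (3 * i + e) \<kappa> * c0 z \<kappa> (3 * i + e)) =
          (if R then \<Sum>b<d. \<Sum>k<d. \<eta> i m b k e * \<zeta> i m' b k e else 0)" if "e < 3" for e
      proof -
        have "(\<Sum>\<kappa>\<in>K. b0 y (3 * i + e) \<kappa> * c0 z \<kappa> (3 * i + e)) =
            (\<Sum>\<kappa>\<in>K. if R then \<eta> i m (fst \<kappa>) (snd \<kappa>) e * \<zeta> i m' (fst \<kappa>) (snd \<kappa>) e else 0)"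
          by (rule sum.cong) (use that in \<open>auto simp: R_def b0_def c0_def y z im im'\<close>)
        then show ?thesis by (cases R) (simp_all add: K_def sum.cartesian_product split_def)
      qed
      then have "(\<Sum>e<3. \<Sum>\<kappa>\<in>K. b0 y (3 * i + e) \<kappa> * c0 z \<kappa> (3 * i + e)) =
          (if R then \<Sum>e<3. \<Sum>b<d. \<Sum>k<d. \<eta> i m b k e * \<zeta> i m' b k e else 0)"
        by simp
      also have "(\<Sum>e<3. \<Sum>b<d. \<Sum>k<d. \<eta> i m b k e * \<zeta> i m' b k e) = (\<Sum>b<d. \<Sum>e<3. \<Sum>k<d. \<eta> i m b k e * \<zeta> i m' b k e)"
        by (rule sum.swap)
      also have "\<dots> = (\<Sum>b<d. \<Sum>k<d. \<Sum>e<3. \<eta> i m b k e * \<zeta> i m' b k e)"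
        by (intro sum.cong refl sum.swap)
      also have "\<dots> = (if m = m' then 1 else 0)" by (rule dual[OF im(3) im'(3)])
      finally have "(\<Sum>e<3. \<Sum>\<kappa>\<in>K. b0 y (3 * i + e) \<kappa> * c0 z \<kappa> (3 * i + e)) = (if R then if m = m' then 1 else 0 else 0)" .
      moreover have "(\<Sum>\<kappa>\<in>K. b1 i y \<kappa> * c1 z \<kappa>) = 0" by (simp add: c1_def z)
      ultimately show ?thesis by (auto simp: y z im im' R_def)
    qed
  qed
  have "\<exists>q. (\<Sum>v\<le>s. Y v x y z) = monom 1 2 * q \<and> coeff q 0 = core_tensor T x y z"
    if x: "x \<in> core_x d s" and y: "y \<in> core_y d s g" and z: "z \<in> core_y d s g" for x y z
  proof (cases x)
    case (Inl aa)
    obtain a a' where aa: "aa = (a, a')" "a < d" "a' < d" using x Inl by (auto simp: core_x_def)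
    define S where "S = (\<Sum>\<kappa>\<in>K. b0 y a' \<kappa> * c0 z \<kappa> a)"
    have inner: "(\<Sum>j<d. \<Sum>\<kappa>\<in>K. A0 x i j * monom (b0 y j \<kappa>) (deg y) * monom (c0 z \<kappa> i) (deg z))
        = (if i = a then monom S (deg y + deg z + 2) else 0)" for i
    proof -
      have "(\<Sum>j<d. \<Sum>\<kappa>\<in>K. A0 x i j * monom (b0 y j \<kappa>) (deg y) * monom (c0 z \<kappa> i) (deg z))
        = (\<Sum>j<d. if j = a' then if i = a then \<Sum>\<kappa>\<in>K. monom 1 2 * monom (b0 y j \<kappa>) (deg y) * monom (c0 z \<kappa> i) (deg z) else 0 else 0)"
        by (rule sum.cong) (auto simp: A0_def Inl aa)
      also have "\<dots> = (if i = a then \<Sum>\<kappa>\<in>K. monom 1 2 * monom (b0 y a' \<kappa>) (deg y) * monom (c0 z \<kappa> i) (deg z) else 0)"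
        using aa by (simp add: sum.delta)
      also have "\<dots> = (if i = a then monom S (deg y + deg z + 2) else 0)"
        by (simp add: S_def monom_sum mult_monom add_ac)
      finally show ?thesis .
    qed
    have "Y0 x y z = monom S (deg y + deg z + 2)"
      unfolding Y0_def inner using aa by (simp add: sum.delta)
    moreover have "(\<Sum>i<s. Y1 i x y z) = 0" by (simp add: Y1_def Inl)
    ultimately have "(\<Sum>v\<le>s. Y v x y z) = monom 1 2 * monom S (deg y + deg z)"
      unfolding total by (simp add: mult_monom add_ac)
    moreover have "coeff (monom S (deg y + deg z)) 0 = core_tensor T x y z"
    proof (cases "\<exists>b l c k. y = Inl (b, l) \<and> z = Inl (c, k)")
      case True
      then obtain b l c k where yz: "y = Inl (b, l)" "z = Inl (c, k)" by blast
      have lt: "b < d" "k < d" using y z yz by (auto simp: core_y_def)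
      have "S = (\<Sum>\<kappa>\<in>K. if \<kappa> = (b, k) then T a' l k * T a b c else 0)"
        unfolding S_def by (rule sum.cong) (auto simp: b0_def c0_def yz)
      then have "S = T a' l k * T a b c" using lt K(1) by (simp add: sum.delta K_def)
      then show ?thesis by (simp add: yz Inl aa deg_def mult.commute)
    next
      case False
      then have "0 < deg y + deg z" "core_tensor T x y z = 0"
        unfolding Inl aa by (cases y; cases z; auto simp: deg_def)+
      then show ?thesis unfolding coeff_monom by (auto simp del: add_is_0)
    qed
    ultimately show ?thesis by blast
  next
    case (Inr i)
    have i: "i < s" using x Inr by (auto simp: core_x_def)
    have "Y0 x y z = (\<Sum>i1<d. \<Sum>j<d. if i1 = j \<and> i1 div 3 = i then \<Sum>\<kappa>\<in>K. monom (b0 y j \<kappa>) (deg y) * monom (c0 z \<kappa> i1) (deg z) else 0)"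
      unfolding Y0_def by (intro sum.cong refl) (auto simp: A0_def Inr)
    also have "\<dots> = (\<Sum>e<3. \<Sum>\<kappa>\<in>K. monom (b0 y (3 * i + e) \<kappa>) (deg y) * monom (c0 z \<kappa> (3 * i + e)) (deg z))"
      by (rule sum_diag_block) (use i in \<open>simp add: s_def\<close>)
    finally have Y0: "Y0 x y z = monom (\<Sum>e<3. \<Sum>\<kappa>\<in>K. b0 y (3 * i + e) \<kappa> * c0 z \<kappa> (3 * i + e)) (deg y + deg z)"
      by (simp add: monom_sum mult_monom)
    have "(\<Sum>i1<s. Y1 i1 x y z) = (\<Sum>i1<s. if i1 = i then \<Sum>\<kappa>\<in>K. monom (b1 i y \<kappa>) (deg y) * monom (c1 z \<kappa>) (deg z) else 0)"
      by (rule sum.cong) (auto simp: Y1_def Inr)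
    also have "\<dots> = monom (\<Sum>\<kappa>\<in>K. b1 i y \<kappa> * c1 z \<kappa>) (deg y + deg z)"
      using i by (simp add: sum.delta monom_sum mult_monom)
    finally have "(\<Sum>v\<le>s. Y v x y z) = monom (core_tensor T x y z) (deg y + deg z)"
      unfolding total Y0 by (simp add: add_monom scalar[OF y z] Inr)
    also have "\<dots> = monom 1 2 * monom (core_tensor T x y z) 0"
    proof (cases "(\<exists>p. y = Inr p) \<and> (\<exists>p. z = Inr p)")
      case True
      then have "deg y + deg z = 2" by (auto simp: deg_def)
      then show ?thesis by (simp add: mult_monom)
    next
      case False
      then have "core_tensor T x y z = 0" unfolding Inr by (cases y; cases z) auto
      then show ?thesis by simp
    qed
    finally show ?thesis by (intro exI[of _ "monom (core_tensor T x y z) 0"]) simp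
  qed
  then show ?thesis using form unfolding s_def g_def by blast
qed

section \<open>Functionals on an ordered monoid\<close>

lemma fekete:
  fixes a :: "nat \<Rightarrow> real"
  assumes ge1: "\<And>n. 1 \<le> a n" and sub: "\<And>m n. a (m + n) \<le> a m * a n"
  shows "\<exists>x\<ge>1. (\<lambda>n. root n (a n)) \<longlonglongrightarrow> x"
proof -
  define x where "x = (INF n\<in>{1..}. root n (a n))"
  have bdd: "bdd_below ((\<lambda>n. root n (a n)) ` {1..})"
    by (rule bdd_belowI[of _ 0]) (use ge1 order_trans[OF zero_le_one] in \<open>auto intro!: real_root_ge_zero\<close>)
  have root_ge1: "1 \<le> root n (a n)" if "n \<ge> 1" for n
    using that ge1[of n] by simp
  have lower: "x \<le> root n (a n)" if "n \<ge> 1" for n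
    unfolding x_def by (rule cINF_lower[OF bdd]) (use that in simp)
  have "1 \<le> x"
    unfolding x_def by (rule cINF_greatest) (use root_ge1 in auto)
  have pow: "a (m * q) \<le> a m ^ q * a 0" for m q
  proof (induction q)
    case (Suc q)
    have "a (m * Suc q) \<le> a m * a (m * q)" using sub[of m "m * q"] by simp
    also have "\<dots> \<le> a m * (a m ^ q * a 0)"
      using Suc ge1[of m] by (intro mult_left_mono) auto
    finally show ?case by (simp add: mult.assoc)
  qed simp
  have upper: "eventually (\<lambda>n. root n (a n) < y) sequentially" if "x < y" for y
  proof -
    obtain m where m: "m \<ge> 1" "root m (a m) < y"
      using cINF_less_iff[OF _ bdd, of y] \<open>x < y\<close> unfolding x_def by auto
    define z where "z = root m (a m)"
    have z: "1 \<le> z" "z ^ m = a m" using root_ge1[OF m(1)] ge1[of m] m(1) by (auto simp: z_def)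
    \<comment> \<open>Bounds the contribution of the remainder of \<open>n\<close> modulo
      \<open>m\<close> together with the factor \<open>a 0\<close> from \<open>pow\<close>; its
      \<open>n\<close>-th root tends to 1.\<close>
    define M where "M = a 0 * (\<Sum>r<m. a r)"
    have pos: "0 \<le> a r" for r using ge1[of r] by simp
    have Mr: "a 0 * a r \<le> M" if "r < m" for r
      unfolding M_def by (intro mult_left_mono member_le_sum) (use that pos in auto)
    have "M > 0" using Mr[of 0] m(1) ge1[of 0] by (smt (verit) mult_le_cancel_left1 less_le_trans zero_less_one less_eq_Suc_le One_nat_def)
    have bound: "a n \<le> z ^ n * M" for n
    proof -
      have "a n \<le> a (m * (n div m)) * a (n mod m)" using sub[of "m * (n div m)" "n mod m"] by simp
      also have "\<dots> \<le> (a m ^ (n div m) * a 0) * a (n mod m)"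
        by (intro mult_right_mono pow pos)
      also have "\<dots> = z ^ (m * (n div m)) * (a 0 * a (n mod m))"
        by (simp add: z(2)[symmetric] power_mult mult.assoc)
      also have "\<dots> \<le> z ^ n * M"
        using z(1) m(1) \<open>M > 0\<close> pos by (intro mult_mono Mr power_increasing) auto
      finally show ?thesis .
    qed
    have "(\<lambda>n. z * root n M) \<longlonglongrightarrow> z * 1"
      by (intro tendsto_mult tendsto_const LIMSEQ_root_const \<open>M > 0\<close>)
    then have "eventually (\<lambda>n. z * root n M < y) sequentially"
      using m(2) by (intro order_tendstoD(2)) (auto simp: z_def)
    moreover have "eventually (\<lambda>n. root n (a n) \<le> z * root n M) sequentially"
      using eventually_gt_at_top[of 0]
    proof eventually_elim
      case (elim n)
      have "root n (a n) \<le> root n (z ^ n * M)" using elim bound by simp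
      also have "\<dots> = z * root n M" using elim z(1) by (simp add: real_root_mult real_root_power_cancel)
      finally show ?case .
    qed
    ultimately show ?thesis by eventually_elim simp
  qed
  have "(\<lambda>n. root n (a n)) \<longlonglongrightarrow> x"
  proof (rule order_tendstoI)
    show "eventually (\<lambda>n. y < root n (a n)) sequentially" if "y < x" for y
      using eventually_ge_at_top[of 1] by eventually_elim (use lower that in \<open>auto intro: less_le_trans\<close>)
  qed (rule upper)
  then show ?thesis using \<open>1 \<le> x\<close> by blast
qed

text \<open>Of the preordered semiring of tensors only products and the order are kept. Direct sums
  would leave the family; they enter only through \<open>sum_ineq\<close>.\<close>

locale monoid_order =
  fixes le :: "'w::comm_monoid_mult \<Rightarrow> 'w \<Rightarrow> bool"
  assumes one_le: "le 1 w" and mult_le: "le v w \<Longrightarrow> le (u * v) (u * w)"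
begin

text \<open>Properties of asymptotic rank that are preserved by \<open>deriv_fun\<close>.
  Homogeneity under powers replaces multiplicativity, which is gained one direction at a
  time.\<close>

definition functional :: "('w \<Rightarrow> real) \<Rightarrow> bool" where
  "functional \<Phi> \<longleftrightarrow> (\<forall>v w. \<Phi> (v * w) \<le> \<Phi> v * \<Phi> w) \<and> (\<forall>w k. \<Phi> (w ^ k) = \<Phi> w ^ k) \<and>
     (\<forall>v w. le v w \<longrightarrow> \<Phi> v \<le> \<Phi> w)"

lemma functionalD:
  assumes "functional \<Phi>"
  shows "\<Phi> (v * w) \<le> \<Phi> v * \<Phi> w" "\<Phi> (w ^ k) = \<Phi> w ^ k" "le v w \<Longrightarrow> \<Phi> v \<le> \<Phi> w"
    "\<Phi> 1 = 1" "1 \<le> \<Phi> w" "\<Phi> v \<le> \<Phi> (v * w)"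
proof -
  show sub: "\<Phi> (v * w) \<le> \<Phi> v * \<Phi> w" and hom: "\<Phi> (w ^ k) = \<Phi> w ^ k"
    and mono: "le v w \<Longrightarrow> \<Phi> v \<le> \<Phi> w" for v w k
    using assms unfolding functional_def by auto
  show one: "\<Phi> 1 = 1" using hom[of 1 0] by simp
  show "1 \<le> \<Phi> w" using mono[OF one_le, of w] one by simp
  show "\<Phi> v \<le> \<Phi> (v * w)" using mono[OF mult_le[OF one_le, of v w]] by simp
qed

text \<open>The quotients decrease in \<open>M\<close>, so the infimum is a limit; it makes the functional multiplicative
  along \<open>V\<close>.\<close>

definition deriv_fun :: "('w \<Rightarrow> real) \<Rightarrow> 'w \<Rightarrow> 'w \<Rightarrow> real" where
  "deriv_fun \<Phi> V w = (INF M. \<Phi> (V ^ M * w) / \<Phi> V ^ M)"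

context
  fixes \<Phi> :: "'w \<Rightarrow> real" and V :: 'w
  assumes \<Phi>: "functional \<Phi>"
begin

lemma functional_pos: "0 < \<Phi> w"
  using functionalD(5)[OF \<Phi>, of w] by linarith

lemma deriv_quotient_ge_1: "1 \<le> \<Phi> (V ^ M * w) / \<Phi> V ^ M"
  using functionalD(6)[OF \<Phi>, of "V ^ M" w] functionalD(2)[OF \<Phi>, of V M] functional_pos[of V] by simp

lemma deriv_bdd_below: "bdd_below (range (\<lambda>M. \<Phi> (V ^ M * w) / \<Phi> V ^ M))"
  by (rule bdd_belowI[of _ 1]) (use deriv_quotient_ge_1 in auto)

lemma deriv_fun_le: "deriv_fun \<Phi> V w \<le> \<Phi> (V ^ M * w) / \<Phi> V ^ M"
  unfolding deriv_fun_def by (rule cINF_lower[OF deriv_bdd_below]) simp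

lemma deriv_fun_tendsto: "(\<lambda>M. \<Phi> (V ^ M * w) / \<Phi> V ^ M) \<longlonglongrightarrow> deriv_fun \<Phi> V w"
  unfolding deriv_fun_def
proof (rule LIMSEQ_decseq_INF[OF deriv_bdd_below], rule decseq_SucI)
  fix M
  have "\<Phi> (V ^ Suc M * w) \<le> \<Phi> V * \<Phi> (V ^ M * w)"
    using functionalD(1)[OF \<Phi>, of V "V ^ M * w"] by (simp add: mult.assoc)
  then show "\<Phi> (V ^ Suc M * w) / \<Phi> V ^ Suc M \<le> \<Phi> (V ^ M * w) / \<Phi> V ^ M"
    using functional_pos[of V] by (simp add: field_simps)
qed

text \<open>Submultiplicativity: distribute \<open>V ^ (2 * M)\<close> evenly over \<open>v\<close>
  and \<open>w\<close>. Powers: evaluate the limit for \<open>w ^ k\<close> along the multiples of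
  \<open>k\<close>, where the quotient is exactly the \<open>k\<close>-th power of a quotient for
  \<open>w\<close>.\<close>

lemma functional_deriv: "functional (deriv_fun \<Phi> V)"
  unfolding functional_def
proof (intro conjI allI impI)
  note pos = functional_pos[of V]
  fix v w
  show "deriv_fun \<Phi> V (v * w) \<le> deriv_fun \<Phi> V v * deriv_fun \<Phi> V w"
  proof (rule LIMSEQ_le_const[OF tendsto_mult[OF deriv_fun_tendsto deriv_fun_tendsto]], intro exI allI impI)
    fix M
    have "\<Phi> (V ^ (2 * M) * (v * w)) \<le> \<Phi> (V ^ M * v) * \<Phi> (V ^ M * w)"
    proof -
      have "V ^ (2 * M) * (v * w) = (V ^ M * v) * (V ^ M * w)"
        unfolding mult_2 power_add by (simp only: mult_ac)
      then show ?thesis using functionalD(1)[OF \<Phi>] by simp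
    qed
    then have "\<Phi> (V ^ (2 * M) * (v * w)) / \<Phi> V ^ (2 * M) \<le> \<Phi> (V ^ M * v) / \<Phi> V ^ M * (\<Phi> (V ^ M * w) / \<Phi> V ^ M)"
      using pos by (simp add: mult_2 power_add divide_right_mono)
    then show "deriv_fun \<Phi> V (v * w) \<le> \<Phi> (V ^ M * v) / \<Phi> V ^ M * (\<Phi> (V ^ M * w) / \<Phi> V ^ M)"
      using deriv_fun_le[of "v * w" "2 * M"] by linarith
  qed
next
  fix w and k :: nat
  show "deriv_fun \<Phi> V (w ^ k) = deriv_fun \<Phi> V w ^ k"
  proof (cases "k = 0")
    case True
    have "(\<lambda>M. \<Phi> (V ^ M * 1) / \<Phi> V ^ M) = (\<lambda>M. 1)"
      using functional_pos[of V] by (auto simp: functionalD(2)[OF \<Phi>])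
    then have "deriv_fun \<Phi> V 1 = 1"
      using deriv_fun_tendsto[of 1] by (simp add: LIMSEQ_const_iff)
    then show ?thesis using True by simp
  next
    case False
    then have "filterlim (\<lambda>M. k * M) sequentially sequentially"
      by (intro mult_nat_left_at_top) auto
    from filterlim_compose[OF deriv_fun_tendsto[of "w ^ k"] this]
    have "(\<lambda>M. \<Phi> (V ^ (k * M) * w ^ k) / \<Phi> V ^ (k * M)) \<longlonglongrightarrow> deriv_fun \<Phi> V (w ^ k)" .
    moreover have "\<Phi> (V ^ (k * M) * w ^ k) / \<Phi> V ^ (k * M) = (\<Phi> (V ^ M * w) / \<Phi> V ^ M) ^ k" for M
    proof -
      have "V ^ (k * M) * w ^ k = (V ^ M * w) ^ k"
        by (simp add: power_mult_distrib power_mult[symmetric] mult.commute)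
      then show ?thesis
        by (simp add: functionalD(2)[OF \<Phi>] power_divide power_mult[symmetric] mult.commute)
    qed
    ultimately have "(\<lambda>M. (\<Phi> (V ^ M * w) / \<Phi> V ^ M) ^ k) \<longlonglongrightarrow> deriv_fun \<Phi> V (w ^ k)"
      by (simp only:)
    then show ?thesis
      using tendsto_power[OF deriv_fun_tendsto[of w]] LIMSEQ_unique by blast
  qed
next
  fix v w assume "le v w"
  then show "deriv_fun \<Phi> V v \<le> deriv_fun \<Phi> V w"
    using functional_pos[of V] functionalD(3)[OF \<Phi>] mult_le
    by (intro LIMSEQ_le[OF deriv_fun_tendsto deriv_fun_tendsto]) (auto intro!: divide_right_mono)
qed

lemma deriv_fun_le_self: "deriv_fun \<Phi> V w \<le> \<Phi> w"
  using deriv_fun_le[of w 0] by simp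

lemma deriv_fun_mult: "deriv_fun \<Phi> V (V * w) = \<Phi> V * deriv_fun \<Phi> V w"
proof -
  have "(\<lambda>M. \<Phi> V * (\<Phi> (V ^ Suc M * w) / \<Phi> V ^ Suc M)) \<longlonglongrightarrow> \<Phi> V * deriv_fun \<Phi> V w"
    by (intro tendsto_mult tendsto_const LIMSEQ_Suc deriv_fun_tendsto)
  moreover have "\<Phi> V * (\<Phi> (V ^ Suc M * w) / \<Phi> V ^ Suc M) = \<Phi> (V ^ M * (V * w)) / \<Phi> V ^ M" for M
    using functional_pos[of V] by (simp add: mult_ac)
  ultimately show ?thesis using LIMSEQ_unique[OF deriv_fun_tendsto[of "V * w"]] by simp
qed

text \<open>Multiplicativity obtained in an earlier direction survives a later derivative, so
  derivatives can be taken successively.\<close>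

lemma deriv_fun_mult_other:
  assumes "\<And>w. \<Phi> (V' * w) = \<Phi> V' * \<Phi> w"
  shows "deriv_fun \<Phi> V (V' * w) = \<Phi> V' * deriv_fun \<Phi> V w"
proof -
  have "(\<lambda>M. \<Phi> V' * (\<Phi> (V ^ M * w) / \<Phi> V ^ M)) \<longlonglongrightarrow> \<Phi> V' * deriv_fun \<Phi> V w"
    by (intro tendsto_mult tendsto_const deriv_fun_tendsto)
  moreover have "\<Phi> V' * (\<Phi> (V ^ M * w) / \<Phi> V ^ M) = \<Phi> (V ^ M * (V' * w)) / \<Phi> V ^ M" for M
    using assms[of "V ^ M * w"] by (simp add: mult.left_commute)
  ultimately show ?thesis using LIMSEQ_unique[OF deriv_fun_tendsto[of "V' * w"]] by (simp only:)
qed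

end

text \<open>For a point of the asymptotic spectrum this would be \<open>\<Phi> X + s * \<Phi> Y \<le> \<Phi> B + s * \<Phi> C\<close>. The left-hand
  side is not available for general \<open>\<Phi>\<close>, since the lower bound for a direct sum needs its powers.\<close>

definition sum_ineq :: "('w \<Rightarrow> real) \<Rightarrow> 'w \<Rightarrow> 'w \<Rightarrow> 'w \<Rightarrow> 'w \<Rightarrow> real \<Rightarrow> bool" where
  "sum_ineq \<Phi> X Y B C s \<longleftrightarrow> (\<forall>U a b. 0 \<le> a \<longrightarrow> 0 \<le> b \<longrightarrow>
     (\<forall>k j. a ^ k * b ^ j \<le> \<Phi> (U ^ (k + j) * X ^ k * Y ^ j)) \<longrightarrow> a + s * b \<le> \<Phi> (U * B) + s * \<Phi> (U * C))"

text \<open>The reason for quantifying over \<open>U\<close> in \<open>sum_ineq\<close>: the power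
  \<open>V ^ M\<close> is absorbed into \<open>U\<close>, while \<open>a\<close> and
  \<open>b\<close> are both scaled by \<open>\<Phi> V ^ M\<close>. It appears \<open>k + j\<close>
  times on either side, so the hypothesis rescales correctly, and dividing the conclusion by
  \<open>\<Phi> V ^ M\<close> leaves the quotients whose limits are the derivative.\<close>

lemma sum_ineq_deriv:
  assumes \<Phi>: "functional \<Phi>" and "sum_ineq \<Phi> X Y B C s"
  shows "sum_ineq (deriv_fun \<Phi> V) X Y B C s"
  unfolding sum_ineq_def
proof (intro allI impI)
  fix U a b
  assume ab: "0 \<le> a" "0 \<le> b" and le: "\<forall>k j. a ^ k * b ^ j \<le> deriv_fun \<Phi> V (U ^ (k + j) * X ^ k * Y ^ j)"
  note pos = functional_pos[OF \<Phi>, of V]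
  show "a + s * b \<le> deriv_fun \<Phi> V (U * B) + s * deriv_fun \<Phi> V (U * C)"
  proof (rule LIMSEQ_le_const[OF tendsto_add[OF deriv_fun_tendsto[OF \<Phi>] tendsto_mult[OF tendsto_const deriv_fun_tendsto[OF \<Phi>]]]],
      intro exI allI impI)
    fix M
    define P where "P = \<Phi> V ^ M"
    have "P > 0" using pos by (simp add: P_def)
    have "(P * a) ^ k * (P * b) ^ j \<le> \<Phi> ((V ^ M * U) ^ (k + j) * X ^ k * Y ^ j)" for k j
    proof -
      have "a ^ k * b ^ j \<le> \<Phi> (V ^ (M * (k + j)) * (U ^ (k + j) * X ^ k * Y ^ j)) / \<Phi> V ^ (M * (k + j))"
        using le deriv_fun_le[OF \<Phi>] order_trans by blast
      moreover have "\<Phi> V ^ (M * (k + j)) = P ^ k * P ^ j"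
        by (simp add: P_def power_mult[symmetric] power_add[symmetric] distrib_left)
      ultimately have "a ^ k * b ^ j * (P ^ k * P ^ j) \<le> \<Phi> (V ^ (M * (k + j)) * (U ^ (k + j) * X ^ k * Y ^ j))"
        using \<open>P > 0\<close> by (simp add: pos_le_divide_eq)
      moreover have "V ^ (M * (k + j)) * (U ^ (k + j) * X ^ k * Y ^ j) = (V ^ M * U) ^ (k + j) * X ^ k * Y ^ j"
        by (simp only: power_mult power_mult_distrib mult.assoc)
      ultimately show ?thesis by (simp add: power_mult_distrib mult_ac)
    qed
    then have "P * a + s * (P * b) \<le> \<Phi> (V ^ M * U * B) + s * \<Phi> (V ^ M * U * C)"
      using assms(2) ab \<open>P > 0\<close> unfolding sum_ineq_def by simp
    then have "(P * a + s * (P * b)) / P \<le> (\<Phi> (V ^ M * U * B) + s * \<Phi> (V ^ M * U * C)) / P"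
      using \<open>P > 0\<close> by (intro divide_right_mono) auto
    then show "a + s * b \<le> \<Phi> (V ^ M * (U * B)) / \<Phi> V ^ M + s * (\<Phi> (V ^ M * (U * C)) / \<Phi> V ^ M)"
      using \<open>P > 0\<close> by (simp add: P_def[symmetric] add_divide_distrib mult.assoc)
  qed
qed

end

text \<open>\<open>n ^ k\<close> lies between consecutive powers of 2, so monotonicity and
  homogeneity confine \<open>log 2 (f n)\<close> to within \<open>u / k\<close> of the claimed
  value. This covers all three directions, also <1, 1, n>, along which no derivative is
  taken.\<close>

lemma power_law:
  fixes f :: "nat \<Rightarrow> real"
  assumes ge1: "\<And>n. 0 < n \<Longrightarrow> 1 \<le> f n" and mono: "\<And>m n. 0 < m \<Longrightarrow> m \<le> n \<Longrightarrow> f m \<le> f n"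
    and pow: "\<And>n k. 0 < n \<Longrightarrow> f (n ^ k) = f n ^ k" and "0 < n"
  shows "f n = real n powr log 2 (f 2)"
proof (cases "n = 1")
  case True
  have "f 1 = 1" using pow[OF zero_less_one, of 0] by (simp only: power_0 power_one)
  then show ?thesis unfolding True by simp
next
  case False
  then have n: "n \<ge> 2" using \<open>0 < n\<close> by simp
  define u where "u = log 2 (f 2)"
  define v where "v = log 2 (f n)"
  define x where "x = log 2 (real n)"
  have u: "0 \<le> u" using ge1[of 2] by (simp add: u_def)
  have bound: "\<bar>v - x * u\<bar> \<le> u / real k" if "k > 0" for k :: nat
  proof -
    define a where "a = nat \<lfloor>real k * x\<rfloor>"
    have "0 \<le> x" using n by (simp add: x_def)
    then have a: "real a \<le> real k * x" "real k * x < real a + 1"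
      unfolding a_def by (auto simp: of_nat_nat)
    have nk: "real (n ^ k) = 2 powr (real k * x)"
    proof -
      have "2 powr (real k * x) = (2 powr x) powr real k" by (simp add: powr_powr mult.commute)
      then show ?thesis using n by (simp add: x_def powr_realpow)
    qed
    have "real (2 ^ a) \<le> real (n ^ k)" "real (n ^ k) \<le> real (2 ^ Suc a)"
    proof -
      have "2 powr real a \<le> 2 powr (real k * x)" "2 powr (real k * x) \<le> 2 powr (real a + 1)"
        using a by (auto intro!: powr_mono)
      then show "real (2 ^ a) \<le> real (n ^ k)" "real (n ^ k) \<le> real (2 ^ Suc a)"
        unfolding nk by (simp_all add: powr_add powr_realpow)
    qed
    then have "2 ^ a \<le> n ^ k" "n ^ k \<le> 2 ^ Suc a" by (simp_all only: of_nat_le_iff)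
    then have "f 2 ^ a \<le> f n ^ k" "f n ^ k \<le> f 2 ^ Suc a"
      using mono[of "2 ^ a" "n ^ k"] mono[of "n ^ k" "2 ^ Suc a"] pow n by (metis pos2 zero_less_power less_le_trans)+
    then have "log 2 (f 2 ^ a) \<le> log 2 (f n ^ k)" "log 2 (f n ^ k) \<le> log 2 (f 2 ^ Suc a)"
      using ge1[of 2] ge1[of n] n by (auto intro!: log_mono)
    moreover have "log 2 (f 2 ^ q) = real q * u" "log 2 (f n ^ q) = real q * v" for q
      using ge1[of 2] ge1[of n] n by (simp_all add: u_def v_def log_nat_power)
    ultimately have "real a * u \<le> real k * v" "real k * v \<le> (real a + 1) * u"
      by (simp_all only: of_nat_Suc add.commute)
    moreover have "real a * u \<le> real k * x * u" "real k * x * u \<le> (real a + 1) * u"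
      using a u by (auto intro!: mult_right_mono)
    ultimately have "\<bar>real k * v - real k * x * u\<bar> \<le> u" by (simp add: algebra_simps abs_le_iff)
    moreover have "real k * v - real k * x * u = real k * (v - x * u)"
      by (simp only: right_diff_distrib mult.assoc)
    ultimately have "real k * \<bar>v - x * u\<bar> \<le> u"
      by (simp add: abs_mult)
    then show ?thesis using that by (simp add: field_simps)
  qed
  have "(\<lambda>k. u / real k) \<longlonglongrightarrow> 0" by (rule lim_const_over_n)
  then have "\<bar>v - x * u\<bar> \<le> 0"
    by (rule LIMSEQ_le_const) (use bound in \<open>auto intro!: exI[of _ 1]\<close>)
  then have "v = x * u" by simp
  then have "2 powr v = (2 powr x) powr u" by (simp add: powr_powr)
  then show ?thesis
    using ge1[of n] n by (simp add: v_def x_def u_def)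
qed

section \<open>Asymptotic rank of the family\<close>

text \<open>A dimension 0 would give an empty tensor, of rank 0; positivity makes 1 the least
  element and keeps functionals at or above 1.\<close>

typedef shape = "{(p :: nat, n :: nat, m :: nat, l :: nat). 0 < n \<and> 0 < m \<and> 0 < l}"
  by (intro exI[of _ "(0, 1, 1, 1)"]) simp

setup_lifting type_definition_shape

lift_definition expo :: "shape \<Rightarrow> nat" is fst .
lift_definition dim1 :: "shape \<Rightarrow> nat" is "\<lambda>w. fst (snd w)" .
lift_definition dim2 :: "shape \<Rightarrow> nat" is "\<lambda>w. fst (snd (snd w))" .
lift_definition dim3 :: "shape \<Rightarrow> nat" is "\<lambda>w. snd (snd (snd w))" .

text \<open>The maximum only makes \<open>Shape\<close> total; it is applied to positive dimensions.\<close>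

lift_definition Shape :: "nat \<Rightarrow> nat \<Rightarrow> nat \<Rightarrow> nat \<Rightarrow> shape" is
  "\<lambda>p n m l. (p, max 1 n, max 1 m, max 1 l)" by (auto simp: max_def)

instantiation shape :: comm_monoid_mult
begin

lift_definition one_shape :: shape is "(0, 1, 1, 1)" by simp

lift_definition times_shape :: "shape \<Rightarrow> shape \<Rightarrow> shape" is
  "\<lambda>(p, n, m, l) (p', n', m', l'). (p + p', n * n', m * m', l * l')" by auto

instance
  by standard (transfer; auto)+

end

lemma dim_pos: "0 < dim1 w" "0 < dim2 w" "0 < dim3 w"
  by (transfer; auto)+

lemma shape_eqI: "expo v = expo w \<Longrightarrow> dim1 v = dim1 w \<Longrightarrow> dim2 v = dim2 w \<Longrightarrow> dim3 v = dim3 w \<Longrightarrow> v = w"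
  by transfer auto

lemma shape_one [simp]: "expo 1 = 0" "dim1 1 = 1" "dim2 1 = 1" "dim3 1 = 1"
  by (transfer; simp)+

lemma shape_times [simp]:
  "expo (v * w) = expo v + expo w" "dim1 (v * w) = dim1 v * dim1 w"
  "dim2 (v * w) = dim2 v * dim2 w" "dim3 (v * w) = dim3 v * dim3 w"
  by (transfer; auto)+

lemma shape_power [simp]:
  "expo (w ^ k) = expo w * k" "dim1 (w ^ k) = dim1 w ^ k" "dim2 (w ^ k) = dim2 w ^ k" "dim3 (w ^ k) = dim3 w ^ k"
  by (induction k) auto

lemma shape_Shape [simp]:
  "expo (Shape p n m l) = p" "0 < n \<Longrightarrow> dim1 (Shape p n m l) = n"
  "0 < m \<Longrightarrow> dim2 (Shape p n m l) = m" "0 < l \<Longrightarrow> dim3 (Shape p n m l) = l"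
  by (transfer; simp)+

definition shape_le :: "shape \<Rightarrow> shape \<Rightarrow> bool" where
  "shape_le v w \<longleftrightarrow> expo v \<le> expo w \<and> dim1 v \<le> dim1 w \<and> dim2 v \<le> dim2 w \<and> dim3 v \<le> dim3 w"

interpretation shape: monoid_order shape_le
  by unfold_locales (auto simp: shape_le_def Suc_le_eq dim_pos)

section \<open>Cyclic symmetry of the modes\<close>

definition rotate :: "(nat \<Rightarrow> nat \<Rightarrow> nat \<Rightarrow> 'a) \<Rightarrow> nat \<Rightarrow> nat \<Rightarrow> nat \<Rightarrow> 'a" where
  "rotate T b c a = T a b c"

definition rot :: "shape \<Rightarrow> shape" where
  "rot w = Shape (expo w) (dim2 w) (dim3 w) (dim1 w)"

lemma shape_rot [simp]: "expo (rot w) = expo w" "dim1 (rot w) = dim2 w" "dim2 (rot w) = dim3 w" "dim3 (rot w) = dim1 w"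
  by (simp_all add: rot_def dim_pos)

lemma rot_mult: "rot (v * w) = rot v * rot w" and rot_power: "rot (w ^ k) = rot w ^ k"
  by (rule shape_eqI; simp)+

lemma fam_rank_rotate:
  fixes T :: "nat \<Rightarrow> nat \<Rightarrow> nat \<Rightarrow> 'a::field"
  shows "fam_rank d (rotate T) p m l n = fam_rank d T p n m l"
proof -
  have "matmul_tensor jk ki ij = (matmul_tensor ij jk ki :: 'a)" for ij jk ki
  proof -
    obtain i j j' k k' i' where "ij = (i, j)" "jk = (j', k)" "ki = (k', i')" by (metis prod.collapse)
    moreover have "(j' = j \<and> k = k' \<and> i' = i) \<longleftrightarrow> (i = i' \<and> j = j' \<and> k = k')" by blast
    ultimately show ?thesis by (simp only: matmul_tensor_def prod.case)
  qed
  then have "fam_tensor (rotate T) p = (\<lambda>b c a. fam_tensor T p a b c)"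
    by (intro ext) (simp only: fam_tensor_def kron_pow_def rotate_def)
  then show ?thesis unfolding fam_rank_def by (simp only:) (rule tensor_rank_rotate)
qed

definition shape_rank :: "nat \<Rightarrow> (nat \<Rightarrow> nat \<Rightarrow> nat \<Rightarrow> 'a::field) \<Rightarrow> shape \<Rightarrow> nat" where
  "shape_rank d T w = fam_rank d T (expo w) (dim1 w) (dim2 w) (dim3 w)"

definition arank :: "nat \<Rightarrow> (nat \<Rightarrow> nat \<Rightarrow> nat \<Rightarrow> 'a::field) \<Rightarrow> shape \<Rightarrow> real" where
  "arank d T w = lim (\<lambda>n. root n (real (shape_rank d T (w ^ n))))"

lemma shape_rank_rotate: "shape_rank d (rotate T) (rot w) = shape_rank d T w"
  by (simp add: shape_rank_def fam_rank_rotate)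

lemma arank_rotate: "arank d (rotate T) (rot w) = arank d T w"
  unfolding arank_def rot_power[symmetric] shape_rank_rotate ..

lemma shape_rank_mult: "shape_rank d T (v * w) \<le> shape_rank d T v * shape_rank d T w"
  by (simp add: shape_rank_def fam_rank_mult_le)

text \<open>For T = 0 the positive powers have rank 0 and asymptotic rank is not a functional
  bounded below by 1; the main proof treats this case directly.\<close>

definition nonzero_tensor :: "nat \<Rightarrow> (nat \<Rightarrow> nat \<Rightarrow> nat \<Rightarrow> 'a::field) \<Rightarrow> bool" where
  "nonzero_tensor d T \<longleftrightarrow> (\<exists>a<d. \<exists>b<d. \<exists>c<d. T a b c \<noteq> 0)"

lemma nonzero_tensor_rotate: "nonzero_tensor d (rotate T) \<longleftrightarrow> nonzero_tensor d T"
  unfolding nonzero_tensor_def rotate_def by blast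

context
  fixes d :: nat and T :: "nat \<Rightarrow> nat \<Rightarrow> nat \<Rightarrow> 'a::field"
  assumes nonzero: "nonzero_tensor d T"
begin

lemma shape_rank_ge_1: "1 \<le> shape_rank d T w"
proof (rule ccontr)
  obtain a0 b0 c0 where T: "T a0 b0 c0 \<noteq> 0" "a0 < d" "b0 < d" "c0 < d"
    using nonzero unfolding nonzero_tensor_def by blast
  assume "\<not> ?thesis"
  then have r: "fam_rank d T (expo w) (dim1 w) (dim2 w) (dim3 w) = 0" by (simp add: shape_rank_def)
  let ?r = "\<lambda>a. (replicate (expo w) a, 0, 0)"
  have "fam_tensor T (expo w) (?r a0) (?r b0) (?r c0) = 0"
  proof -
    have "?r a0 \<in> fam_index d (expo w) (dim1 w) (dim2 w)" "?r b0 \<in> fam_index d (expo w) (dim2 w) (dim3 w)"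
      "?r c0 \<in> fam_index d (expo w) (dim3 w) (dim1 w)"
      using T dim_pos[of w] by (auto simp: fam_index_def index_pow_def)
    then show ?thesis
      using has_rank_fam[of d "expo w" "dim1 w" "dim2 w" "dim3 w" T] unfolding r has_rank_def by simp
  qed
  moreover have "fam_tensor T (expo w) (?r a0) (?r b0) (?r c0) = T a0 b0 c0 ^ expo w"
    by (simp add: fam_tensor_def kron_pow_def matmul_tensor_def)
  ultimately show False using T by simp
qed

text \<open>A nonzero entry of T supplies the missing factors: fixing the last \<open>q\<close>
  coordinates of each mode there multiplies the tensor by a nonzero scalar, which is divided out
  again.\<close>

lemma shape_rank_mono:
  assumes "shape_le v w"
  shows "shape_rank d T v \<le> shape_rank d T w"
proof -
  obtain a0 b0 c0 where T: "T a0 b0 c0 \<noteq> 0" "a0 < d" "b0 < d" "c0 < d"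
    using nonzero unfolding nonzero_tensor_def by blast
  obtain q where q: "expo w = expo v + q" using assms le_Suc_ex by (auto simp: shape_le_def)
  have "shape_rank d T v \<le> fam_rank d T (expo v) (dim1 w) (dim2 w) (dim3 w)"
    unfolding shape_rank_def by (rule fam_rank_mono) (use assms in \<open>auto simp: shape_le_def\<close>)
  also have "\<dots> \<le> fam_rank d T (expo w) (dim1 w) (dim2 w) (dim3 w)"
  proof (rule fam_rank_le, rule has_rank_reindex[OF has_rank_scale[OF has_rank_fam, of _ _ _ _ _ "inverse (T a0 b0 c0 ^ q)"], where f = "\<lambda>(xs, i). (xs @ replicate q a0, i)"
        and g = "\<lambda>(xs, i). (xs @ replicate q b0, i)" and h = "\<lambda>(xs, i). (xs @ replicate q c0, i)"], goal_cases)
    case (4 a b c)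
    obtain xs i ys j zs l where abc: "a = (xs, i)" "b = (ys, j)" "c = (zs, l)" by (metis prod.collapse)
    have len: "length xs = expo v" "length ys = expo v" "length zs = expo v"
      using 4 by (auto simp: abc fam_index_def index_pow_def)
    have "kron_pow (expo v + q) T (xs @ replicate q a0) (ys @ replicate q b0) (zs @ replicate q c0)
      = kron_pow (expo v) T xs ys zs * T a0 b0 c0 ^ q"
      using kron_pow_add[of "xs @ replicate q a0" "expo v" q "ys @ replicate q b0" "zs @ replicate q c0" T] len
      by (simp add: kron_pow_def)
    then show ?case using T by (simp add: abc fam_tensor_def q)
  qed (use T in \<open>auto simp: fam_index_def index_pow_def q\<close>)
  finally show ?thesis by (simp add: shape_rank_def)
qed

lemma arank_tendsto: "(\<lambda>n. root n (real (shape_rank d T (w ^ n)))) \<longlonglongrightarrow> arank d T w"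
proof -
  have "\<exists>x\<ge>1. (\<lambda>n. root n (real (shape_rank d T (w ^ n)))) \<longlonglongrightarrow> x"
    by (rule fekete) (use shape_rank_ge_1 shape_rank_mult in \<open>simp_all add: power_add flip: of_nat_mult\<close>)
  then show ?thesis unfolding arank_def by (auto simp: limI)
qed

lemma functional_arank: "shape.functional (arank d T)"
  unfolding shape.functional_def
proof (intro conjI allI impI)
  fix v w
  show "arank d T (v * w) \<le> arank d T v * arank d T w"
  proof (rule LIMSEQ_le[OF arank_tendsto tendsto_mult[OF arank_tendsto arank_tendsto]], intro exI allI impI)
    fix n :: nat assume n: "1 \<le> n"
    have "real (shape_rank d T ((v * w) ^ n)) \<le> real (shape_rank d T (v ^ n)) * real (shape_rank d T (w ^ n))"
      using shape_rank_mult[of d T "v ^ n" "w ^ n"] by (simp add: power_mult_distrib flip: of_nat_mult)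
    then show "root n (real (shape_rank d T ((v * w) ^ n)))
        \<le> root n (real (shape_rank d T (v ^ n))) * root n (real (shape_rank d T (w ^ n)))"
      using n by (simp flip: real_root_mult)
  qed
next
  fix w and k :: nat
  show "arank d T (w ^ k) = arank d T w ^ k"
  proof (cases "k = 0")
    case True
    have "shape_rank d T 1 \<le> 1"
      unfolding shape_rank_def
      by (intro fam_rank_le has_rankI_sum[where S = "{()}" and u = "\<lambda>_ _. 1" and v = "\<lambda>_ _. 1" and w = "\<lambda>_ _. 1"])
         (auto simp: fam_index_def fam_tensor_def kron_pow_0 matmul_tensor_def)
    then have "shape_rank d T 1 = 1" using shape_rank_ge_1[of 1] by simp
    then have "(\<lambda>n. root n (real (shape_rank d T (1 ^ n)))) \<longlonglongrightarrow> 1"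
      by (intro tendsto_eventually eventually_mono[OF eventually_gt_at_top[of 0]]) simp
    then show ?thesis using LIMSEQ_unique[OF arank_tendsto[of 1]] True by simp
  next
    case False
    then have "filterlim (\<lambda>n. k * n) sequentially sequentially"
      by (intro mult_nat_left_at_top) auto
    from tendsto_power[OF filterlim_compose[OF arank_tendsto[of w] this], of k]
    have "(\<lambda>n. root (k * n) (real (shape_rank d T (w ^ (k * n)))) ^ k) \<longlonglongrightarrow> arank d T w ^ k" .
    moreover have "eventually (\<lambda>n. root (k * n) (real (shape_rank d T (w ^ (k * n)))) ^ k
        = root n (real (shape_rank d T ((w ^ k) ^ n)))) sequentially"
      using eventually_gt_at_top[of 0]
      by eventually_elim (use False in \<open>simp add: power_mult real_root_mult_exp\<close>)
    ultimately show ?thesis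
      using LIMSEQ_unique[OF arank_tendsto[of "w ^ k"]] by (auto dest: Lim_transform_eventually)
  qed
next
  fix v w assume "shape_le v w"
  then have "shape_le (v ^ n) (w ^ n)" for n
    by (simp add: shape_le_def power_mono)
  then show "arank d T v \<le> arank d T w"
    by (intro LIMSEQ_le[OF arank_tendsto arank_tendsto]) (auto intro!: exI[of _ 1] shape_rank_mono)
qed

text \<open>The limit may be approached from above, so some slack \<open>x\<close> is needed;
  \<open>K\<close> takes care of the finitely many small \<open>n\<close>.\<close>

lemma shape_rank_le_power:
  assumes "arank d T w < x"
  shows "\<exists>K>0. \<forall>n. real (shape_rank d T (w ^ n)) \<le> K * x ^ n"
proof -
  have x: "1 \<le> x" using shape.functionalD(5)[OF functional_arank, of w] assms by linarith
  have "eventually (\<lambda>n. root n (real (shape_rank d T (w ^ n))) < x) sequentially"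
    using order_tendstoD(2)[OF arank_tendsto assms] .
  then obtain n0 where n0: "\<And>n. n \<ge> n0 \<Longrightarrow> root n (real (shape_rank d T (w ^ n))) < x"
    by (auto simp: eventually_sequentially)
  define K where "K = 1 + (\<Sum>n\<le>n0. real (shape_rank d T (w ^ n)))"
  have "real (shape_rank d T (w ^ n)) \<le> K * x ^ n" for n
  proof (cases "n \<le> n0")
    case True
    then have "real (shape_rank d T (w ^ n)) \<le> K"
      unfolding K_def using member_le_sum[of n "{..n0}" "\<lambda>n. real (shape_rank d T (w ^ n))"] by simp
    also have "\<dots> \<le> K * x ^ n"
      using mult_left_mono[OF one_le_power[OF x, of n], of K] by (simp add: K_def sum_nonneg)
    finally show ?thesis .
  next
    case False
    then have "root n (real (shape_rank d T (w ^ n))) ^ n \<le> x ^ n"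
      using n0[of n] by (intro power_mono) auto
    then have "real (shape_rank d T (w ^ n)) \<le> x ^ n" using False by simp
    also have "\<dots> \<le> K * x ^ n" using x by (simp add: K_def sum_nonneg)
    finally show ?thesis .
  qed
  moreover have "K > 0" by (simp add: K_def add_pos_nonneg sum_nonneg)
  ultimately show ?thesis by blast
qed

lemma arank_le_of_power_bound:
  assumes "0 < K" "0 \<le> x" and "\<And>n. real (shape_rank d T (w ^ n)) \<le> K * x ^ n"
  shows "arank d T w \<le> x"
proof (rule LIMSEQ_le[OF arank_tendsto])
  show "(\<lambda>n. root n K * x) \<longlonglongrightarrow> x"
    using tendsto_mult[OF LIMSEQ_root_const[OF \<open>0 < K\<close>] tendsto_const[of x]] by simp
  have "root n (real (shape_rank d T (w ^ n))) \<le> root n K * x" if "1 \<le> n" for n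
  proof -
    have "root n (real (shape_rank d T (w ^ n))) \<le> root n (K * x ^ n)"
      using that assms(3) by simp
    also have "\<dots> = root n K * x" using that assms(2) by (simp add: real_root_mult real_root_power_cancel)
    finally show ?thesis .
  qed
  then show "\<exists>N. \<forall>n\<ge>N. root n (real (shape_rank d T (w ^ n))) \<le> root n K * x" by blast
qed

end

section \<open>From the degeneration to an inequality of asymptotic ranks\<close>

lemma le_of_power_le:
  fixes A B K :: real
  assumes "0 \<le> A" "0 \<le> B" "0 < K" and le: "\<And>N. 1 \<le> N \<Longrightarrow> A ^ N \<le> K * real N ^ 3 * B ^ N"
  shows "A \<le> B"
proof (rule LIMSEQ_le_const)
  have "(\<lambda>N. root N K * root N (real N) ^ 3 * B) \<longlonglongrightarrow> 1 * 1 ^ 3 * B"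
    by (intro tendsto_mult tendsto_power tendsto_const LIMSEQ_root LIMSEQ_root_const assms)
  then show "(\<lambda>N. root N K * root N (real N) ^ 3 * B) \<longlonglongrightarrow> B" by simp
  have "A \<le> root N K * root N (real N) ^ 3 * B" if "1 \<le> N" for N
  proof -
    have N: "0 < N" using that by simp
    have "A = root N (A ^ N)" using N assms(1) by (simp add: real_root_power_cancel)
    also have "\<dots> \<le> root N (K * real N ^ 3 * B ^ N)" using N le[OF that] by simp
    also have "\<dots> = root N K * root N (real N) ^ 3 * B"
      using N assms(2) by (simp add: real_root_mult real_root_power real_root_power_cancel)
    finally show ?thesis .
  qed
  then show "\<exists>N. \<forall>n\<ge>N. A \<le> root n K * root n (real n) ^ 3 * B" by blast
qed

lemma prod_zeros: "(\<Prod>t<length v. if v ! t = 0 then x else y) = x ^ zeros v * y ^ (length v - zeros v)"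
  for x y :: "'a::comm_semiring_1"
proof (induction v)
  case (Cons a v)
  have "zeros v \<le> length v" by (rule count_le_length)
  then show ?case using Cons
    by (simp add: prod.lessThan_Suc_shift Suc_diff_le mult_ac del: prod.lessThan_Suc)
qed simp

lemma sum_words: "(\<Sum>v\<in>index_pow N {..s}. x ^ zeros v * y ^ (N - zeros v)) = (x + real s * y) ^ N"
  for x y :: real
proof -
  have "(\<Sum>v\<in>index_pow N {..s}. x ^ zeros v * y ^ (N - zeros v)) = (\<Sum>v\<in>index_pow N {..s}. \<Prod>t<N. if v ! t = 0 then x else y)"
    by (rule sum.cong) (auto simp: index_pow_def prod_zeros[symmetric])
  also have "\<dots> = (\<Prod>t<N. \<Sum>l\<le>s. if l = 0 then x else y)"
    by (rule prod_sum_lists[symmetric]) simp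
  also have "(\<Sum>l\<le>s. if l = 0 then x else y) = x + real s * y"
    by (simp add: sum.atMost_shift)
  finally show ?thesis by simp
qed

lemma sum_words_by_zeros:
  "(\<Sum>k\<le>N. real (card {w \<in> index_pow N {..s}. zeros w = k}) * (x ^ k * y ^ (N - k))) = (x + real s * y) ^ N"
  for x y :: real
proof -
  have "zeros v \<le> N" if "v \<in> index_pow N {..s}" for v
    using that count_le_length[of v 0] by (auto simp: index_pow_def)
  then have "(\<Sum>k\<le>N. \<Sum>w\<in>{w \<in> index_pow N {..s}. zeros w = k}. x ^ zeros w * y ^ (N - zeros w))
      = (\<Sum>v\<in>index_pow N {..s}. x ^ zeros v * y ^ (N - zeros v))"
    by (intro sum.group finite_index_pow) auto
  moreover have "(\<Sum>w\<in>{w \<in> index_pow N {..s}. zeros w = k}. x ^ zeros w * y ^ (N - zeros w))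
      = real (card {w \<in> index_pow N {..s}. zeros w = k}) * (x ^ k * y ^ (N - k))" for k
    by simp
  ultimately show ?thesis by (simp add: sum_words)
qed

text \<open>Compare \<open>N\<close>-th powers. On the right, a word with z zeros contributes
  \<open>B ^ z * C ^ (N - z)\<close>, and all words together essentially (x + s y)^N. On the left,
  the words with \<open>k\<close> zeros are equal copies, to which Schoenhage's argument applies;
  weighted by their number, the terms a^k b^(N - k) add up to (a + s b)^N. Taking
  \<open>N\<close>-th roots removes the polynomial losses.\<close>

lemma sum_ineq_arank:
  fixes T :: "nat \<Rightarrow> nat \<Rightarrow> nat \<Rightarrow> 'a::field"
  assumes T: "nonzero_tensor d T"
  shows "shape.sum_ineq (arank d T) (Shape 2 1 1 1) (Shape 0 1 1 (2 * d * d)) (Shape 0 d d (d * d)) (Shape 0 1 1 (d * d)) (real (d div 3))"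
  unfolding shape.sum_ineq_def
proof (intro allI impI)
  fix U and a b :: real
  define s g D where "s = d div 3" and "g = 2 * d * d" and "D = d * d"
  assume a: "0 \<le> a" and b: "0 \<le> b" and "\<forall>k j. a ^ k * b ^ j
      \<le> arank d T (U ^ (k + j) * Shape 2 1 1 1 ^ k * Shape 0 1 1 (2 * d * d) ^ j)"
  then have ab: "a ^ k * b ^ j \<le> arank d T (U ^ (k + j) * Shape 2 1 1 1 ^ k * Shape 0 1 1 g ^ j)" for k j
    by (simp add: g_def)
  have "0 < d" "0 < g" "0 < D" using T by (auto simp: g_def D_def nonzero_tensor_def)
  define B where "B = U * Shape 0 d d D"
  define C where "C = U * Shape 0 1 1 D"
  obtain Y where Y: "\<And>v. v \<le> s \<Longrightarrow> mmform (core_dim d v) (core_dim d v) D (Y v)"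
    and core: "\<And>x y z. x \<in> core_x d s \<Longrightarrow> y \<in> core_y d s g \<Longrightarrow> z \<in> core_y d s g \<Longrightarrow>
      \<exists>q. (\<Sum>v\<le>s. Y v x y z) = monom 1 2 * q \<and> coeff q 0 = core_tensor T x y z"
    using core_degeneration[of d T] unfolding s_def g_def D_def by blast
  define R where "R N = (\<Sum>v\<in>index_pow N {..s}. fam_rank d T (expo U * N) (d ^ zeros v * dim1 U ^ N) (d ^ zeros v * dim2 U ^ N) (D ^ N * dim3 U ^ N))" for N
  define W where "W N k = {w \<in> index_pow N {..s}. zeros w = k}" for N k
  have lower: "real (card (W N k)) * (a ^ k * b ^ (N - k)) \<le> real ((2 * N + 1)\<^sup>2 * R N) + real (card (W N k))" if "k \<le> N" for N k
  proof (cases "W N k = {}")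
    case False
    have fin: "finite (W N k)" by (simp add: W_def finite_index_pow)
    define w where "w = U ^ N * Shape 2 1 1 1 ^ k * Shape 0 1 1 g ^ (N - k)"
    have w: "expo w = expo U * N + 2 * k" "dim1 w = dim1 U ^ N" "dim2 w = dim2 U ^ N" "dim3 w = dim3 U ^ N * g ^ (N - k)"
      using \<open>0 < g\<close> by (simp_all add: w_def)
    \<comment> \<open>The quotient rounded up generously. The \<open>+ 1\<close> gives the bound
      that \<open>schonhage\<close> asks for and costs the extra summand
      \<open>card (W N k)\<close>, which is harmless in the sum over \<open>k\<close>.\<close>
    define e where "e = (2 * N + 1)\<^sup>2 * R N div card (W N k) + 1"
    have "0 < card (W N k)" using False fin by (simp add: card_gt_0_iff)
    then have e: "(2 * N + 1)\<^sup>2 * R N \<le> e * card (W N k)" "e * card (W N k) \<le> (2 * N + 1)\<^sup>2 * R N + card (W N k)"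
      unfolding e_def using dividend_less_div_times[of "card (W N k)" "(2 * N + 1)\<^sup>2 * R N"]
      by (auto simp: algebra_simps)
    have "has_rank (fam_index d (expo w) (dim1 w) (dim2 w) \<times> W N k) (fam_index d (expo w) (dim2 w) (dim3 w) \<times> W N k)
        (fam_index d (expo w) (dim3 w) (dim1 w) \<times> W N k) (dsum (fam_tensor T (expo w))) ((2 * N + 1)\<^sup>2 * R N)"
      unfolding w R_def W_def by (rule has_rank_words[OF \<open>0 < g\<close> \<open>k \<le> N\<close> Y core])
    from schonhage[OF fin False this e(1)]
    have "shape_rank d T (w ^ L) \<le> e ^ L * card (W N k)" for L
      by (simp add: shape_rank_def)
    then have "real (shape_rank d T (w ^ L)) \<le> real (card (W N k)) * real e ^ L" for L
      by (metis mult.commute of_nat_le_iff of_nat_mult of_nat_power)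
    then have "arank d T w \<le> real e"
      using \<open>0 < card (W N k)\<close> by (intro arank_le_of_power_bound[OF T, of "real (card (W N k))"]) auto
    moreover have "a ^ k * b ^ (N - k) \<le> arank d T w"
      using ab[of k "N - k"] that by (simp add: w_def)
    ultimately have "real (card (W N k)) * (a ^ k * b ^ (N - k)) \<le> real (card (W N k)) * real e"
      by (intro mult_left_mono) auto
    also have "\<dots> \<le> real ((2 * N + 1)\<^sup>2 * R N) + real (card (W N k))"
      using e(2) by (simp flip: of_nat_mult of_nat_add add: mult.commute)
    finally show ?thesis .
  qed simp
  have "a + real s * b \<le> arank d T B + real s * arank d T C + \<epsilon>" if "0 < \<epsilon>" for \<epsilon>
  proof -
    \<comment> \<open>The error occurs once in \<open>x\<close> and \<open>s\<close> times in
      \<open>y\<close>, so it adds up to \<epsilon>.\<close>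
    define \<delta> where "\<delta> = \<epsilon> / (1 + real s)"
    have "0 < \<delta>" using that by (simp add: \<delta>_def)
    define x y where "x = arank d T B + \<delta>" and "y = arank d T C + \<delta>"
    have xy: "1 \<le> x" "1 \<le> y" "arank d T B < x" "arank d T C < y"
      using shape.functionalD(5)[OF functional_arank[OF T], of B] shape.functionalD(5)[OF functional_arank[OF T], of C] \<open>0 < \<delta>\<close>
      by (auto simp: x_def y_def)
    obtain Kx where Kx: "0 < Kx" "\<And>n. real (shape_rank d T (B ^ n)) \<le> Kx * x ^ n"
      using shape_rank_le_power[OF T xy(3)] by blast
    obtain Ky where Ky: "0 < Ky" "\<And>n. real (shape_rank d T (C ^ n)) \<le> Ky * y ^ n"
      using shape_rank_le_power[OF T xy(4)] by blast
    have R: "real (R N) \<le> Kx * Ky * (x + real s * y) ^ N" for N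
    proof -
      have "real (fam_rank d T (expo U * N) (d ^ zeros v * dim1 U ^ N) (d ^ zeros v * dim2 U ^ N) (D ^ N * dim3 U ^ N))
          \<le> Kx * Ky * (x ^ zeros v * y ^ (N - zeros v))" if "v \<in> index_pow N {..s}" for v
      proof -
        have z: "zeros v \<le> N" using that count_le_length[of v 0] by (auto simp: index_pow_def)
        have "B ^ zeros v * C ^ (N - zeros v) = U ^ N * Shape 0 d d D ^ zeros v * Shape 0 1 1 D ^ (N - zeros v)"
        proof -
          have "U ^ N = U ^ zeros v * U ^ (N - zeros v)" using z by (simp flip: power_add)
          then show ?thesis by (simp add: B_def C_def power_mult_distrib mult_ac)
        qed
        moreover have "D ^ N = D ^ zeros v * D ^ (N - zeros v)" using z by (simp flip: power_add)
        ultimately have "fam_rank d T (expo U * N) (d ^ zeros v * dim1 U ^ N) (d ^ zeros v * dim2 U ^ N) (D ^ N * dim3 U ^ N)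
            = shape_rank d T (B ^ zeros v * C ^ (N - zeros v))"
          using \<open>0 < d\<close> \<open>0 < D\<close> by (simp add: shape_rank_def mult_ac)
        also have "real \<dots> \<le> real (shape_rank d T (B ^ zeros v)) * real (shape_rank d T (C ^ (N - zeros v)))"
          using shape_rank_mult by (simp flip: of_nat_mult)
        also have "\<dots> \<le> (Kx * x ^ zeros v) * (Ky * y ^ (N - zeros v))"
          using Kx Ky xy by (intro mult_mono) auto
        finally show ?thesis by (simp add: mult_ac)
      qed
      then have "real (R N) \<le> (\<Sum>v\<in>index_pow N {..s}. Kx * Ky * (x ^ zeros v * y ^ (N - zeros v)))"
        unfolding R_def of_nat_sum by (rule sum_mono)
      then show ?thesis by (simp only: sum_distrib_left[symmetric] sum_words)
    qed
    \<comment> \<open>The cubic factor collects the \<open>N + 1\<close> values of \<open>k\<close>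
      and the square from the extraction of coefficients: for \<open>N\<close> at least 1, (N + 1)
      (2 N + 1)^2 <= 2 N (3 N)^2 = 18 N^3. The additional 1 pays for the rounding in
      \<open>e\<close>, whose total (1 + s)^N is at most \<open>?Z\<close> because \<open>x\<close>
      and \<open>y\<close> are at least 1.\<close>
    have "(a + real s * b) ^ N \<le> (18 * (Kx * Ky) + 1) * real N ^ 3 * (x + real s * y) ^ N" if "1 \<le> N" for N
    proof -
      let ?Z = "(x + real s * y) ^ N"
      have Z: "(1 + real s) ^ N \<le> ?Z"
        using xy by (intro power_mono add_mono) (auto simp: mult_le_cancel_left1)
      have "0 \<le> ?Z" using xy by simp
      have "(a + real s * b) ^ N = (\<Sum>k\<le>N. real (card (W N k)) * (a ^ k * b ^ (N - k)))"
        unfolding W_def by (rule sum_words_by_zeros[symmetric])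
      also have "\<dots> \<le> (\<Sum>k\<le>N. real ((2 * N + 1)\<^sup>2 * R N) + real (card (W N k)))"
        by (rule sum_mono) (use lower in auto)
      also have "\<dots> = real (N + 1) * real ((2 * N + 1)\<^sup>2) * real (R N) + (1 + real s) ^ N"
        using sum_words_by_zeros[of N s 1 1] by (simp add: sum.distrib W_def mult.assoc)
      also have "\<dots> \<le> (18 * real N ^ 3) * (Kx * Ky * ?Z) + real N ^ 3 * ?Z"
      proof (rule add_mono)
        have "(N + 1) * (2 * N + 1)\<^sup>2 \<le> (2 * N) * (3 * N)\<^sup>2"
          using that by (intro mult_mono power_mono) auto
        also have "\<dots> = 18 * N ^ 3" by (simp add: power2_eq_square power3_eq_cube)
        finally have "real ((N + 1) * (2 * N + 1)\<^sup>2) \<le> real (18 * N ^ 3)"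
          by (simp only: of_nat_le_iff)
        then have "real (N + 1) * real ((2 * N + 1)\<^sup>2) \<le> 18 * real N ^ 3"
          by (simp only: of_nat_mult[of "N + 1"] of_nat_mult[of 18] of_nat_power[of N 3] of_nat_numeral)
        from mult_mono[OF this R[of N]]
        show "real (N + 1) * real ((2 * N + 1)\<^sup>2) * real (R N) \<le> (18 * real N ^ 3) * (Kx * Ky * ?Z)"
          by simp
        have "1 \<le> real N ^ 3" using that by simp
        then show "(1 + real s) ^ N \<le> real N ^ 3 * ?Z"
          using Z \<open>0 \<le> ?Z\<close> mult_right_mono[of 1 "real N ^ 3" ?Z] by simp
      qed
      also have "\<dots> = (18 * (Kx * Ky) + 1) * real N ^ 3 * ?Z" by (simp add: algebra_simps)
      finally show ?thesis .
    qed
    note power = this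
    have "0 < Kx * Ky" using Kx(1) Ky(1) by simp
    then have "0 < 18 * (Kx * Ky) + 1" by linarith
    moreover have "0 \<le> a + real s * b" "0 \<le> x + real s * y" using a b xy by auto
    ultimately have "a + real s * b \<le> x + real s * y" by (intro le_of_power_le[OF _ _ _ power])
    also have "\<dots> = arank d T B + real s * arank d T C + (1 + real s) * \<delta>"
      by (simp add: x_def y_def algebra_simps)
    also have "(1 + real s) * \<delta> = \<epsilon>" by (simp add: \<delta>_def)
    finally show ?thesis .
  qed
  then show "a + real (d div 3) * b \<le> arank d T (U * Shape 0 d d (d * d)) + real (d div 3) * arank d T (U * Shape 0 1 1 (d * d))"
    unfolding B_def C_def D_def s_def by (rule field_le_epsilon)
qed

lemma sum_ineq_rotate:
  assumes "shape.sum_ineq (arank d (rotate T)) (rot X) (rot Y) (rot B) (rot C) s"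
  shows "shape.sum_ineq (arank d T) X Y B C s"
  using assms unfolding shape.sum_ineq_def
  by (metis arank_rotate rot_mult rot_power)

section \<open>The exponent of matrix multiplication\<close>

text \<open>With fewer than n^2 terms, some nonzero matrix \<mu> is annihilated by all first-mode
  forms of the decomposition, so contraction with \<mu> gives 0. But the tensor determines \<mu>:
  the coordinates (j, i) and (i, i) of the other modes read off its entry at (i, j).\<close>

lemma matmul_rank_ge: "n * n \<le> matmul_rank TYPE('a::field) n n n"
proof (rule ccontr)
  assume less: "\<not> ?thesis"
  let ?I = "{..<n} \<times> {..<n}"
  define r where "r = matmul_rank TYPE('a) n n n"
  have "has_rank ?I ?I ?I (matmul_tensor :: _ \<Rightarrow> _ \<Rightarrow> _ \<Rightarrow> 'a) r"
    unfolding r_def matmul_rank_def by (intro has_rank_tensor_rank) auto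
  then obtain u v w where uvw: "\<And>a b c. a \<in> ?I \<Longrightarrow> b \<in> ?I \<Longrightarrow> c \<in> ?I \<Longrightarrow>
      (matmul_tensor a b c :: 'a) = (\<Sum>s<r. u s a * v s b * w s c)"
    unfolding has_rank_def by blast
  have "card {..<r} + 1 \<le> card ?I" using less by (simp add: r_def card_cartesian_product)
  from homogeneous_system[OF finite_lessThan finite_cartesian_product[OF finite_lessThan finite_lessThan] this, of u]
  obtain J \<mu> where J: "J \<subseteq> ?I" "card J = 1"
    and sys: "\<forall>j\<in>J. (\<forall>s\<in>{..<r}. (\<Sum>i\<in>?I. u s i * \<mu> j i) = 0) \<and> (\<forall>j'\<in>J. \<mu> j j' = (if j' = j then 1 else 0))"
    by (elim exE conjE)
  obtain p where p: "J = {p}" using J(2) card_1_singletonE by blast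
  obtain i j where ij: "p = (i, j)" "i < n" "j < n" using J(1) p by auto
  have ker: "(\<Sum>q\<in>?I. u s q * \<mu> p q) = 0" if "s < r" for s using sys p that by auto
  have one: "\<mu> p p = 1" using sys p by auto
  have mem: "(j, i) \<in> ?I" "(i, i) \<in> ?I" using ij by auto
  have "(\<Sum>q\<in>?I. \<mu> p q * matmul_tensor q (j, i) (i, i)) = (\<Sum>q\<in>?I. if q = p then \<mu> p q else 0)"
    by (rule sum.cong) (auto simp: matmul_tensor_def ij split: if_splits)
  also have "\<dots> = 1" using ij one by (simp add: sum.delta)
  finally have "1 = (\<Sum>q\<in>?I. \<Sum>s<r. \<mu> p q * (u s q * v s (j, i) * w s (i, i)))"
    using uvw[OF _ mem] by (simp add: sum_distrib_left)
  also have "\<dots> = (\<Sum>s<r. \<Sum>q\<in>?I. \<mu> p q * (u s q * v s (j, i) * w s (i, i)))" by (rule sum.swap)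
  also have "\<dots> = (\<Sum>s<r. (\<Sum>q\<in>?I. u s q * \<mu> p q) * (v s (j, i) * w s (i, i)))"
    unfolding sum_distrib_right by (intro sum.cong refl) (simp only: mult_ac)
  also have "\<dots> = 0" using ker by simp
  finally show False by simp
qed

lemma matmul_rank_le: "matmul_rank TYPE('a::field) n n n \<le> n ^ 3"
proof -
  let ?I = "{..<n} \<times> {..<n}"
  have "has_rank ?I ?I ?I (matmul_tensor :: _ \<Rightarrow> _ \<Rightarrow> _ \<Rightarrow> 'a) (n ^ 3)"
  proof (rule has_rankI_sum[where S = "{..<n} \<times> ({..<n} \<times> {..<n})"
        and u = "\<lambda>(i, j, k) a. if a = (i, j) then 1 else 0"
        and v = "\<lambda>(i, j, k) b. if b = (j, k) then 1 else 0"
        and w = "\<lambda>(i, j, k) c. if c = (k, i) then 1 else 0"])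
    fix a b c assume "a \<in> ?I" "b \<in> ?I" "c \<in> ?I"
    then obtain i j j' k k' i' where [simp]: "a = (i, j)" "b = (j', k)" "c = (k', i')" and lt: "i < n" "j < n" "k < n" by auto
    have "(\<Sum>s\<in>{..<n} \<times> ({..<n} \<times> {..<n}). (case s of (i, j, k) \<Rightarrow> \<lambda>a. if a = (i, j) then 1 else 0) a *
        (case s of (i, j, k) \<Rightarrow> \<lambda>b. if b = (j, k) then 1 else 0) b * (case s of (i, j, k) \<Rightarrow> \<lambda>c. if c = (k, i) then 1 else 0) c)
      = (\<Sum>s\<in>{..<n} \<times> ({..<n} \<times> {..<n}). if s = (i, j, k) then matmul_tensor a b c else (0 :: 'a))"
      by (rule sum.cong) (auto simp: matmul_tensor_def split: if_splits)
    then show "matmul_tensor a b c = (\<Sum>s\<in>{..<n} \<times> ({..<n} \<times> {..<n}). (case s of (i, j, k) \<Rightarrow> \<lambda>a. if a = (i, j) then 1 else 0) a *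
        (case s of (i, j, k) \<Rightarrow> \<lambda>b. if b = (j, k) then 1 else 0) b * (case s of (i, j, k) \<Rightarrow> \<lambda>c. if c = (k, i) then 1 else (0 :: 'a)) c)"
      using lt by (simp add: sum.delta)
  qed (auto simp: card_cartesian_product power3_eq_cube)
  then show ?thesis unfolding matmul_rank_def by (rule tensor_rank_le)
qed

text \<open>The set defining the exponent contains 3 and is bounded below by 2, so its infimum is
  meaningful. The last part turns the eventual bound into one valid for every positive
  \<open>n\<close>.\<close>

lemma matmul_exponent_facts:
  shows "2 \<le> matmul_exponent TYPE('a::field)" "matmul_exponent TYPE('a) \<le> 3"
    and "matmul_exponent TYPE('a) < \<tau> \<Longrightarrow> \<exists>K>0. \<forall>n\<ge>1. real (matmul_rank TYPE('a) n n n) \<le> K * real n powr \<tau>"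
proof -
  define M where "M n = real (matmul_rank TYPE('a) n n n)" for n
  define S where "S = {\<tau>::real. M \<in> O(\<lambda>n. real n powr \<tau>)}"
  have \<omega>: "matmul_exponent TYPE('a) = Inf S" unfolding matmul_exponent_def S_def M_def ..
  have M: "real n ^ 2 \<le> M n" "M n \<le> real n ^ 3" for n
    using matmul_rank_ge[of n, where 'a = 'a] matmul_rank_le[of n, where 'a = 'a]
    unfolding M_def by (simp_all add: power2_eq_square flip: of_nat_mult of_nat_power)
  have "3 \<in> S"
    unfolding S_def mem_Collect_eq
  proof (rule bigoI[of _ 1], rule eventually_mono[OF eventually_gt_at_top[of 0]])
    fix n :: nat assume "0 < n"
    then have "real n powr 3 = real n ^ 3" using powr_realpow[of "real n" 3] by simp
    then show "norm (M n) \<le> 1 * norm (real n powr 3)" using M(2)[of n] by (simp add: M_def)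
  qed
  have ge2: "2 \<le> \<tau>" if "\<tau> \<in> S" for \<tau>
  proof (rule ccontr)
    assume "\<not> 2 \<le> \<tau>"
    obtain c where c: "c > 0" "eventually (\<lambda>n. norm (M n) \<le> c * norm (real n powr \<tau>)) sequentially"
      using \<open>\<tau> \<in> S\<close> unfolding S_def by (auto elim: landau_o.bigE)
    have "(\<lambda>n. real n powr (\<tau> - 2)) \<longlonglongrightarrow> 0"
      using \<open>\<not> 2 \<le> \<tau>\<close> by (intro tendsto_neg_powr filterlim_real_sequentially) auto
    then have "eventually (\<lambda>n. real n powr (\<tau> - 2) < 1 / c) sequentially"
      using c(1) by (intro order_tendstoD(2)) auto
    with c(2) have "eventually (\<lambda>n. False) sequentially"
      using eventually_gt_at_top[of 0]
    proof eventually_elim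
      case (elim n)
      have "real n ^ 2 \<le> c * real n powr \<tau>" using order_trans[OF M(1)[of n], of "c * real n powr \<tau>"] elim(1) by (simp only: M_def) simp
      also have "real n powr \<tau> = real n powr (\<tau> - 2) * real n ^ 2"
      proof -
        have "real n ^ 2 = real n powr 2" using elim by simp
        then show ?thesis by (simp only: powr_add[symmetric]) simp
      qed
      also have "c * (real n powr (\<tau> - 2) * real n ^ 2) < c * (1 / c * real n ^ 2)"
        using elim c(1) by (intro mult_strict_left_mono mult_strict_right_mono) auto
      also have "\<dots> = real n ^ 2" using c(1) by simp
      finally show False by simp
    qed
    then show False by simp
  qed
  have bdd: "bdd_below S" by (rule bdd_belowI[of _ 2]) (rule ge2)
  show "2 \<le> matmul_exponent TYPE('a)" unfolding \<omega> by (rule cInf_greatest) (use \<open>3 \<in> S\<close> ge2 in auto)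
  show "matmul_exponent TYPE('a) \<le> 3" unfolding \<omega> by (rule cInf_lower[OF \<open>3 \<in> S\<close> bdd])
  show "\<exists>K>0. \<forall>n\<ge>1. real (matmul_rank TYPE('a) n n n) \<le> K * real n powr \<tau>" if less: "matmul_exponent TYPE('a) < \<tau>"
  proof -
    obtain \<sigma> where \<sigma>: "\<sigma> \<in> S" "\<sigma> < \<tau>"
      using cInf_lessD[of S \<tau>] less \<open>3 \<in> S\<close> unfolding \<omega> by auto
    obtain c where c: "c > 0" "eventually (\<lambda>n. norm (M n) \<le> c * norm (real n powr \<sigma>)) sequentially"
      using \<sigma>(1) unfolding S_def by (auto elim: landau_o.bigE)
    then obtain n0 where n0: "\<And>n. n \<ge> n0 \<Longrightarrow> M n \<le> c * real n powr \<sigma>"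
      unfolding eventually_sequentially M_def by auto
    \<comment> \<open>The summand \<open>real n0 ^ 3\<close> covers \<open>n < n0\<close> through
      the cubic bound, since \<open>real n powr \<tau>\<close> is at least 1.\<close>
    define K where "K = c + real n0 ^ 3"
    have "M n \<le> K * real n powr \<tau>" if "n \<ge> 1" for n
    proof (cases "n \<ge> n0")
      case True
      have "M n \<le> c * real n powr \<sigma>" by (rule n0[OF True])
      also have "\<dots> \<le> K * real n powr \<tau>"
        using c(1) \<sigma>(2) that by (intro mult_mono powr_mono) (auto simp: K_def)
      finally show ?thesis .
    next
      case False
      have "M n \<le> real n ^ 3" by (rule M(2))
      also have "\<dots> \<le> real n0 ^ 3" using False by (intro power_mono) auto
      also have "\<dots> \<le> K * 1" using c(1) by (simp add: K_def)
      also have "\<dots> \<le> K * real n powr \<tau>"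
        using c(1) \<sigma> ge2[OF \<sigma>(1)] that by (intro mult_left_mono ge_one_powr_ge_zero) (auto simp: K_def)
      finally show ?thesis .
    qed
    moreover have "K > 0" using c(1) by (simp add: K_def add_pos_nonneg)
    ultimately show ?thesis unfolding M_def by blast
  qed
qed

text \<open>The assumption bounds \<open>q\<close> by y^3 x - s x^2 (X - 1), and the claim is the
  same expression with x = y and X = Y. So it has to be shown that s (y^2 (Y - 1) - x^2 (X - 1)) <=
  y^3 (y - x): split off y - x on the left and compare s (3 Y - 2) with y^2.\<close>

lemma exponent_bound:
  fixes \<alpha> \<omega> q :: real and d :: nat
  assumes d: "3 \<le> d" and \<omega>: "2 \<le> \<omega>" "\<omega> \<le> 3" and \<alpha>: "0 \<le> \<alpha>" "\<alpha> \<le> \<omega> / 3"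
    and q: "q + real (d div 3) * real (2 * d * d) powr \<alpha> \<le> real d powr \<omega> * real d powr \<alpha> + real (d div 3) * real (d * d) powr \<alpha>"
  shows "q \<le> real d powr (4/3 * \<omega>) - real (d div 3) * (2 powr (\<omega> / 3) - 1) * real d powr (2/3 * \<omega>)"
proof -
  define \<tau> where "\<tau> = \<omega> / 3"
  define s where "s = real (d div 3)"
  define x y X Y where "x = real d powr \<alpha>" and "y = real d powr \<tau>" and "X = 2 powr \<alpha>" and "Y = 2 powr \<tau>"
  note defs = x_def y_def X_def Y_def
  have d0: "real d > 0" "1 \<le> real d" using d by auto
  have pos: "0 < x" "x \<le> y" "1 \<le> X" "X \<le> Y" "1 \<le> Y" "Y \<le> 2" "0 \<le> s"
    using d0 \<alpha> \<omega> by (auto simp: defs \<tau>_def s_def ge_one_powr_ge_zero intro: powr_mono order_trans[OF powr_mono[of "\<omega> / 3" 1 2]])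
  \<comment> \<open>Raising the exponent from \<alpha> to \<tau> enlarges the power of
    \<open>d\<close> at least as much as that of 2.\<close>
  have "x * Y \<le> X * y"
  proof -
    have "2 powr (\<tau> - \<alpha>) \<le> real d powr (\<tau> - \<alpha>)" using \<alpha> d by (intro powr_mono2) (auto simp: \<tau>_def)
    then have "Y / X \<le> y / x" by (simp add: defs powr_diff)
    then show ?thesis using pos by (simp add: field_simps)
  qed
  have yy: "real d * (Y - 2/3) \<le> y * y"
  proof -
    \<comment> \<open>The number 4/3 bounds Y - 2/3, as Y <= 2. Its cube 64/27 is below 3, hence
      below \<open>d\<close>, and the exponent 2 \<tau> - 1 is at least 1/3 because \<omega> is at
      least 2.\<close>
    have "4 / 3 = ((4 / 3) powr 3) powr (1 / 3 :: real)" unfolding powr_powr by simp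
    also have "(4 / 3 :: real) powr 3 = 64 / 27" using powr_realpow[of "4/3" 3] by (simp add: power3_eq_cube)
    also have "(64 / 27) powr (1 / 3) \<le> real d powr (1 / 3)" using d by (intro powr_mono2) auto
    also have "\<dots> \<le> real d powr (2 * \<tau> - 1)" using d0 \<omega> by (intro powr_mono) (auto simp: \<tau>_def)
    finally have "4 / 3 \<le> real d powr (2 * \<tau> - 1)" .
    then have "real d * (Y - 2/3) \<le> real d * real d powr (2 * \<tau> - 1)"
      using pos d0 by (intro mult_left_mono) auto
    also have "\<dots> = y * y" using d0 by (simp add: y_def powr_diff powr_add[symmetric])
    finally show ?thesis .
  qed
  have "s \<le> real d / 3" unfolding s_def by linarith
  then have "s * (3 * Y - 2) \<le> real d / 3 * (3 * Y - 2)" using pos by (intro mult_right_mono) auto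
  also have "\<dots> \<le> y * y" using yy by (simp add: algebra_simps)
  finally have key: "s * (3 * Y - 2) \<le> y * y" .
  \<comment> \<open>Passing through x^2 Y separates the change of x from that of X; the second part
    also acquires the factor y - x through \<open>x * Y \<le> X * y\<close>.\<close>
  have "y * y * (Y - 1) - x * x * (X - 1) = (y - x) * ((y + x) * (Y - 1)) + x * (x * Y - x * X)"
    by (simp add: algebra_simps)
  also have "\<dots> \<le> (y - x) * ((y + x) * (Y - 1)) + x * (X * y - x * X)"
    using pos \<open>x * Y \<le> X * y\<close> by (intro add_left_mono mult_left_mono) auto
  also have "\<dots> = (y - x) * ((y + x) * (Y - 1) + x * X)" by (simp add: algebra_simps)
  also have "\<dots> \<le> (y - x) * ((y + y) * (Y - 1) + y * Y)"
    using pos by (intro mult_left_mono add_mono mult_right_mono mult_mono) auto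
  also have "\<dots> = (y - x) * y * (3 * Y - 2)" by (simp add: algebra_simps)
  finally have "s * (y * y * (Y - 1) - x * x * (X - 1)) \<le> s * ((y - x) * y * (3 * Y - 2))"
    using pos by (intro mult_left_mono) auto
  also have "\<dots> = (y - x) * y * (s * (3 * Y - 2))" by (simp add: mult_ac)
  also have "\<dots> \<le> (y - x) * y * (y * y)" using key pos by (intro mult_left_mono) auto
  finally have fin: "y * y * y * x - s * (x * x * (X - 1)) \<le> y * y * y * y - s * (y * y * (Y - 1))"
    by (simp add: algebra_simps)
  have "real d powr \<omega> = y * y * y" using d0 by (simp add: y_def \<tau>_def powr_add[symmetric])
  moreover have "real (2 * d * d) powr \<alpha> = X * x * x" "real (d * d) powr \<alpha> = x * x"
    using d0 by (simp_all add: defs powr_mult)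
  ultimately have "q \<le> y * y * y * x - s * (x * x * (X - 1))" using q by (simp add: s_def defs algebra_simps)
  also note fin
  also have "y * y * y * y = real d powr (4/3 * \<omega>)" using d0 by (simp add: y_def \<tau>_def powr_add[symmetric])
  also have "y * y = real d powr (2/3 * \<omega>)" using d0 by (simp add: y_def \<tau>_def powr_add[symmetric])
  finally show ?thesis by (simp add: s_def Y_def \<tau>_def mult_ac)
qed

section \<open>The bound\<close>

text \<open>Powers of <n, n, n> are again square matrix products. The exponent is an infimum that
  need not be attained, so the bound is proved for every larger \<tau> and passed to the
  limit.\<close>

lemma arank_matmul_le:
  fixes T :: "nat \<Rightarrow> nat \<Rightarrow> nat \<Rightarrow> 'a::field"
  assumes T: "nonzero_tensor d T" and n: "0 < n"
  shows "arank d T (Shape 0 n n n) \<le> real n powr matmul_exponent TYPE('a)"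
proof -
  let ?\<omega> = "matmul_exponent TYPE('a)"
  have le: "arank d T (Shape 0 n n n) \<le> real n powr \<tau>" if "?\<omega> < \<tau>" for \<tau>
  proof -
    obtain K where K: "0 < K" "\<And>n. 1 \<le> n \<Longrightarrow> real (matmul_rank TYPE('a) n n n) \<le> K * real n powr \<tau>"
      using matmul_exponent_facts(3)[OF \<open>?\<omega> < \<tau>\<close>] by blast
    have "real (shape_rank d T (Shape 0 n n n ^ L)) \<le> K * (real n powr \<tau>) ^ L" for L
    proof -
      have *: "has_rank ({..<n^L} \<times> {..<n^L}) ({..<n^L} \<times> {..<n^L}) ({..<n^L} \<times> {..<n^L})
          (matmul_tensor :: _ \<Rightarrow> _ \<Rightarrow> _ \<Rightarrow> 'a) (matmul_rank TYPE('a) (n ^ L) (n ^ L) (n ^ L))"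
        unfolding matmul_rank_def by (intro has_rank_tensor_rank) auto
      have "fam_rank d T 0 (n ^ L) (n ^ L) (n ^ L) \<le> matmul_rank TYPE('a) (n ^ L) (n ^ L) (n ^ L)"
        by (rule fam_rank_le, rule has_rank_reindex[OF *, where f = snd and g = snd and h = snd])
           (auto simp: fam_index_def fam_tensor_def kron_pow_0)
      then have "real (shape_rank d T (Shape 0 n n n ^ L)) \<le> real (matmul_rank TYPE('a) (n ^ L) (n ^ L) (n ^ L))"
        using n by (simp add: shape_rank_def)
      also have "\<dots> \<le> K * real (n ^ L) powr \<tau>" using n by (intro K(2)) (simp add: Suc_leI)
      also have "real (n ^ L) powr \<tau> = (real n powr \<tau>) ^ L"
        using n by (simp add: powr_realpow[symmetric] powr_powr mult.commute)
      finally show ?thesis .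
    qed
    then show ?thesis using K(1) n by (intro arank_le_of_power_bound[OF T, of K]) auto
  qed
  show ?thesis
  proof (rule LIMSEQ_le_const)
    have "(\<lambda>k. ?\<omega> + inverse (real (Suc k))) \<longlonglongrightarrow> ?\<omega> + 0"
      by (intro tendsto_add tendsto_const LIMSEQ_inverse_real_of_nat)
    then show "(\<lambda>k. real n powr (?\<omega> + inverse (real (Suc k)))) \<longlonglongrightarrow> real n powr ?\<omega>"
      using n by (intro tendsto_powr tendsto_const) auto
    show "\<exists>N. \<forall>k\<ge>N. arank d T (Shape 0 n n n) \<le> real n powr (?\<omega> + inverse (real (Suc k)))"
      by (intro exI allI impI le) simp
  qed
qed

lemma asymptotic_rank_eq_arank:
  "asymptotic_rank {..<d} {..<d} {..<d} T = arank d T (Shape 1 1 1 1)"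
proof -
  have "tensor_rank (index_pow n {..<d}) (index_pow n {..<d}) (index_pow n {..<d}) (kron_pow n T)
      = shape_rank d T (Shape 1 1 1 1 ^ n)" for n
  proof (rule antisym)
    have "shape_rank d T (Shape 1 1 1 1 ^ n) = fam_rank d T n 1 1 1" by (simp add: shape_rank_def)
    then have *: "has_rank (fam_index d n 1 1) (fam_index d n 1 1) (fam_index d n 1 1) (fam_tensor T n) (shape_rank d T (Shape 1 1 1 1 ^ n))"
      using has_rank_fam[of d n 1 1 1 T] by (simp only:)
    show "tensor_rank (index_pow n {..<d}) (index_pow n {..<d}) (index_pow n {..<d}) (kron_pow n T) \<le> shape_rank d T (Shape 1 1 1 1 ^ n)"
      by (rule tensor_rank_le, rule has_rank_reindex[OF *, where f = "\<lambda>xs. (xs, 0, 0)" and g = "\<lambda>xs. (xs, 0, 0)" and h = "\<lambda>xs. (xs, 0, 0)"])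
         (auto simp: fam_index_def fam_tensor_def matmul_tensor_def)
    have "fam_rank d T n 1 1 1 \<le> tensor_rank (index_pow n {..<d}) (index_pow n {..<d}) (index_pow n {..<d}) (kron_pow n T)"
      by (rule fam_rank_le, rule has_rank_reindex[OF has_rank_tensor_rank, where f = fst and g = fst and h = fst])
         (auto simp: fam_index_def fam_tensor_def matmul_tensor_def finite_index_pow)
    then show "shape_rank d T (Shape 1 1 1 1 ^ n) \<le> tensor_rank (index_pow n {..<d}) (index_pow n {..<d}) (index_pow n {..<d}) (kron_pow n T)"
      by (simp add: shape_rank_def)
  qed
  then show ?thesis by (simp add: asymptotic_rank_def arank_def)
qed

lemma asymptotic_rank_zero:
  assumes "\<not> nonzero_tensor d T"
  shows "asymptotic_rank {..<d} {..<d} {..<d} T = 0"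
proof -
  have "tensor_rank (index_pow n {..<d}) (index_pow n {..<d}) (index_pow n {..<d}) (kron_pow n T) = 0" if "0 < n" for n
  proof -
    have "kron_pow n T xs ys zs = 0" if "xs \<in> index_pow n {..<d}" "ys \<in> index_pow n {..<d}" "zs \<in> index_pow n {..<d}" for xs ys zs
    proof -
      have "T (xs ! 0) (ys ! 0) (zs ! 0) = 0"
        using assms that[THEN index_pow_nth, OF \<open>0 < n\<close>] by (auto simp: nonzero_tensor_def)
      then show ?thesis using \<open>0 < n\<close> by (auto simp: kron_pow_def intro!: prod_zero)
    qed
    then have "has_rank (index_pow n {..<d}) (index_pow n {..<d}) (index_pow n {..<d}) (kron_pow n T) 0"
      by (simp add: has_rank_def)
    then show ?thesis using tensor_rank_le by blast
  qed
  then have "(\<lambda>n. root n (real (tensor_rank (index_pow n {..<d}) (index_pow n {..<d}) (index_pow n {..<d}) (kron_pow n T)))) \<longlonglongrightarrow> 0"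
    by (intro tendsto_eventually eventually_mono[OF eventually_gt_at_top[of 0]]) auto
  then show ?thesis unfolding asymptotic_rank_def by (rule limI)
qed

text \<open>\<open>sum_ineq\<close> is used with U = 1, a = t^2 and b =
  \<open>\<Phi> (e (2 * d * d))\<close>. Multiplicativity along T makes its hypothesis an equality:
  the factors T are pulled out one by one, and a pure power of \<open>e (2 * d * d)\<close> remains,
  where homogeneity suffices.\<close>

lemma axis_bound:
  fixes e :: "nat \<Rightarrow> shape"
  assumes \<Phi>: "shape.functional \<Phi>" and V: "\<And>w. \<Phi> (Shape 1 1 1 1 * w) = t * \<Phi> w"
    and ineq: "shape.sum_ineq \<Phi> (Shape 2 1 1 1) (e (2 * d * d)) (Shape 0 d d d * e d) (e (d * d)) s"
    and e: "\<And>n k. 0 < n \<Longrightarrow> e (n ^ k) = e n ^ k" "\<And>m n. 0 < m \<Longrightarrow> m \<le> n \<Longrightarrow> shape_le (e m) (e n)"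
    and "0 < d" and \<omega>: "\<Phi> (Shape 0 d d d) \<le> real d powr \<omega>"
  shows "t\<^sup>2 + s * real (2 * d * d) powr log 2 (\<Phi> (e 2))
    \<le> real d powr \<omega> * real d powr log 2 (\<Phi> (e 2)) + s * real (d * d) powr log 2 (\<Phi> (e 2))"
proof -
  note F = shape.functionalD[OF \<Phi>]
  have law: "\<Phi> (e n) = real n powr log 2 (\<Phi> (e 2))" if "0 < n" for n
    by (rule power_law) (use that F e in auto)
  have Vk: "\<Phi> (Shape 1 1 1 1 ^ k * w) = t ^ k * \<Phi> w" for k w
    by (induction k) (simp_all only: power_0 mult_1_left power_Suc mult.assoc V)
  have X: "Shape 2 1 1 1 ^ k = Shape 1 1 1 1 ^ (2 * k)" for k
    by (rule shape_eqI) auto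
  have "(t\<^sup>2) ^ k * \<Phi> (e (2 * d * d)) ^ j \<le> \<Phi> (1 ^ (k + j) * Shape 2 1 1 1 ^ k * e (2 * d * d) ^ j)" for k j
  proof -
    have "\<Phi> (1 ^ (k + j) * Shape 2 1 1 1 ^ k * e (2 * d * d) ^ j) = t ^ (2 * k) * \<Phi> (e (2 * d * d)) ^ j"
      by (simp only: power_one mult_1_left X Vk F(2))
    then show ?thesis by (simp only: power_mult order_refl)
  qed
  moreover have "0 \<le> \<Phi> (e (2 * d * d))" using F(5)[of "e (2 * d * d)"] by linarith
  ultimately have "t\<^sup>2 + s * \<Phi> (e (2 * d * d)) \<le> \<Phi> (1 * (Shape 0 d d d * e d)) + s * \<Phi> (1 * e (d * d))"
    using ineq unfolding shape.sum_ineq_def by (meson zero_le_power2)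
  moreover have "\<Phi> (Shape 0 d d d * e d) \<le> real d powr \<omega> * \<Phi> (e d)"
    using F(1)[of "Shape 0 d d d" "e d"] mult_right_mono[OF \<omega>, of "\<Phi> (e d)"] F(5)[of "e d"] by linarith
  moreover have "\<Phi> (e (2 * d * d)) = real (2 * d * d) powr log 2 (\<Phi> (e 2))" "\<Phi> (e d) = real d powr log 2 (\<Phi> (e 2))"
    "\<Phi> (e (d * d)) = real (d * d) powr log 2 (\<Phi> (e 2))"
    by (rule law; use \<open>0 < d\<close> in simp)+
  ultimately show ?thesis by (simp only: mult_1_left)
qed

theorem theorem1p5:
  fixes d :: nat and T :: "nat \<Rightarrow> nat \<Rightarrow> nat \<Rightarrow> 'a::field" and \<omega> :: real
  assumes "d \<ge> 3"
    and "\<omega> = matmul_exponent TYPE('a)"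
  shows "asymptotic_rank {..<d} {..<d} {..<d} T
           \<le> sqrt (real d powr (4/3 * \<omega>)
                   - real_of_int \<lfloor>real d / 3\<rfloor> * (2 powr (\<omega> / 3) - 1) * real d powr (2/3 * \<omega>))
       \<and> sqrt (real d powr (4/3 * \<omega>)
               - real_of_int \<lfloor>real d / 3\<rfloor> * (2 powr (\<omega> / 3) - 1) * real d powr (2/3 * \<omega>))
           < real d powr (2/3 * \<omega>)"
proof
  have \<omega>: "2 \<le> \<omega>" "\<omega> \<le> 3" using matmul_exponent_facts(1,2)[where 'a = 'a] assms(2) by auto
  have floor: "real_of_int \<lfloor>real d / 3\<rfloor> = real (d div 3)"
    using floor_divide_of_nat_eq[of d 3, where 'a = real] by simp
  let ?R = "real d powr (4/3 * \<omega>) - real (d div 3) * (2 powr (\<omega> / 3) - 1) * real d powr (2/3 * \<omega>)"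
  have "sqrt ?R < real d powr (2/3 * \<omega>)"
  proof -
    have "1 < (2 :: real) powr (\<omega> / 3)" using \<omega> by (simp add: gr_one_powr)
    moreover have "1 \<le> real (d div 3)" using assms(1) by (simp add: Suc_le_eq div_greater_zero_iff)
    ultimately have "0 < real (d div 3) * (2 powr (\<omega> / 3) - 1) * real d powr (2/3 * \<omega>)"
      using assms(1) by (intro mult_pos_pos) auto
    moreover have "real d powr (4/3 * \<omega>) = (real d powr (2/3 * \<omega>))\<^sup>2"
      by (simp add: power2_eq_square flip: powr_add)
    ultimately have "sqrt ?R < sqrt ((real d powr (2/3 * \<omega>))\<^sup>2)" by (intro real_sqrt_less_mono) simp
    then show ?thesis by simp
  qed
  then show "sqrt (real d powr (4/3 * \<omega>) - real_of_int \<lfloor>real d / 3\<rfloor> * (2 powr (\<omega> / 3) - 1) * real d powr (2/3 * \<omega>))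
      < real d powr (2/3 * \<omega>)" unfolding floor .
  have "asymptotic_rank {..<d} {..<d} {..<d} T \<le> sqrt ?R"
  proof (cases "nonzero_tensor d T")
    case False
    \<comment> \<open>The asymptotic rank is 0 here, so the radicand must be shown nonnegative:
      \<open>sqrt\<close> of a negative real is negative.\<close>
    have "(2 :: real) powr (\<omega> / 3) \<le> 2 powr 1" using \<omega> by (intro powr_mono) auto
    moreover have "(1 :: real) \<le> 2 powr (\<omega> / 3)" using \<omega> by (intro ge_one_powr_ge_zero) auto
    ultimately have "real (d div 3) * (2 powr (\<omega> / 3) - 1) \<le> real d * 1" by (intro mult_mono) auto
    also have "\<dots> = real d powr 1" by simp
    also have "\<dots> \<le> real d powr (2/3 * \<omega>)" using assms(1) \<omega> by (intro powr_mono) auto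
    finally have "real (d div 3) * (2 powr (\<omega> / 3) - 1) * real d powr (2/3 * \<omega>)
        \<le> real d powr (2/3 * \<omega>) * real d powr (2/3 * \<omega>)"
      by (intro mult_right_mono) auto
    also have "\<dots> = real d powr (4/3 * \<omega>)" by (simp flip: powr_add)
    finally have "0 \<le> ?R" by simp
    then show ?thesis using asymptotic_rank_zero[OF False] by simp
  next
    case T: True
    define s where "s = real (d div 3)"
    define X where "X = Shape 2 1 1 1"
    define E1 E2 E3 where "E1 n = Shape 0 n 1 1" and "E2 n = Shape 0 1 n 1" and "E3 n = Shape 0 1 1 n" for n
    note E = E1_def E2_def E3_def
    have "0 < d" using assms(1) by simp
    define t where "t = arank d T (Shape 1 1 1 1)"
    have B: "Shape 0 d d d * E1 d = Shape 0 (d * d) d d" "Shape 0 d d d * E2 d = Shape 0 d (d * d) d" "Shape 0 d d d * E3 d = Shape 0 d d (d * d)"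
      by (rule shape_eqI; use \<open>0 < d\<close> in \<open>simp add: E\<close>)+
    have base: "shape.functional (arank d T)" by (rule functional_arank[OF T])
    \<comment> \<open>Stated for every nonzero tensor, since the other two directions follow by
      applying it to \<open>rotate T\<close> and to its rotation.\<close>
    have ineq3: "shape.sum_ineq (arank d T) X (E3 (2 * d * d)) (Shape 0 d d d * E3 d) (E3 (d * d)) s" if "nonzero_tensor d T"
      for T :: "nat \<Rightarrow> nat \<Rightarrow> nat \<Rightarrow> 'a"
      unfolding X_def E s_def B[unfolded E] by (rule sum_ineq_arank[OF that])
    have rots: "rot X = X" "rot (E1 n) = E3 n" "rot (E2 n) = E1 n" "rot (Shape 0 d d d) = Shape 0 d d d" if "0 < n" for n
      by (rule shape_eqI; use \<open>0 < d\<close> that in \<open>simp add: E X_def\<close>)+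
    have ineq1: "shape.sum_ineq (arank d T) X (E1 (2 * d * d)) (Shape 0 d d d * E1 d) (E1 (d * d)) s" if "nonzero_tensor d T"
      for T :: "nat \<Rightarrow> nat \<Rightarrow> nat \<Rightarrow> 'a"
      by (rule sum_ineq_rotate) (use ineq3[of "rotate T"] that \<open>0 < d\<close> in \<open>simp add: rots rot_mult nonzero_tensor_rotate\<close>)
    have ineq2: "shape.sum_ineq (arank d T) X (E2 (2 * d * d)) (Shape 0 d d d * E2 d) (E2 (d * d)) s"
      by (rule sum_ineq_rotate) (use ineq1[of "rotate T"] T \<open>0 < d\<close> in \<open>simp add: rots rot_mult nonzero_tensor_rotate\<close>)
    \<comment> \<open>The derivative along T comes first: it fixes the value \<open>t\<close> on T,
      and the later ones preserve it. Two dimensions are then enough, because in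
      \<open>E1 2 * (E2 2 * E3 2)\<close> pulling out two factors leaves the third alone.\<close>
    define \<Phi>1 where "\<Phi>1 = shape.deriv_fun (arank d T) (Shape 1 1 1 1)"
    define \<Phi>2 where "\<Phi>2 = shape.deriv_fun \<Phi>1 (E1 2)"
    define \<Phi> where "\<Phi> = shape.deriv_fun \<Phi>2 (E2 2)"
    have f1: "shape.functional \<Phi>1" unfolding \<Phi>1_def by (rule shape.functional_deriv[OF base])
    have f2: "shape.functional \<Phi>2" unfolding \<Phi>2_def by (rule shape.functional_deriv[OF f1])
    have f: "shape.functional \<Phi>" unfolding \<Phi>_def by (rule shape.functional_deriv[OF f2])
    have ineqs: "shape.sum_ineq \<Phi> X (E1 (2 * d * d)) (Shape 0 d d d * E1 d) (E1 (d * d)) s"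
      "shape.sum_ineq \<Phi> X (E2 (2 * d * d)) (Shape 0 d d d * E2 d) (E2 (d * d)) s"
      "shape.sum_ineq \<Phi> X (E3 (2 * d * d)) (Shape 0 d d d * E3 d) (E3 (d * d)) s"
      unfolding \<Phi>_def \<Phi>2_def \<Phi>1_def
      by (intro shape.sum_ineq_deriv base f1[unfolded \<Phi>1_def] f2[unfolded \<Phi>2_def \<Phi>1_def] ineq1[OF T] ineq2 ineq3[OF T])+
    have V1: "\<Phi>1 (Shape 1 1 1 1 * w) = t * \<Phi>1 w" for w
      unfolding \<Phi>1_def t_def by (rule shape.deriv_fun_mult[OF base])
    have V1': "\<Phi>1 (Shape 1 1 1 1) = t" using V1[of 1] shape.functionalD(4)[OF f1] by simp
    have V2: "\<Phi>2 (Shape 1 1 1 1 * w) = t * \<Phi>2 w" for w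
      unfolding \<Phi>2_def using shape.deriv_fun_mult_other[OF f1] V1 V1' by metis
    have V2': "\<Phi>2 (Shape 1 1 1 1) = t" using V2[of 1] shape.functionalD(4)[OF f2] by simp
    have V: "\<Phi> (Shape 1 1 1 1 * w) = t * \<Phi> w" for w
      unfolding \<Phi>_def using shape.deriv_fun_mult_other[OF f2] V2 V2' by metis
    have W2: "\<Phi>2 (E1 2 * w) = \<Phi>1 (E1 2) * \<Phi>2 w" for w
      unfolding \<Phi>2_def by (rule shape.deriv_fun_mult[OF f1])
    have W2': "\<Phi>2 (E1 2) = \<Phi>1 (E1 2)" using W2[of 1] shape.functionalD(4)[OF f2] by simp
    have W: "\<Phi> (E1 2 * w) = \<Phi>2 (E1 2) * \<Phi> w" for w
      unfolding \<Phi>_def using shape.deriv_fun_mult_other[OF f2] W2 W2' by metis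
    have W': "\<Phi> (E1 2) = \<Phi>2 (E1 2)" using W[of 1] shape.functionalD(4)[OF f] by simp
    have Z: "\<Phi> (E2 2 * w) = \<Phi>2 (E2 2) * \<Phi> w" for w
      unfolding \<Phi>_def by (rule shape.deriv_fun_mult[OF f2])
    have Z': "\<Phi> (E2 2) = \<Phi>2 (E2 2)" using Z[of 1] shape.functionalD(4)[OF f] by simp
    have le: "\<Phi> w \<le> arank d T w" for w
      using shape.deriv_fun_le_self[OF base, of "Shape 1 1 1 1" w] shape.deriv_fun_le_self[OF f1, of "E1 2" w]
        shape.deriv_fun_le_self[OF f2, of "E2 2" w] by (simp add: \<Phi>_def \<Phi>2_def \<Phi>1_def)
    have mm: "\<Phi> (Shape 0 n n n) \<le> real n powr \<omega>" if "0 < n" for n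
      using le[of "Shape 0 n n n"] arank_matmul_le[OF T that] assms(2) by simp
    have pows: "E1 (n ^ k) = E1 n ^ k" "E2 (n ^ k) = E2 n ^ k" "E3 (n ^ k) = E3 n ^ k" if "0 < n" for n k
      by (rule shape_eqI; use that in \<open>simp add: E\<close>)+
    have les: "shape_le (E1 m) (E1 n)" "shape_le (E2 m) (E2 n)" "shape_le (E3 m) (E3 n)" if "0 < m" "m \<le> n" for m n
      using that by (auto simp: E shape_le_def)
    define \<alpha>1 \<alpha>2 \<alpha>3 where "\<alpha>1 = log 2 (\<Phi> (E1 2))" and "\<alpha>2 = log 2 (\<Phi> (E2 2))" and "\<alpha>3 = log 2 (\<Phi> (E3 2))"
    have pos: "0 < \<Phi> w" "1 \<le> \<Phi> w" for w using shape.functionalD(5)[OF f, of w] by auto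
    have bounds: "t\<^sup>2 + s * real (2 * d * d) powr \<alpha> \<le> real d powr \<omega> * real d powr \<alpha> + s * real (d * d) powr \<alpha>"
      if "\<alpha> \<in> {\<alpha>1, \<alpha>2, \<alpha>3}" for \<alpha>
      using that axis_bound[OF f V ineqs(1)[unfolded X_def] pows(1) les(1) \<open>0 < d\<close> mm[OF \<open>0 < d\<close>]]
        axis_bound[OF f V ineqs(2)[unfolded X_def] pows(2) les(2) \<open>0 < d\<close> mm[OF \<open>0 < d\<close>]]
        axis_bound[OF f V ineqs(3)[unfolded X_def] pows(3) les(3) \<open>0 < d\<close> mm[OF \<open>0 < d\<close>]]
      unfolding \<alpha>1_def \<alpha>2_def \<alpha>3_def by blast
    have "Shape 0 2 2 2 = E1 2 * (E2 2 * E3 2)" by (rule shape_eqI) (auto simp: E)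
    then have "\<Phi> (Shape 0 2 2 2) = \<Phi> (E1 2) * (\<Phi> (E2 2) * \<Phi> (E3 2))"
      by (simp add: W Z W' Z')
    then have "log 2 (\<Phi> (Shape 0 2 2 2)) = \<alpha>1 + \<alpha>2 + \<alpha>3"
      using pos(1) by (simp add: \<alpha>1_def \<alpha>2_def \<alpha>3_def log_mult_pos)
    moreover have "log 2 (\<Phi> (Shape 0 2 2 2)) \<le> \<omega>"
      using mm[of 2] pos(1) by (simp add: log_le_iff)
    ultimately have "\<alpha>1 \<le> \<omega> / 3 \<or> \<alpha>2 \<le> \<omega> / 3 \<or> \<alpha>3 \<le> \<omega> / 3" by linarith
    then obtain \<alpha> where \<alpha>: "\<alpha> \<in> {\<alpha>1, \<alpha>2, \<alpha>3}" "\<alpha> \<le> \<omega> / 3" by blast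
    have "0 \<le> \<alpha>" using \<alpha>(1) by (auto simp: \<alpha>1_def \<alpha>2_def \<alpha>3_def pos)
    have "t\<^sup>2 \<le> ?R"
      by (rule exponent_bound[OF assms(1) \<omega> \<open>0 \<le> \<alpha>\<close> \<alpha>(2)]) (use bounds[OF \<alpha>(1)] in \<open>simp add: s_def\<close>)
    then show ?thesis
      unfolding asymptotic_rank_eq_arank t_def[symmetric] by (rule real_le_rsqrt)
  qed
  then show "asymptotic_rank {..<d} {..<d} {..<d} T
      \<le> sqrt (real d powr (4/3 * \<omega>) - real_of_int \<lfloor>real d / 3\<rfloor> * (2 powr (\<omega> / 3) - 1) * real d powr (2/3 * \<omega>))"
    unfolding floor .
qed

end
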